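(* Let $p$ be a prime number and let $\Gamma_p:\mathbb{Z}_p\to\mathbb{Z}_p$ be the Morita $p$-adic gamma function. Then $\Gamma_p$ is differentially transcendental over $\mathbb{C}_p(X)$; that is, there is no nonzero polynomial $P(X,Y_0,Y_1,\ldots,Y_n)$ with coefficients in $\mathbb{C}_p$ (for any $n\ge 0$) such that $P(x,\Gamma_p(x),\Gamma_p'(x),\ldots,\Gamma_p^{(n)}(x))=0$ for all $x\in\mathbb{Z}_p$.
   Context: $\mathbb{Z}_p$ denotes the ring of $p$-adic integers, $\mathbb{Z}_p^{\times}$ its group of units, and $\mathbb{C}_p$ the completion of an algebraic closure of $\mathbb{Q}_p$. The Morita $p$-adic gamma function $\Gamma_p:\mathbb{Z}_p\to\mathbb{Z}_p$ is the unique continuous function with $\Gamma_p(n)=(-1)^n\prod_{1\le j<n,\ p\nmid j} j$ for integers $n\ge 2$. It takes values in $\mathbb{Z}_p^{\times}$ and satisfies $\Gamma_p(x+1)=-x\,\Gamma_p(x)$ for $x\in\mathbb{Z}_p^{\times}$ and $\Gamma_p(x+1)=-\Gamma_p(x)$ for $x\in p\mathbb{Z}_p$. Derivatives are the usual $p$-adic derivatives. An element $f$ of a differential field extension $L$ of a differential field $K$ is differentially algebraic over $K$ if $P(f,f',\ldots,f^{(m)})=0$ for some nonzero differential polynomial $P\in K\{Y\}$, and differentially transcendental otherwise; here $K=\mathbb{C}_p(X)$ with derivation $d/dX$. *)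

theory Defs
  imports
    "HOL-Analysis.Analysis"
    "HOL-Computational_Algebra.Computational_Algebra"
    "HOL-Library.Poly_Mapping"
begin

text \<open>
  The library constant \<open>norm\<close> is constrained to real normed vector spaces, which a nonarchimedean
  field cannot be, so the absolute value gets its own name.
\<close>

class nonarch_field = field_char_0 + metric_space +
  fixes absval :: "'a \<Rightarrow> real"
  assumes dist_absval: "dist x y = absval (x - y)"
    and absval_mult: "absval (x * y) = absval x * absval y"
    and absval_add: "absval (x + y) \<le> max (absval x) (absval y)"

definition padic_abs :: "nat \<Rightarrow> rat \<Rightarrow> real" where
  "padic_abs p r =
    (if r = 0 then 0
     else let (a, b) = quotient_of r
          in real p powi (int (multiplicity (int p) b) - int (multiplicity (int p) a)))"

text \<open>
  If \<open>'a\<close> is complete and its absolute value restricts to the \<open>p\<close>-adic one on the rationals,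
  then the closure of the rationals in \<open>'a\<close> is their \<open>p\<close>-adic completion. The prime \<open>p\<close> is
  determined by the absolute value of \<open>'a\<close>, so it is not an argument of the next three constants.
\<close>

definition padic_numbers :: "'a::nonarch_field set" where
  "padic_numbers = closure \<rat>"

definition padic_integers :: "'a::nonarch_field set" where
  "padic_integers = {x \<in> padic_numbers. absval x \<le> 1}"

definition padic_algebraic_numbers :: "'a::nonarch_field set" where
  "padic_algebraic_numbers =
    {x. \<exists>q. q \<noteq> 0 \<and> (\<forall>i. coeff q i \<in> padic_numbers) \<and> poly q x = 0}"

text \<open>
  \<open>is_padic_complex p TYPE('a)\<close> says that \<open>'a\<close> is a completion of an algebraic closure of the
  field of \<open>p\<close>-adic numbers: \<open>'a\<close> is complete, its absolute value extends the \<open>p\<close>-adic one, the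
  elements of \<open>'a\<close> algebraic over the \<open>p\<close>-adic numbers form an algebraically closed field (hence
  an algebraic closure), and they are dense in \<open>'a\<close>. This determines \<open>'a\<close> up to isometric
  isomorphism.
\<close>

definition is_padic_complex :: "nat \<Rightarrow> 'a::nonarch_field itself \<Rightarrow> bool" where
  "is_padic_complex p (K :: 'a itself) \<longleftrightarrow>
     (\<forall>r. absval (of_rat r :: 'a) = padic_abs p r) \<and>
     complete (UNIV :: 'a set) \<and>
     (\<forall>q :: 'a poly. degree q > 0 \<longrightarrow> (\<forall>i. coeff q i \<in> padic_algebraic_numbers) \<longrightarrow>
        (\<exists>x \<in> padic_algebraic_numbers. poly q x = 0)) \<and>
     closure (padic_algebraic_numbers :: 'a set) = UNIV"

text \<open>
  Functions on the \<open>p\<close>-adic integers are total functions on \<open>'a\<close>; membership in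
  \<open>\<rightarrow>\<^sub>E\<close> fixes the value outside the domain, which makes the description unique.
\<close>

definition morita_gamma :: "nat \<Rightarrow> 'a::nonarch_field \<Rightarrow> 'a" where
  "morita_gamma p =
    (THE g. g \<in> padic_integers \<rightarrow>\<^sub>E padic_integers \<and>
       continuous_on padic_integers g \<and>
       (\<forall>n\<ge>2. g (of_nat n) = (-1) ^ n * (\<Prod>j | 1 \<le> j \<and> j < n \<and> \<not> p dvd j. of_nat j)))"

definition deriv_on :: "'a::nonarch_field set \<Rightarrow> ('a \<Rightarrow> 'a) \<Rightarrow> 'a \<Rightarrow> 'a" where
  "deriv_on S f x = Lim (at x within S) (\<lambda>y. (f y - f x) / (y - x))"

text \<open>
  Multivariate polynomials are finitely supported maps from monomials to coefficients, a monomial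
  being a finitely supported map from variable indices to exponents.
\<close>

type_synonym 'a mpolynomial = "(nat \<Rightarrow>\<^sub>0 nat) \<Rightarrow>\<^sub>0 'a"

definition mpoly_vars :: "'a::zero mpolynomial \<Rightarrow> nat set" where
  "mpoly_vars P = (\<Union>m \<in> Poly_Mapping.keys P. Poly_Mapping.keys m)"

definition mpoly_eval :: "'a::comm_semiring_1 mpolynomial \<Rightarrow> (nat \<Rightarrow> 'a) \<Rightarrow> 'a" where
  "mpoly_eval P v =
    (\<Sum>m \<in> Poly_Mapping.keys P.
       Poly_Mapping.lookup P m * (\<Prod>i \<in> Poly_Mapping.keys m. v i ^ Poly_Mapping.lookup m i))"

text \<open>Variable \<open>0\<close> is \<open>X\<close> and variable \<open>Suc k\<close> is \<open>Y\<^sub>k\<close>.\<close>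

definition jet_on :: "'a::nonarch_field set \<Rightarrow> ('a \<Rightarrow> 'a) \<Rightarrow> 'a \<Rightarrow> nat \<Rightarrow> 'a" where
  "jet_on S f x i = (case i of 0 \<Rightarrow> x | Suc k \<Rightarrow> (deriv_on S ^^ k) f x)"

end

theory Submission
  imports Defs "HOL-Number_Theory.Residues"
begin

text \<open>
  Put \<open>s = p\<^sup>4\<close>. On \<open>s \<int>\<^sub>p\<close> the function \<open>f = \<Gamma>\<^sub>p\<close> satisfies \<open>f (x + s) = b x * f x\<close> for the
  polynomial \<open>b x = \<plusminus> \<Prod> (x + j)\<close>, the product being over the \<open>j < s\<close> prime to \<open>p\<close>, and it is given by
  a Newton series whose coefficients decay so fast that \<open>f\<close> is infinitely differentiable there. The
  Taylor coefficients \<open>H\<^sub>i\<close> of the logarithmic derivative \<open>f' / f\<close> at the points \<open>s m\<close> therefore satisfy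
  \<open>H\<^sub>i (m + 1) = H\<^sub>i m + r\<^sub>i m\<close> with \<open>r\<^sub>i m = (-1)\<^sup>i * \<Sum> 1 / (s m + j) ^ (i + 1)\<close>. An argument of
  Kolchin-Ostrowski type shows that an algebraic relation between \<open>f (s m)\<close> and the \<open>H\<^sub>i m\<close> over the
  rational functions of \<open>m\<close> forces a nontrivial combination of the \<open>r\<^sub>i\<close> to be of the form
  \<open>c m - c (m + 1)\<close> with \<open>c\<close> rational, which the location of the poles of the \<open>r\<^sub>i\<close> forbids. Since the
  derivatives of \<open>f\<close> are polynomials in \<open>f\<close> and the \<open>H\<^sub>i\<close>, by an invertible triangular substitution,
  an algebraic differential equation for \<open>f\<close> would be such a relation.
\<close>

section \<open>Morita gamma values at natural numbers\<close>

text \<open>The shift by 1 multiplies the function by a factor that depends on the residue class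
  modulo \<open>p\<close>; on points divisible by \<open>p\<close>, a shift by a multiple of
  \<open>p\<close> has a single polynomial multiplier. The exponent 4 comes from
  \<open>s = q\<^sup>2\<close> with \<open>q = p\<^sup>2\<close>: the \<open>k\<close>-th forward
  difference of the values at \<open>s m\<close> is divisible by \<open>q ^ k = p ^ (2 k)\<close>,
  the Newton coefficient divides it by \<open>k!\<close>, whose \<open>p\<close>-part is at most
  \<open>p ^ k\<close>, and a factor \<open>p ^ k\<close> survives. The logarithmic derivative is
  taken because it turns the multiplicative functional equation into an additive one, whose
  increments are rational in \<open>m\<close> with poles of order exactly \<open>i + 1\<close>.
  Sampling at the points \<open>s m\<close> then makes independence a purely algebraic statement
  about sequences over a field of characteristic 0, with rational functions present as germs at
  infinity.\<close>

definition unit_indices :: "nat \<Rightarrow> nat \<Rightarrow> nat set" where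
  "unit_indices p n = {j. j < n \<and> \<not> p dvd j}"

text \<open>At \<open>n = 0\<close> and \<open>n = 1\<close> this gives \<open>1\<close> and
  \<open>-1\<close>, the values of the gamma function there, so the recursion starts at 0. The index
  \<open>j = 0\<close> is excluded because \<open>p\<close> divides it.\<close>

definition int_gamma :: "nat \<Rightarrow> nat \<Rightarrow> int" where
  "int_gamma p n = (-1) ^ n * (\<Prod>j\<in>unit_indices p n. int j)"

definition shift_poly :: "nat \<Rightarrow> nat \<Rightarrow> int poly" where
  "shift_poly p n = [:(-1) ^ n:] * (\<Prod>j\<in>unit_indices p n. [:int j, 1:])"

lemma finite_unit_indices [simp]: "finite (unit_indices p n)"
  by (simp add: unit_indices_def)

lemma unit_indices_0 [simp]: "unit_indices p 0 = {}"
  by (simp add: unit_indices_def)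

lemma unit_indices_Suc:
  "unit_indices p (Suc n) = (if p dvd n then unit_indices p n else insert n (unit_indices p n))"
  by (auto simp: unit_indices_def less_Suc_eq)

lemma not_in_unit_indices [simp]: "n \<notin> unit_indices p n"
  by (simp add: unit_indices_def)

lemma int_gamma_0 [simp]: "int_gamma p 0 = 1"
  by (simp add: int_gamma_def)

lemma int_gamma_Suc:
  "int_gamma p (Suc n) = - (if p dvd n then 1 else int n) * int_gamma p n"
  by (simp add: int_gamma_def unit_indices_Suc)

lemma int_gamma_nonzero: "int_gamma p n \<noteq> 0"
  by (auto simp: int_gamma_def unit_indices_def)

lemma poly_shift_poly:
  "poly (shift_poly p n) x = (-1) ^ n * (\<Prod>j\<in>unit_indices p n. int j + x)"
  by (simp add: shift_poly_def poly_prod)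

lemma poly_shift_poly_0 [simp]: "poly (shift_poly p n) 0 = int_gamma p n"
  by (simp add: poly_shift_poly int_gamma_def)

text \<open>Since \<open>p\<close> divides \<open>N\<close>, the index \<open>N + j\<close> is
  skipped exactly when \<open>j\<close> is, so the second block of the product is a polynomial in
  \<open>N\<close>.\<close>

lemma int_gamma_add:
  assumes "p dvd N"
  shows "int_gamma p (N + n) = poly (shift_poly p n) (int N) * int_gamma p N"
proof (induction n)
  case (Suc n)
  have "p dvd N + n \<longleftrightarrow> p dvd n" using assms by (simp add: dvd_add_right_iff)
  then show ?case using Suc
    by (auto simp: int_gamma_Suc poly_shift_poly unit_indices_Suc algebra_simps)
qed (simp add: poly_shift_poly)

section \<open>Wilson congruences modulo prime powers\<close>

text \<open>\<open>c\<close> is fixed before \<open>x\<close>: information on the linear coefficient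
  gained at one point can be used at all others.\<close>

lemma poly_expand_first_order:
  fixes B :: "'a::comm_ring_1 poly"
  obtains c where "\<And>x. \<exists>d. poly B x = poly B 0 + x * c + x\<^sup>2 * d"
proof -
  obtain a B' where B: "B = pCons a B'" by (rule pCons_cases)
  obtain c R where B': "B' = pCons c R" by (rule pCons_cases)
  show thesis by (rule that[of c]) (auto simp: B B' algebra_simps power2_eq_square)
qed

text \<open>This is the parity of Euler's totient of \<open>p ^ k\<close>, which fails only for
  \<open>p ^ k = 2\<close>.\<close>

lemma even_card_unit_indices:
  assumes "prime p" "k \<ge> 1" "p = 2 \<longrightarrow> k \<ge> 2"
  shows "even (card (unit_indices p (p ^ k)))"
proof -
  have "unit_indices p (p ^ k) = totatives (p ^ k)"
  proof -
    have "coprime j (p ^ k) \<longleftrightarrow> \<not> p dvd j" for j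
      using assms(2) prime_imp_coprime[OF assms(1), of j] not_prime_unit[of p] assms(1)
      by (auto simp: coprime_commute[of j] coprime_absorb_left)
    moreover have "j < p ^ k" if "j \<le> p ^ k" "\<not> p dvd j" for j
    proof -
      have "p dvd p ^ k" using assms(2) by simp
      then show ?thesis using that by (cases "j = p ^ k") auto
    qed
    ultimately show ?thesis
      by (auto simp: unit_indices_def totatives_def intro!: Nat.gr0I)
  qed
  then have "card (unit_indices p (p ^ k)) = p ^ (k - 1) * (p - 1)"
    using totient_prime_power[OF assms(1), of k] assms(2) by (simp add: totient_def)
  moreover have "even (p ^ (k - 1) * (p - 1))"
  proof (cases "p = 2")
    case False
    then have "odd p" using assms(1) prime_odd_nat[of p] prime_ge_2_nat[of p] by linarith
    then show ?thesis by simp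
  next
    case True
    then have "k - 1 \<noteq> 0" using assms(3) by simp
    then show ?thesis using True by simp
  qed
  ultimately show ?thesis by (simp only:)
qed

text \<open>The map \<open>j -> p ^ k - j\<close> permutes the indices and changes the sign of an
  even number of factors. Equal values at \<open>0\<close> and \<open>- p ^ k\<close> make the
  linear coefficient divisible by \<open>p ^ k\<close>.\<close>

lemma shift_poly_reflect:
  assumes "prime p" "k \<ge> 1" "p = 2 \<longrightarrow> k \<ge> 2"
  shows "poly (shift_poly p (p ^ k)) (- int (p ^ k)) = int_gamma p (p ^ k)"
proof -
  let ?q = "p ^ k" let ?U = "unit_indices p ?q"
  have dvd: "p dvd ?q" using assms(2) by simp
  have "bij_betw (\<lambda>j. ?q - j) ?U ?U"
  proof (rule bij_betw_byWitness[where f' = "\<lambda>j. ?q - j"])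
    show "(\<lambda>j. ?q - j) ` ?U \<subseteq> ?U"
    proof (rule image_subsetI)
      fix j assume j: "j \<in> ?U"
      then have "j < ?q" "\<not> p dvd j" by (auto simp: unit_indices_def)
      moreover have "j > 0" using \<open>\<not> p dvd j\<close> by (auto intro!: Nat.gr0I)
      moreover have "\<not> p dvd ?q - j"
        using dvd_diffD1[of p ?q j] dvd \<open>j < ?q\<close> \<open>\<not> p dvd j\<close> by linarith
      ultimately show "?q - j \<in> ?U" by (simp add: unit_indices_def)
    qed
    then show "(\<lambda>j. ?q - j) ` ?U \<subseteq> ?U" .
  qed (auto simp: unit_indices_def)
  then have "(\<Prod>j\<in>?U. int j) = (\<Prod>j\<in>?U. int (?q - j))"
    by (rule prod.reindex_bij_betw[symmetric])
  also have "\<dots> = (\<Prod>j\<in>?U. - 1 * (int j + - int ?q))"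
    by (rule prod.cong) (auto simp: unit_indices_def of_nat_diff)
  also have "\<dots> = (-1) ^ card ?U * (\<Prod>j\<in>?U. int j + - int ?q)"
    by (simp only: prod.distrib prod_constant)
  also have "\<dots> = (\<Prod>j\<in>?U. int j + - int ?q)"
    using even_card_unit_indices[OF assms] by simp
  finally show ?thesis by (simp add: poly_shift_poly int_gamma_def)
qed

text \<open>The product up to \<open>p ^ Suc k\<close> splits into \<open>p\<close> blocks of length
  \<open>q = p ^ k\<close>, and modulo \<open>p q\<close> all of them equal the first,
  \<open>g\<close>. From \<open>g = 1 + q t\<close> follows \<open>g ^ p = 1 + p q t = 1\<close>
  modulo \<open>p q\<close>.\<close>

lemma int_gamma_prime_power_step:
  assumes p: "prime p" "k \<ge> 1" "p = 2 \<longrightarrow> k \<ge> 2"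
    and IH: "[int_gamma p (p ^ k) = 1] (mod int (p ^ k))"
  shows "[int_gamma p (p ^ Suc k) = 1] (mod int (p ^ Suc k))"
proof -
  define q where "q = int (p ^ k)"
  define g where "g = int_gamma p (p ^ k)"
  let ?m = "q * int p"
  have m_dvd: "?m dvd q ^ 2"
    unfolding q_def power2_eq_square using p(2) by (intro mult_dvd_mono) (auto simp: dvd_power)
  have qnz: "q \<noteq> 0" using p(1) by (auto simp: q_def)
  obtain c where c: "\<And>x. \<exists>d. poly (shift_poly p (p ^ k)) x = g + x * c + x\<^sup>2 * d"
    using poly_expand_first_order[of "shift_poly p (p ^ k)"] by (metis poly_shift_poly_0 g_def)
  obtain d where "g = g + (- q) * c + (- q)\<^sup>2 * d"
    using c[of "- q"] shift_poly_reflect[OF p] by (auto simp: g_def q_def)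
  \<comment> \<open>The constant term cancels, so \<open>c\<close> is a multiple of \<open>q\<close>
    and the block value varies only by multiples of \<open>q\<^sup>2\<close>.\<close>
  then have "q * c = q * (q * d)" by (simp add: power2_eq_square algebra_simps)
  then have c_eq: "c = q * d" using qnz by simp
  have block: "[poly (shift_poly p (p ^ k)) (q * i) = g] (mod ?m)" for i
  proof -
    obtain e where "poly (shift_poly p (p ^ k)) (q * i) = g + q * i * c + (q * i)\<^sup>2 * e"
      using c[of "q * i"] by blast
    then have "poly (shift_poly p (p ^ k)) (q * i) - g = q ^ 2 * (i * d + i ^ 2 * e)"
      by (simp add: c_eq power2_eq_square algebra_simps)
    then show ?thesis using m_dvd by (simp add: cong_iff_dvd_diff)
  qed
  have pow: "[int_gamma p (p ^ k * n) = g ^ n] (mod ?m)" for n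
  proof (induction n)
    case (Suc n)
    have "int_gamma p (p ^ k * Suc n) =
        poly (shift_poly p (p ^ k)) (q * int n) * int_gamma p (p ^ k * n)"
      using int_gamma_add[of p "p ^ k * n" "p ^ k"] p(2) by (simp add: q_def algebra_simps)
    with cong_mult[OF block Suc] show ?case by simp
  qed simp
  obtain t where t: "g = 1 + q * t"
    using IH by (metis cong_iff_dvd_diff dvdE g_def q_def add.commute diff_add_cancel)
  have lin: "[g ^ n = 1 + int n * (q * t)] (mod ?m)" for n
  proof (induction n)
    case (Suc n)
    have "[g ^ Suc n = g * (1 + int n * (q * t))] (mod ?m)"
      using cong_mult[OF cong_refl Suc] by simp
    moreover have "g * (1 + int n * (q * t)) - (1 + int (Suc n) * (q * t)) =
        q\<^sup>2 * (int n * t\<^sup>2)"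
      by (simp add: t power2_eq_square algebra_simps)
    then have "[g * (1 + int n * (q * t)) = 1 + int (Suc n) * (q * t)] (mod ?m)"
      using m_dvd by (simp add: cong_iff_dvd_diff)
    ultimately show ?case using cong_trans by blast
  qed simp
  have "[1 + int p * (q * t) = 1] (mod ?m)"
    by (simp add: cong_iff_dvd_diff algebra_simps)
  then have "[int_gamma p (p ^ k * p) = 1] (mod ?m)"
    using cong_trans[OF pow[of p] cong_trans[OF lin]] by blast
  then show ?thesis by (simp add: q_def mult.commute)
qed

text \<open>For odd \<open>p\<close> the induction starts at \<open>k = 1\<close> with Wilson's
  theorem. For \<open>p = 2\<close> the congruence fails at 4, where the product is 3, and starts at
  8 with \<open>1 * 3 * 5 * 7 = 105\<close>; this is the origin of \<open>k \<ge> 3\<close>.\<close>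

lemma int_gamma_prime_power:
  assumes "prime p" "k \<ge> 3"
  shows "[int_gamma p (p ^ k) = 1] (mod int (p ^ k))"
proof -
  have step: "[int_gamma p (p ^ (k0 + n)) = 1] (mod int (p ^ (k0 + n)))"
    if "[int_gamma p (p ^ k0) = 1] (mod int (p ^ k0))" "k0 \<ge> 1" "p = 2 \<longrightarrow> k0 \<ge> 2" for n k0
  proof (induction n)
    case (Suc n)
    have "[int_gamma p (p ^ Suc (k0 + n)) = 1] (mod int (p ^ Suc (k0 + n)))"
      by (rule int_gamma_prime_power_step) (use Suc assms that in auto)
    then show ?case by simp
  qed (use that in simp)
  show ?thesis
  proof (cases "p = 2")
    case True
    have "int_gamma 2 (Suc (Suc (Suc (Suc (Suc (Suc (Suc (Suc 0)))))))) = 105"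
      by (simp add: int_gamma_Suc)
    moreover have "Suc (Suc (Suc (Suc (Suc (Suc (Suc (Suc 0))))))) = 8" by simp
    ultimately have "int_gamma 2 8 = 105" by (simp only:)
    then show ?thesis using step[of 3 "k - 3"] assms True by (simp add: cong_def)
  next
    case False
    then have odd: "odd p" using assms prime_odd_nat prime_ge_2_nat[of p] by force
    have "unit_indices p p = {1..p - 1}"
      using prime_gt_0_nat[OF assms(1)]
      by (auto simp: unit_indices_def dest: dvd_imp_le intro!: Suc_leI Nat.gr0I)
    then have "int_gamma p p = - fact (p - 1)"
      using odd by (simp add: int_gamma_def fact_prod)
    moreover have "[- fact (p - 1) = - (- 1 :: int)] (mod int p)"
      using wilson_theorem[OF assms(1)] cong_minus_minus_iff by blast
    ultimately show ?thesis using step[of 1 "k - 1"] assms False by simp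
  qed
qed

lemma int_gamma_add_prime_power:
  assumes "prime p" "k \<ge> 3"
  shows "[int_gamma p (n + p ^ k) = int_gamma p n] (mod int (p ^ k))"
proof (induction n)
  case (Suc n)
  have "p dvd n + p ^ k \<longleftrightarrow> p dvd n" using assms by (simp add: dvd_add_left_iff)
  moreover have "[int n + int (p ^ k) = int n] (mod int (p ^ k))"
    by (simp add: cong_def)
  ultimately show ?case using Suc cong_mult
    by (auto simp: int_gamma_Suc cong_minus_minus_iff)
qed (use int_gamma_prime_power[OF assms] in simp)

text \<open>Repeated shifts by \<open>p ^ k\<close>. Read \<open>p\<close>-adically, this is the
  Lipschitz estimate behind the extension to the \<open>p\<close>-adic integers.\<close>

lemma int_gamma_cong:
  assumes "prime p" "k \<ge> 3" "[m = n] (mod p ^ k)"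
  shows "[int_gamma p m = int_gamma p n] (mod int (p ^ k))"
proof -
  have mult: "[int_gamma p (n + p ^ k * i) = int_gamma p n] (mod int (p ^ k))" for n i
  proof (induction i)
    case (Suc i)
    have "[int_gamma p (n + p ^ k * i + p ^ k) = int_gamma p n] (mod int (p ^ k))"
      by (rule cong_trans[OF int_gamma_add_prime_power[OF assms(1,2)] Suc])
    then show ?case by (simp add: algebra_simps)
  qed simp
  have wlog: "[int_gamma p m = int_gamma p n] (mod int (p ^ k))"
    if "n \<le> m" "[m = n] (mod p ^ k)" for m n
  proof -
    have "\<exists>i. m = i * p ^ k + n" using cong_le_nat[OF that(1)] that(2) by simp
    then obtain i where "m = i * p ^ k + n" ..
    then show ?thesis using mult[of n i] by (simp add: algebra_simps)
  qed
  show ?thesis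
  proof (cases "n \<le> m")
    case False
    then show ?thesis using cong_sym[OF wlog[OF _ cong_sym[OF assms(3)]]] by simp
  qed (rule wlog[OF _ assms(3)])
qed

section \<open>The p-part of a factorial\<close>

text \<open>A coarse form of Legendre's formula: only multiples of \<open>p\<close> contribute, so
  the multiplicity in \<open>n!\<close> is \<open>q\<close> plus that in \<open>q!\<close> with
  \<open>q = n div p\<close>, at most \<open>2 q \<le> n\<close> by induction.\<close>

lemma prime_power_dvd_fact_le:
  assumes "prime (p::nat)" "p ^ k dvd fact n"
  shows "k \<le> n"
proof -
  have "multiplicity p (fact n :: nat) \<le> n"
  proof (induction n rule: less_induct)
    case (less n)
    define q where "q = n div p"
    have p2: "p \<ge> 2" using assms(1) by (simp add: prime_ge_2_nat)
    show ?case
    proof (cases "n = 0")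
      case False
      have "q < n" using p2 False by (simp add: q_def)
      have pe: "prime_elem p" using assms(1) by simp
      have mult_fact: "multiplicity p (fact n :: nat) = (\<Sum>i\<in>{1..n}. multiplicity p i)" for n
        unfolding fact_prod
        by (simp add: prime_elem_multiplicity_prod_distrib[OF pe])
      have "(\<Sum>i\<in>{1..n}. multiplicity p i) = (\<Sum>i\<in>(\<lambda>i. p * i) ` {1..q}. multiplicity p i)"
      proof (rule sum.mono_neutral_right)
        show "(\<lambda>i. p * i) ` {1..q} \<subseteq> {1..n}"
          using p2 by (auto simp: q_def less_eq_div_iff_mult_less_eq algebra_simps)
        show "\<forall>i\<in>{1..n} - (\<lambda>i. p * i) ` {1..q}. multiplicity p i = 0"
        proof
          fix i assume i: "i \<in> {1..n} - (\<lambda>i. p * i) ` {1..q}"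
          have "\<not> p dvd i"
          proof
            assume "p dvd i"
            then obtain j where j: "i = p * j" by blast
            then have "j \<in> {1..q}" using i p2
              by (auto simp: q_def less_eq_div_iff_mult_less_eq algebra_simps intro!: Suc_leI Nat.gr0I)
            with i j show False by blast
          qed
          then show "multiplicity p i = 0" by (rule not_dvd_imp_multiplicity_0)
        qed
      qed simp
      also have "\<dots> = (\<Sum>i\<in>{1..q}. multiplicity p (p * i))"
        using p2 by (subst sum.reindex) (auto simp: inj_on_def)
      also have "\<dots> = (\<Sum>i\<in>{1..q}. Suc (multiplicity p i))"
        using p2 assms(1) by (intro sum.cong) (auto simp: multiplicity_times_same)
      also have "\<dots> = q + multiplicity p (fact q :: nat)"
        by (simp add: mult_fact sum_Suc)
      also have "\<dots> \<le> q + q" using less \<open>q < n\<close> by simp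
      also have "\<dots> \<le> n" using p2 
        by (metis div_times_less_eq_dividend mult.commute mult_2 mult_le_mono2 order_trans q_def)
      finally show ?thesis by (simp add: mult_fact)
    qed simp
  qed
  moreover have "k \<le> multiplicity p (fact n :: nat)"
    using assms by (intro multiplicity_geI) (auto simp: not_prime_unit)
  ultimately show ?thesis by simp
qed

section \<open>Rational sequences\<close>

lemma eventually_poly_of_nat_nonzero:
  fixes B :: "'a::field_char_0 poly"
  assumes "B \<noteq> 0"
  shows "\<forall>\<^sub>F m in sequentially. poly B (of_nat m) \<noteq> 0"
proof -
  have "finite ((of_nat :: nat \<Rightarrow> 'a) -` {x. poly B x = 0})"
    by (intro finite_vimageI poly_roots_finite assms inj_of_nat)
  then show ?thesis
    by (simp add: cofinite_eq_sequentially[symmetric] eventually_cofinite vimage_def)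
qed

lemma poly_eventually_zero_imp_zero:
  fixes A :: "'a::field_char_0 poly"
  assumes "\<forall>\<^sub>F m in sequentially. poly A (of_nat m) = 0"
  shows "A = 0"
proof (rule ccontr)
  assume "A \<noteq> 0"
  from eventually_conj[OF assms eventually_poly_of_nat_nonzero[OF this]]
  have "\<forall>\<^sub>F m in (sequentially :: nat filter). False" by (rule eventually_mono) simp
  then show False by simp
qed

text \<open>Germs at infinity of rational functions, sampled at the naturals. Eventual equality
  makes zeros of denominators harmless; the germs form a field stable under
  \<open>m -> m + 1\<close>, the base field of the independence argument.\<close>

definition rational_seq :: "(nat \<Rightarrow> 'a::field_char_0) set" where
  "rational_seq = {c. \<exists>A B. B \<noteq> 0 \<and>
     (\<forall>\<^sub>F m in sequentially. c m = poly A (of_nat m) / poly B (of_nat m))}"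

lemma rational_seqE:
  assumes "c \<in> rational_seq"
  obtains A B where "B \<noteq> 0" "\<forall>\<^sub>F m in sequentially. c m = poly A (of_nat m) / poly B (of_nat m)"
  using assms by (auto simp: rational_seq_def)

lemma rational_seq_poly: "(\<lambda>m. poly A (of_nat m)) \<in> rational_seq"
  unfolding rational_seq_def by (rule CollectI, rule exI[of _ A], rule exI[of _ 1]) simp

lemma rational_seq_const: "(\<lambda>m. a) \<in> rational_seq"
  using rational_seq_poly[of "[:a:]"] by simp

lemma rational_seq_add:
  assumes "c \<in> rational_seq" "d \<in> rational_seq"
  shows "(\<lambda>m. c m + d m) \<in> rational_seq"
proof -
  obtain A B where c: "B \<noteq> 0" "\<forall>\<^sub>F m in sequentially. c m = poly A (of_nat m) / poly B (of_nat m)"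
    using assms(1) by (rule rational_seqE)
  obtain C D where d: "D \<noteq> 0" "\<forall>\<^sub>F m in sequentially. d m = poly C (of_nat m) / poly D (of_nat m)"
    using assms(2) by (rule rational_seqE)
  have "\<forall>\<^sub>F m in sequentially. c m + d m = poly (A * D + C * B) (of_nat m) / poly (B * D) (of_nat m)"
    using c(2) d(2) eventually_poly_of_nat_nonzero[OF c(1)] eventually_poly_of_nat_nonzero[OF d(1)]
    by eventually_elim (simp add: field_simps)
  moreover have "B * D \<noteq> 0" using c d by simp
  ultimately show ?thesis unfolding rational_seq_def by blast
qed

lemma rational_seq_mult:
  assumes "c \<in> rational_seq" "d \<in> rational_seq"
  shows "(\<lambda>m. c m * d m) \<in> rational_seq"
proof -
  obtain A B where c: "B \<noteq> 0" "\<forall>\<^sub>F m in sequentially. c m = poly A (of_nat m) / poly B (of_nat m)"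
    using assms(1) by (rule rational_seqE)
  obtain C D where d: "D \<noteq> 0" "\<forall>\<^sub>F m in sequentially. d m = poly C (of_nat m) / poly D (of_nat m)"
    using assms(2) by (rule rational_seqE)
  have "\<forall>\<^sub>F m in sequentially. c m * d m = poly (A * C) (of_nat m) / poly (B * D) (of_nat m)"
    using c(2) d(2) by eventually_elim simp
  moreover have "B * D \<noteq> 0" using c d by simp
  ultimately show ?thesis unfolding rational_seq_def by blast
qed

lemma rational_seq_inverse:
  assumes "c \<in> rational_seq"
  shows "(\<lambda>m. inverse (c m)) \<in> rational_seq"
proof -
  obtain A B where c: "B \<noteq> 0" "\<forall>\<^sub>F m in sequentially. c m = poly A (of_nat m) / poly B (of_nat m)"
    using assms(1) by (rule rational_seqE)
  show ?thesis
  proof (cases "A = 0")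
    case True
    with c(2) have "\<forall>\<^sub>F m in sequentially. inverse (c m) = poly 0 (of_nat m) / poly 1 (of_nat m)"
      by simp
    then show ?thesis unfolding rational_seq_def
      by (intro CollectI exI[of _ 0] exI[of _ 1]) simp
  next
    case False
    have "\<forall>\<^sub>F m in sequentially. inverse (c m) = poly B (of_nat m) / poly A (of_nat m)"
      using c(2) by eventually_elim simp
    then show ?thesis using False unfolding rational_seq_def by blast
  qed
qed

lemma rational_seq_diff:
  assumes "c \<in> rational_seq" "d \<in> rational_seq"
  shows "(\<lambda>m. c m - d m) \<in> rational_seq"
  using rational_seq_add[OF assms(1) rational_seq_mult[OF rational_seq_const[of "-1"] assms(2)]]
  by simp

lemma rational_seq_divide:
  assumes "c \<in> rational_seq" "d \<in> rational_seq"
  shows "(\<lambda>m. c m / d m) \<in> rational_seq"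
  using rational_seq_mult[OF assms(1) rational_seq_inverse[OF assms(2)]]
  by (simp add: divide_inverse)

lemma rational_seq_power:
  assumes "c \<in> rational_seq"
  shows "(\<lambda>m. c m ^ k) \<in> rational_seq"
  by (induction k) (auto intro: rational_seq_const rational_seq_mult assms)

lemma rational_seq_sum:
  assumes "\<And>t. t \<in> T \<Longrightarrow> c t \<in> rational_seq"
  shows "(\<lambda>m. \<Sum>t\<in>T. c t m) \<in> rational_seq"
  using assms
  by (induction T rule: infinite_finite_induct) (auto intro: rational_seq_const rational_seq_add)

lemma rational_seq_prod:
  assumes "\<And>t. t \<in> T \<Longrightarrow> c t \<in> rational_seq"
  shows "(\<lambda>m. \<Prod>t\<in>T. c t m) \<in> rational_seq"
  using assms
  by (induction T rule: infinite_finite_induct) (auto intro: rational_seq_const rational_seq_mult)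

lemma pcompose_shift_nonzero:
  fixes B :: "'a::field_char_0 poly"
  assumes "B \<noteq> 0"
  shows "pcompose B [:a, 1:] \<noteq> 0"
  using assms by (subst pcompose_eq_0_iff) auto

lemma poly_pcompose_shift: "poly (pcompose A [:1, 1:]) (of_nat m) = poly A (of_nat (Suc m))"
  by (simp add: poly_pcompose)

lemma rational_seq_shift:
  assumes "c \<in> rational_seq"
  shows "(\<lambda>m. c (Suc m)) \<in> rational_seq"
proof -
  obtain A B where c: "B \<noteq> 0" "\<forall>\<^sub>F m in sequentially. c m = poly A (of_nat m) / poly B (of_nat m)"
    using assms(1) by (rule rational_seqE)
  then have "\<forall>\<^sub>F m in sequentially. c (Suc m) =
      poly (pcompose A [:1, 1:]) (of_nat m) / poly (pcompose B [:1, 1:]) (of_nat m)"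
    unfolding poly_pcompose_shift by (subst eventually_sequentially_Suc)
  then show ?thesis using pcompose_shift_nonzero[OF c(1)] unfolding rational_seq_def by blast
qed

text \<open>A nonzero polynomial has finitely many zeros, so a germ that is not zero is invertible;
  this permits dividing a relation by one of its coefficients.\<close>

lemma rational_seq_cases:
  assumes "c \<in> rational_seq"
  obtains "\<forall>\<^sub>F m in sequentially. c m = 0" | "\<forall>\<^sub>F m in sequentially. c m \<noteq> 0"
proof -
  obtain A B where c: "B \<noteq> 0" "\<forall>\<^sub>F m in sequentially. c m = poly A (of_nat m) / poly B (of_nat m)"
    using assms(1) by (rule rational_seqE)
  show thesis
  proof (cases "A = 0")
    case True
    with c(2) show ?thesis using that(1) by simp
  next
    case False
    have "\<forall>\<^sub>F m in sequentially. c m \<noteq> 0"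
      using c(2) eventually_poly_of_nat_nonzero[OF c(1)] eventually_poly_of_nat_nonzero[OF False]
      by eventually_elim simp
    then show ?thesis using that(2) by blast
  qed
qed

lemma eventually_shift_invariant:
  assumes "\<forall>\<^sub>F m in sequentially. c (Suc m) = c m"
  obtains a where "\<forall>\<^sub>F m in sequentially. c m = a"
proof -
  obtain N where N: "\<And>m. m \<ge> N \<Longrightarrow> c (Suc m) = c m"
    using assms by (auto simp: eventually_sequentially)
  have "c m = c N" if "m \<ge> N" for m
    using that by (induction rule: dec_induct) (auto simp: N)
  then show thesis using that by (auto simp: eventually_sequentially)
qed

text \<open>Choosing the denominator of least degree replaces a gcd computation.\<close>

lemma rational_seq_reducedE:
  fixes c :: "nat \<Rightarrow> 'a::field_char_0"
  assumes "c \<in> rational_seq"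
  obtains A B where "B \<noteq> 0" "\<forall>\<^sub>F m in sequentially. c m = poly A (of_nat m) / poly B (of_nat m)"
    "\<And>x. \<not> (poly A x = 0 \<and> poly B x = 0)"
proof -
  define Q where "Q B \<longleftrightarrow> B \<noteq> 0 \<and> (\<exists>A. \<forall>\<^sub>F m in sequentially.
      c m = poly A (of_nat m) / poly B (of_nat m))" for B :: "'a poly"
  have "\<exists>B. Q B" using assms by (auto simp: rational_seq_def Q_def)
  then obtain B where B: "Q B" "\<And>B'. Q B' \<Longrightarrow> degree B \<le> degree B'"
    using ex_has_least_nat[of Q _ degree] by blast
  then obtain A where A: "B \<noteq> 0" "\<forall>\<^sub>F m in sequentially. c m = poly A (of_nat m) / poly B (of_nat m)"
    by (auto simp: Q_def)
  show thesis
  proof (rule that[OF A], rule notI, elim conjE)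
    fix x assume "poly A x = 0" "poly B x = 0"
    then obtain A' B' where AB: "A = [:- x, 1:] * A'" "B = [:- x, 1:] * B'"
      by (metis poly_eq_0_iff_dvd dvdE)
    have "B' \<noteq> 0" using A(1) AB by auto
    then have "degree B = Suc (degree B')" by (simp only: AB) (subst degree_mult_eq, auto)
    moreover have "\<forall>\<^sub>F m in sequentially. c m = poly A' (of_nat m) / poly B' (of_nat m)"
    proof -
      have "\<forall>\<^sub>F m in sequentially. poly [:- x, 1:] (of_nat m) \<noteq> 0"
        by (rule eventually_poly_of_nat_nonzero) simp
      with A(2) show ?thesis
        by eventually_elim (simp add: AB del: poly_pCons mult_pCons_left)
    qed
    then have "degree B \<le> degree B'" using \<open>B' \<noteq> 0\<close> by (intro B(2)) (auto simp: Q_def)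
    ultimately show False by simp
  qed
qed

section \<open>Algebraic independence for a shift system\<close>

text \<open>\<open>F m\<close> stands for the value of the function at \<open>s m\<close>, and
  \<open>H i m\<close> for the \<open>i\<close>-th Taylor coefficient of its logarithmic derivative
  there. As \<open>J\<close> lies in \<open>{1..<s}\<close>, the poles \<open>- j / s\<close> of the
  increments lie strictly between \<open>-1\<close> and \<open>0\<close>, so no two differ by an
  integer; \<open>1 \<in> J\<close> provides the one at \<open>- 1 / s\<close>.\<close>

locale shift_system =
  fixes s :: nat and J :: "nat set" and sg :: "'a::field_char_0"
    and F :: "nat \<Rightarrow> 'a" and H :: "nat \<Rightarrow> nat \<Rightarrow> 'a"
  assumes J: "1 \<in> J" "J \<subseteq> {1..<s}" and sg: "sg \<noteq> 0"
    and F_nonzero: "F m \<noteq> 0"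
    and F_Suc: "F (Suc m) = sg * (\<Prod>j\<in>J. of_nat (s * m + j)) * F m"
    and H_Suc: "H i (Suc m) = H i m + (-1) ^ i * (\<Sum>j\<in>J. 1 / of_nat (s * m + j) ^ Suc i)"
begin

definition b :: "nat \<Rightarrow> 'a" where
  "b m = sg * (\<Prod>j\<in>J. of_nat (s * m + j))"

definition r :: "nat \<Rightarrow> nat \<Rightarrow> 'a" where
  "r i m = (-1) ^ i * (\<Sum>j\<in>J. 1 / of_nat (s * m + j) ^ Suc i)"

definition lin :: "nat \<Rightarrow> 'a poly" where
  "lin j = [:of_nat j, of_nat s:]"

definition b_poly :: "'a poly" where
  "b_poly = [:sg:] * (\<Prod>j\<in>J. lin j)"

lemma finite_J [simp]: "finite J"
  using J(2) finite_subset by blast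

lemma s_pos: "s > 0" and s_nonzero: "of_nat s \<noteq> (0::'a)"
  using J by auto

lemma poly_lin: "poly (lin j) (of_nat m) = of_nat (s * m + j)"
  by (simp add: lin_def algebra_simps)

lemma lin_nonzero: "lin j \<noteq> 0"
  using s_nonzero by (simp add: lin_def)

lemma b_eq_poly: "b m = poly b_poly (of_nat m)"
  by (simp add: b_def b_poly_def poly_prod poly_lin del: of_nat_add of_nat_mult)

lemma b_nonzero: "b m \<noteq> 0"
  using F_nonzero[of "Suc m"] F_Suc[of m] by (auto simp: b_def)

lemma b_poly_nonzero: "b_poly \<noteq> 0"
  using b_nonzero[of 0] b_eq_poly[of 0] by auto

lemma degree_b_poly: "degree b_poly = card J"
proof -
  have "degree (\<Prod>j\<in>J. lin j) = (\<Sum>j\<in>J. degree (lin j))"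
    by (rule degree_prod_eq_sum_degree) (use lin_nonzero in auto)
  also have "\<dots> = card J" using s_nonzero by (simp add: lin_def)
  finally show ?thesis using sg by (simp add: b_poly_def)
qed

lemma card_J_pos: "card J > 0"
  using J(1) by (auto simp: card_gt_0_iff)

lemma rational_seq_b: "b \<in> rational_seq"
  using rational_seq_poly[of b_poly] by (simp add: b_eq_poly[abs_def])

lemma rational_seq_r: "r i \<in> rational_seq"
  unfolding r_def[abs_def]
proof (intro rational_seq_mult rational_seq_const rational_seq_sum rational_seq_divide rational_seq_power)
  show "(\<lambda>m. of_nat (s * m + j) :: 'a) \<in> rational_seq" for j
    using rational_seq_poly[of "lin j"] by (simp only: poly_lin)
qed

text \<open>After clearing denominators, degrees are compared: the shift preserves them, those of
  \<open>A\<close> and \<open>B\<close> cancel, and \<open>k * card J = l * card J\<close> remains.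
  This keeps different powers of \<open>F\<close> apart.\<close>

lemma twisted_invariant_exponent:
  assumes "c \<in> rational_seq" "\<not> (\<forall>\<^sub>F m in sequentially. c m = 0)"
    "\<forall>\<^sub>F m in sequentially. c (Suc m) * b m ^ k = b m ^ l * c m"
  shows "k = l"
proof -
  obtain A B where B: "B \<noteq> 0"
    and c: "\<forall>\<^sub>F m in sequentially. c m = poly A (of_nat m) / poly B (of_nat m)"
    using assms(1) by (rule rational_seqE)
  have A: "A \<noteq> 0" using assms(2) c by auto
  let ?\<sigma> = "\<lambda>A. pcompose A [:1, 1:]"
  have "\<forall>\<^sub>F m in sequentially. c (Suc m) = poly (?\<sigma> A) (of_nat m) / poly (?\<sigma> B) (of_nat m)"
    using c unfolding poly_pcompose_shift by (subst eventually_sequentially_Suc)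
  with assms(3) c eventually_poly_of_nat_nonzero[OF B]
    eventually_poly_of_nat_nonzero[OF pcompose_shift_nonzero[OF B, of 1]]
  have "\<forall>\<^sub>F m in sequentially.
      poly (?\<sigma> A * B * b_poly ^ k - b_poly ^ l * A * ?\<sigma> B) (of_nat m) = 0"
  proof eventually_elim
    case (elim m)
    show ?case using elim(1) elim(3,4) unfolding elim(2) elim(5) b_eq_poly
      by (simp add: field_simps poly_power)
  qed
  then have "?\<sigma> A * B * b_poly ^ k = b_poly ^ l * A * ?\<sigma> B"
    using poly_eventually_zero_imp_zero by fastforce
  then have "degree (?\<sigma> A * B * b_poly ^ k) = degree (b_poly ^ l * A * ?\<sigma> B)" by (rule arg_cong)
  then have "k * card J = l * card J"
    using A B b_poly_nonzero pcompose_shift_nonzero[of A 1] pcompose_shift_nonzero[of B 1]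
    by (simp add: degree_mult_eq degree_power_eq degree_b_poly degree_pcompose)
  then show ?thesis using card_J_pos by auto
qed

text \<open>The left-hand side has a pole at \<open>- 1 / s\<close>, and its poles are pairwise incongruent modulo
  \<open>1\<close>; a difference \<open>c m - c (Suc m)\<close> with a pole has two poles at integral distance.\<close>

lemma combination_not_telescoping:
  assumes "c \<in> rational_seq"
    and eq: "\<forall>\<^sub>F m in sequentially. (\<Sum>i<n. \<mu> i * r i m) = c m - c (Suc m)"
    and "i0 < n"
  shows "\<mu> i0 = 0"
proof (rule ccontr)
  assume "\<mu> i0 \<noteq> 0"
  \<comment> \<open>\<open>e + 1\<close> is the largest pole order that occurs, so \<open>D\<close>
    below is a common denominator and the sum equals \<open>N / D\<close>.\<close>
  define e where "e = Max {i. i < n \<and> \<mu> i \<noteq> 0}"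
  have "e \<in> {i. i < n \<and> \<mu> i \<noteq> 0}"
    unfolding e_def by (rule Max_in) (use \<open>\<mu> i0 \<noteq> 0\<close> assms(3) in auto)
  then have e: "e < n" "\<mu> e \<noteq> 0" by auto
  have above: "\<mu> i = 0" if "i < n" "i > e" for i
    using that Max_ge[of "{i. i < n \<and> \<mu> i \<noteq> 0}" i] by (fastforce simp: e_def)
  define D where "D = (\<Prod>j\<in>J. lin j ^ Suc e)"
  define N where "N = (\<Sum>i\<le>e. [:\<mu> i * (-1) ^ i:] *
      (\<Sum>j\<in>J. lin j ^ (e - i) * (\<Prod>j'\<in>J - {j}. lin j' ^ Suc e)))"
  have D_nonzero: "poly D (of_nat m) \<noteq> 0" for m
    using J by (auto simp: D_def poly_prod poly_power poly_lin simp del: power_Suc of_nat_add of_nat_mult)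
  have N_eq: "poly N (of_nat m) = poly D (of_nat m) * (\<Sum>i<n. \<mu> i * r i m)" for m
  proof -
    have nz: "of_nat (s * m + j) \<noteq> (0::'a)" if "j \<in> J" for j
    proof -
      have "s * m + j \<noteq> 0" using that J(2) by auto
      then show ?thesis by (simp only: of_nat_eq_0_iff not_False_eq_True)
    qed
    have summand: "poly (lin j ^ (e - i) * (\<Prod>j'\<in>J - {j}. lin j' ^ Suc e)) (of_nat m) =
        poly D (of_nat m) * (1 / of_nat (s * m + j) ^ Suc i)" if "j \<in> J" "i \<le> e" for i j
    proof -
      have "poly D (of_nat m) = of_nat (s * m + j) ^ Suc e *
          poly (\<Prod>j'\<in>J - {j}. lin j' ^ Suc e) (of_nat m)"
        unfolding D_def using that
        by (subst prod.remove[of J j]) (auto simp: poly_power poly_lin simp del: power_Suc of_nat_add of_nat_mult)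
      moreover have "of_nat (s * m + j) ^ Suc e =
          of_nat (s * m + j) ^ (e - i) * (of_nat (s * m + j) ^ Suc i :: 'a)"
        using that by (simp only: power_add[symmetric]) simp
      ultimately show ?thesis using nz[OF that(1)]
        by (simp add: poly_power poly_lin del: power_Suc of_nat_add of_nat_mult of_nat_eq_0_iff)
    qed
    have "(\<Sum>i<n. \<mu> i * r i m) = (\<Sum>i\<le>e. \<mu> i * r i m)"
      using e above by (intro sum.mono_neutral_right) auto
    moreover have "poly N (of_nat m) = (\<Sum>i\<le>e. \<mu> i * (-1) ^ i * (\<Sum>j\<in>J.
        poly D (of_nat m) * (1 / of_nat (s * m + j) ^ Suc i)))"
      unfolding N_def poly_sum[of _ "{..e}"]
    proof (rule sum.cong[OF refl])
      fix i assume "i \<in> {..e}"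
      then have "poly (\<Sum>j\<in>J. lin j ^ (e - i) * (\<Prod>j'\<in>J - {j}. lin j' ^ Suc e)) (of_nat m) =
          (\<Sum>j\<in>J. poly D (of_nat m) * (1 / of_nat (s * m + j) ^ Suc i))"
        unfolding poly_sum by (intro sum.cong refl summand) auto
      then show "poly ([:\<mu> i * (- 1) ^ i:] *
            (\<Sum>j\<in>J. lin j ^ (e - i) * (\<Prod>j'\<in>J - {j}. lin j' ^ Suc e))) (of_nat m) =
          \<mu> i * (- 1) ^ i * (\<Sum>j\<in>J. poly D (of_nat m) * (1 / of_nat (s * m + j) ^ Suc i))"
        by (simp only: poly_mult) simp
    qed
    ultimately show ?thesis
      by (simp add: r_def sum_distrib_left mult_ac)
  qed
  \<comment> \<open>The root of \<open>lin 1\<close>. At \<open>\<alpha> + z\<close> the value of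
    \<open>lin j\<close> is \<open>s * z + j - 1\<close>, which for \<open>j \<in> J\<close>
    vanishes only if \<open>z = 0\<close>; so \<open>D\<close> has no other zero at integral
    distance from \<alpha>.\<close>
  define \<alpha> where "\<alpha> = - 1 / (of_nat s :: 'a)"
  have lin_at: "poly (lin j) (\<alpha> + of_int z) = of_int (int s * z + int j - 1)" for j z
    using s_nonzero by (simp add: lin_def \<alpha>_def field_simps)
  have D_at: "z = 0" if "poly D (\<alpha> + of_int z) = 0" for z
  proof -
    have "\<exists>j\<in>J. poly (lin j) (\<alpha> + of_int z) = 0"
      using that by (auto simp: D_def poly_prod poly_power)
    then obtain j where j: "j \<in> J" "poly (lin j) (\<alpha> + of_int z) = 0" ..
    then have "int s * z + int j - 1 = 0" unfolding lin_at by (simp only: of_int_eq_0_iff)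
    moreover have "1 \<le> int j" "int j < int s" using j(1) J(2) by auto
    ultimately have "int s * z < int s * 1" "int s * (-1) < int s * z" by linarith+
    then have "z < 1" "-1 < z" using s_pos by (simp_all only: mult_less_cancel_left_pos of_nat_0_less_iff)
    then show ?thesis by simp
  qed
  \<comment> \<open>For \<open>j \<noteq> 1\<close> each product keeps the vanishing factor
    \<open>lin 1\<close>; for \<open>j = 1\<close> the power \<open>lin 1 ^ (e - i)\<close> vanishes
    unless \<open>i = e\<close>. One term survives.\<close>
  have "poly N \<alpha> = \<mu> e * (-1) ^ e * (\<Prod>j'\<in>J - {1}. poly (lin j') \<alpha> ^ Suc e)"
  proof -
    have lin1: "poly (lin 1) \<alpha> = 0" using lin_at[of 1 0] by simp
    have inner: "(\<Sum>j\<in>J. poly (lin j) \<alpha> ^ (e - i) * (\<Prod>j'\<in>J - {j}. poly (lin j') \<alpha> ^ Suc e)) =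
        (if i = e then \<Prod>j'\<in>J - {1}. poly (lin j') \<alpha> ^ Suc e else 0)" if "i \<le> e" for i
    proof -
      have "(\<Prod>j'\<in>J - {j}. poly (lin j') \<alpha> ^ Suc e) = 0" if "j \<in> J - {1}" for j
        using that J(1) lin1 by (intro prod_zero) auto
      then have "(\<Sum>j\<in>J - {1}. poly (lin j) \<alpha> ^ (e - i) *
          (\<Prod>j'\<in>J - {j}. poly (lin j') \<alpha> ^ Suc e)) = 0"
        by (intro sum.neutral ballI) (simp only: mult_zero_right)
      then have "(\<Sum>j\<in>J. poly (lin j) \<alpha> ^ (e - i) * (\<Prod>j'\<in>J - {j}. poly (lin j') \<alpha> ^ Suc e)) =
          poly (lin 1) \<alpha> ^ (e - i) * (\<Prod>j'\<in>J - {1}. poly (lin j') \<alpha> ^ Suc e)"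
        by (subst sum.remove[OF finite_J J(1)]) (simp only: add_0_right)
      also have "\<dots> = (if i = e then \<Prod>j'\<in>J - {1}. poly (lin j') \<alpha> ^ Suc e else 0)"
        using that lin1 by auto
      finally show ?thesis .
    qed
    have "poly N \<alpha> = (\<Sum>i\<le>e. \<mu> i * (-1) ^ i *
        (if i = e then \<Prod>j'\<in>J - {1}. poly (lin j') \<alpha> ^ Suc e else 0))"
      unfolding N_def poly_sum poly_mult poly_prod poly_power using inner
      by (intro sum.cong refl arg_cong2[where f = "(*)"]) auto
    also have "\<dots> = (\<Sum>i\<in>{e}. \<mu> i * (-1) ^ i *
        (if i = e then \<Prod>j'\<in>J - {1}. poly (lin j') \<alpha> ^ Suc e else 0))"
      by (rule sum.mono_neutral_right) (simp_all del: power_Suc)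
    finally show ?thesis by simp
  qed
  moreover have "poly (lin j) \<alpha> \<noteq> 0" if "j \<in> J - {1}" for j
  proof -
    have "poly (lin j) \<alpha> = of_int (int j - 1)" using lin_at[of j 0] by simp
    moreover have "int j - 1 \<noteq> 0" using that by simp
    ultimately show ?thesis by (simp only: of_int_eq_0_iff not_False_eq_True)
  qed
  ultimately have N_at: "poly N \<alpha> \<noteq> 0" using e(2) by simp
  obtain A B where B: "B \<noteq> 0"
    and c: "\<forall>\<^sub>F m in sequentially. c m = poly A (of_nat m) / poly B (of_nat m)"
    and coprime: "\<And>x. \<not> (poly A x = 0 \<and> poly B x = 0)"
    using assms(1) by (rule rational_seq_reducedE) blast
  let ?\<sigma> = "\<lambda>A. pcompose A [:1, 1:]"
  have "\<forall>\<^sub>F m in sequentially. c (Suc m) = poly (?\<sigma> A) (of_nat m) / poly (?\<sigma> B) (of_nat m)"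
    using c unfolding poly_pcompose_shift by (subst eventually_sequentially_Suc)
  with eq c eventually_poly_of_nat_nonzero[OF B]
    eventually_poly_of_nat_nonzero[OF pcompose_shift_nonzero[OF B, of 1]]
  have "\<forall>\<^sub>F m in sequentially. poly (N * B * ?\<sigma> B - D * (A * ?\<sigma> B - ?\<sigma> A * B)) (of_nat m) = 0"
  proof eventually_elim
    case (elim m)
    have "poly N (of_nat m) = poly D (of_nat m) *
        (poly A (of_nat m) / poly B (of_nat m) - poly (?\<sigma> A) (of_nat m) / poly (?\<sigma> B) (of_nat m))"
      unfolding N_eq elim(1) unfolding elim(2) elim(5) ..
    then show ?case using elim(3,4) by (simp add: field_simps)
  qed
  then have "N * B * ?\<sigma> B - D * (A * ?\<sigma> B - ?\<sigma> A * B) = 0"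
    by (rule poly_eventually_zero_imp_zero)
  then have "poly (N * B * ?\<sigma> B - D * (A * ?\<sigma> B - ?\<sigma> A * B)) x = 0" for x
    by (simp only: poly_0)
  then have key: "poly N x * poly B x * poly B (x + 1) =
      poly D x * (poly A x * poly B (x + 1) - poly A (x + 1) * poly B x)" for x
    by (simp add: poly_pcompose add.commute[of x])
  \<comment> \<open>Integral offsets from \<alpha> at which the reduced denominator of
    \<open>c\<close> vanishes. By \<open>key\<close> the set is nonempty, yet its least element
    would be 1 and its greatest 0.\<close>
  define Z where "Z = {z :: int. poly B (\<alpha> + of_int z) = 0}"
  have "finite Z"
  proof -
    have "Z = (\<lambda>z. \<alpha> + of_int z) -` {x. poly B x = 0}" by (auto simp: Z_def)
    moreover have "finite ((\<lambda>z :: int. \<alpha> + of_int z) -` {x. poly B x = 0})"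
      by (intro finite_vimageI poly_roots_finite B injI) simp
    ultimately show ?thesis by (simp only:)
  qed
  have "poly D \<alpha> = 0"
    using J(1) lin_at[of 1 0] by (auto simp: D_def poly_prod poly_power)
  with key[of \<alpha>] N_at have "poly B \<alpha> = 0 \<or> poly B (\<alpha> + 1) = 0" by auto
  then have "0 \<in> Z \<or> 1 \<in> Z" by (auto simp: Z_def)
  \<comment> \<open>At \<open>x = \<alpha> + z - 1\<close> in \<open>key\<close>, \<open>B\<close>
    vanishes at \<open>x + 1\<close> but not at \<open>x\<close>, and \<open>A\<close> does not
    vanish at \<open>x + 1\<close>; hence \<open>D\<close> vanishes at \<open>x\<close>.\<close>
  have low: "z = 1" if "z \<in> Z" "z - 1 \<notin> Z" for z
  proof -
    have "poly D (\<alpha> + of_int (z - 1)) = 0"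
      using that key[of "\<alpha> + of_int (z - 1)"] coprime[of "\<alpha> + of_int z"]
      by (auto simp: Z_def algebra_simps)
    then show ?thesis using D_at by fastforce
  qed
  have high: "z = 0" if "z \<in> Z" "z + 1 \<notin> Z" for z
  proof -
    have "poly D (\<alpha> + of_int z) = 0"
      using that key[of "\<alpha> + of_int z"] coprime[of "\<alpha> + of_int z"]
      by (auto simp: Z_def algebra_simps)
    then show ?thesis using D_at by fastforce
  qed
  have "Z \<noteq> {}" using \<open>0 \<in> Z \<or> 1 \<in> Z\<close> by blast
  have "Min Z - 1 \<notin> Z" "Max Z + 1 \<notin> Z"
    using Min_le[OF \<open>finite Z\<close>, of "Min Z - 1"] Max_ge[OF \<open>finite Z\<close>, of "Max Z + 1"] by auto
  then have "Min Z = 1" "Max Z = 0"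
    using low high Min_in Max_in \<open>finite Z\<close> \<open>Z \<noteq> {}\<close> by blast+
  then show False
    using Min_le[OF \<open>finite Z\<close>, of "Max Z"] Max_in[OF \<open>finite Z\<close> \<open>Z \<noteq> {}\<close>] by simp
qed

text \<open>Monomials \<open>F\<^sup>k H\<^sup>\<mu>\<close> in \<open>F\<close> and the first \<open>n\<close> sequences \<open>H i\<close> are indexed by pairs
  \<open>(k, \<mu>)\<close> with \<open>\<mu>\<close> extensional on \<open>{..<n}\<close>, so that distinct indices are distinct monomials.\<close>

definition mono_at :: "nat \<Rightarrow> nat \<times> (nat \<Rightarrow> nat) \<Rightarrow> nat \<Rightarrow> 'a" where
  "mono_at n t m = F m ^ fst t * (\<Prod>i<n. H i m ^ snd t i)"

definition mdeg :: "nat \<Rightarrow> nat \<times> (nat \<Rightarrow> nat) \<Rightarrow> nat" where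
  "mdeg n t = (\<Sum>i<n. snd t i)"

text \<open>The coefficient of the monomial \<open>u\<close> when the monomial \<open>t\<close> at
  \<open>Suc m\<close> is expanded by the binomial theorem. Vanishing binomial coefficients make it
  0 unless \<open>u\<close> divides \<open>t\<close>.\<close>

definition shift_coeff ::
    "nat \<Rightarrow> nat \<times> (nat \<Rightarrow> nat) \<Rightarrow> nat \<times> (nat \<Rightarrow> nat) \<Rightarrow> nat \<Rightarrow> 'a" where
  "shift_coeff n t u m = (if fst t = fst u
     then b m ^ fst t * (\<Prod>i<n. of_nat (snd t i choose snd u i) * r i m ^ (snd t i - snd u i))
     else 0)"

definition divisors :: "nat \<Rightarrow> nat \<times> (nat \<Rightarrow> nat) \<Rightarrow> (nat \<times> (nat \<Rightarrow> nat)) set" where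
  "divisors n t = Pair (fst t) ` PiE {..<n} (\<lambda>i. {..snd t i})"

lemma finite_divisors: "finite (divisors n t)"
  unfolding divisors_def by (intro finite_imageI finite_PiE) auto

lemma divisors_iff:
  "u \<in> divisors n t \<longleftrightarrow> fst u = fst t \<and> snd u \<in> extensional {..<n} \<and> (\<forall>i<n. snd u i \<le> snd t i)"
proof -
  have "u \<in> Pair a ` A \<longleftrightarrow> fst u = a \<and> snd u \<in> A" for a :: nat and A
    by (cases u) auto
  then have "u \<in> divisors n t \<longleftrightarrow> fst u = fst t \<and> snd u \<in> PiE {..<n} (\<lambda>i. {..snd t i})"
    unfolding divisors_def by (simp only:)
  also have "snd u \<in> PiE {..<n} (\<lambda>i. {..snd t i}) \<longleftrightarrow>
      snd u \<in> extensional {..<n} \<and> (\<forall>i<n. snd u i \<le> snd t i)"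
    unfolding PiE_iff Ball_def lessThan_iff atMost_iff by (rule conj_commute)
  finally show ?thesis .
qed

lemma H_Suc_r: "H i (Suc m) = H i m + r i m"
  unfolding r_def by (rule H_Suc)

lemma F_Suc_b: "F (Suc m) = b m * F m"
  unfolding b_def by (rule F_Suc)

lemma mono_at_Suc:
  "mono_at n t (Suc m) = (\<Sum>u\<in>divisors n t. shift_coeff n t u m * mono_at n u m)"
proof -
  have "(\<Prod>i<n. H i (Suc m) ^ snd t i) = (\<Prod>i<n. \<Sum>l\<le>snd t i.
      of_nat (snd t i choose l) * H i m ^ l * r i m ^ (snd t i - l))"
    by (simp add: H_Suc_r binomial_ring)
  also have "\<dots> = (\<Sum>\<nu>\<in>PiE {..<n} (\<lambda>i. {..snd t i}). \<Prod>i<n.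
      of_nat (snd t i choose \<nu> i) * H i m ^ \<nu> i * r i m ^ (snd t i - \<nu> i))"
    by (rule prod_sum_PiE) auto
  finally have H: "(\<Prod>i<n. H i (Suc m) ^ snd t i) = \<dots>" .
  have "mono_at n t (Suc m) = (b m * F m) ^ fst t * (\<Prod>i<n. H i (Suc m) ^ snd t i)"
    by (simp add: mono_at_def F_Suc_b)
  also have "\<dots> = (\<Sum>\<nu>\<in>PiE {..<n} (\<lambda>i. {..snd t i}).
      shift_coeff n t (fst t, \<nu>) m * mono_at n (fst t, \<nu>) m)"
    unfolding H sum_distrib_left
    by (intro sum.cong refl)
      (simp add: shift_coeff_def mono_at_def prod.distrib power_mult_distrib mult_ac)
  also have "\<dots> = (\<Sum>u\<in>divisors n t. shift_coeff n t u m * mono_at n u m)"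
    unfolding divisors_def by (subst sum.reindex) (simp_all add: inj_on_def)
  finally show ?thesis .
qed

lemma shift_coeff_nonzeroD:
  assumes "shift_coeff n t u m \<noteq> 0"
  shows "fst t = fst u" "\<And>i. i < n \<Longrightarrow> snd u i \<le> snd t i"
proof -
  show *: "fst t = fst u" using assms by (auto simp: shift_coeff_def split: if_splits)
  show "snd u i \<le> snd t i" if "i < n" for i
  proof (rule ccontr)
    assume "\<not> snd u i \<le> snd t i"
    then have "snd t i choose snd u i = 0" by (simp add: binomial_eq_0)
    then have "(\<Prod>i<n. of_nat (snd t i choose snd u i) * r i m ^ (snd t i - snd u i)) = 0"
      using that by (intro prod_zero) auto
    with assms * show False by (simp add: shift_coeff_def)
  qed
qed

text \<open>Lowering an exponent lowers the degree, so the shift is triangular with respect to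
  \<open>mdeg\<close>, with diagonal entries \<open>b m ^ fst t\<close>.\<close>

lemma shift_coeff_same_degree:
  assumes "snd t \<in> extensional {..<n}" "snd u \<in> extensional {..<n}"
    "mdeg n t \<le> mdeg n u" "t \<noteq> u"
  shows "shift_coeff n t u m = 0"
proof (rule ccontr)
  assume "shift_coeff n t u m \<noteq> 0"
  note * = shift_coeff_nonzeroD[OF this]
  have "snd u i = snd t i" if "i < n" for i
  proof (rule ccontr)
    assume "snd u i \<noteq> snd t i"
    then have "snd u i < snd t i" using *(2)[OF that] by simp
    then have "mdeg n u < mdeg n t" unfolding mdeg_def
      using that *(2) by (intro sum_strict_mono_ex1) auto
    then show False using assms(3) by simp
  qed
  then have "snd u = snd t" using assms(1,2) by (intro extensionalityI) auto
  then show False using *(1) assms(4) by (simp add: prod_eq_iff)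
qed

lemma shift_coeff_refl: "shift_coeff n t t m = b m ^ fst t"
  by (simp add: shift_coeff_def)

text \<open>Multiplication by \<open>H i\<close>: the neighbours of \<open>u\<close> one degree
  higher, whose shifts contain \<open>u\<close> with a coefficient linear in
  \<open>r i\<close>.\<close>

definition raise :: "nat \<times> (nat \<Rightarrow> nat) \<Rightarrow> nat \<Rightarrow> nat \<times> (nat \<Rightarrow> nat)" where
  "raise u i = (fst u, (snd u)(i := Suc (snd u i)))"

lemma mdeg_raise:
  assumes "i < n"
  shows "mdeg n (raise u i) = Suc (mdeg n u)"
proof -
  have "(\<Sum>j<n. ((snd u)(i := Suc (snd u i))) j) = (\<Sum>j<n. snd u j + (if j = i then 1 else 0))"
    by (rule sum.cong) auto
  then show ?thesis using assms by (simp add: mdeg_def raise_def sum.distrib del: fun_upd_apply)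
qed

lemma shift_coeff_raise:
  assumes "i < n"
  shows "shift_coeff n (raise u i) u m = b m ^ fst u * (of_nat (Suc (snd u i)) * r i m)"
proof -
  have "(\<Prod>j<n. of_nat ((snd (raise u i)) j choose snd u j) * r j m ^ (snd (raise u i) j - snd u j)) =
      (\<Prod>j<n. if j = i then of_nat (Suc (snd u i)) * r i m else 1)"
    by (rule prod.cong) (auto simp: raise_def simp del: of_nat_Suc)
  also have "\<dots> = of_nat (Suc (snd u i)) * r i m"
    using assms by (simp add: prod.delta)
  finally show ?thesis by (simp add: shift_coeff_def) (simp add: raise_def)
qed

text \<open>A nonzero coefficient makes \<open>u\<close> divide \<open>t\<close>. Some exponent
  \<open>i\<close> is larger in \<open>t\<close>, so \<open>raise u i\<close> still divides
  \<open>t\<close>, and equal degrees force equality.\<close>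

lemma raise_if_shift_coeff_nonzero:
  assumes "snd t \<in> extensional {..<n}" "snd u \<in> extensional {..<n}"
    "mdeg n t = Suc (mdeg n u)" "shift_coeff n t u m \<noteq> 0"
  obtains i where "i < n" "t = raise u i"
proof -
  note * = shift_coeff_nonzeroD[OF assms(4)]
  have "\<exists>i<n. snd u i \<noteq> snd t i"
  proof (rule ccontr)
    assume "\<not> (\<exists>i<n. snd u i \<noteq> snd t i)"
    then have "mdeg n t = mdeg n u" by (simp add: mdeg_def)
    then show False using assms(3) by simp
  qed
  then obtain i where i: "i < n" "snd u i \<noteq> snd t i" by blast
  have le: "snd (raise u i) j \<le> snd t j" if "j < n" for j
    using *(2)[OF that] i by (auto simp: raise_def)
  have "snd (raise u i) j = snd t j" if "j < n" for j
  proof (rule ccontr)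
    assume "snd (raise u i) j \<noteq> snd t j"
    then have "snd (raise u i) j < snd t j" using le[OF that] by simp
    then have "mdeg n (raise u i) < mdeg n t" unfolding mdeg_def
      using that le by (intro sum_strict_mono_ex1) auto
    then show False using assms(3) mdeg_raise[OF i(1), of u] by simp
  qed
  moreover have "snd (raise u i) \<in> extensional {..<n}"
    using assms(2) i(1) by (auto simp: raise_def extensional_def)
  ultimately have "snd (raise u i) = snd t"
    using assms(1) by (intro extensionalityI[of _ "{..<n}"]) auto
  then have "t = raise u i" using *(1) by (simp add: prod_eq_iff raise_def)
  then show thesis using that i(1) by blast
qed

lemma rational_seq_shift_coeff: "shift_coeff n t u \<in> rational_seq"
proof (cases "fst t = fst u")
  case True
  then have "shift_coeff n t u = (\<lambda>m. b m ^ fst t *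
      (\<Prod>i<n. of_nat (snd t i choose snd u i) * r i m ^ (snd t i - snd u i)))"
    by (simp add: shift_coeff_def fun_eq_iff)
  then show ?thesis
    by (simp only:) (intro rational_seq_mult rational_seq_prod rational_seq_power rational_seq_const
        rational_seq_b rational_seq_r)
next
  case False
  then have "shift_coeff n t u = (\<lambda>m. 0)" by (simp add: shift_coeff_def fun_eq_iff)
  then show ?thesis by (simp add: rational_seq_const)
qed

section \<open>Relations and their shifts\<close>

definition relation :: "nat \<Rightarrow> (nat \<times> (nat \<Rightarrow> nat)) set \<Rightarrow>
    (nat \<times> (nat \<Rightarrow> nat) \<Rightarrow> nat \<Rightarrow> 'a) \<Rightarrow> bool" where
  "relation n T c \<longleftrightarrow> finite T \<and> (\<forall>t\<in>T. snd t \<in> extensional {..<n} \<and> c t \<in> rational_seq) \<and>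
     (\<forall>\<^sub>F m in sequentially. (\<Sum>t\<in>T. c t m * mono_at n t m) = 0)"

text \<open>The coefficients of the relation at \<open>Suc m\<close> minus \<open>b m ^ k\<close>
  times the relation at \<open>m\<close>. If \<open>k\<close> is the exponent of \<open>F\<close> in
  a monomial of top degree with coefficient 1, that monomial cancels.\<close>

definition shifted :: "nat \<Rightarrow> (nat \<times> (nat \<Rightarrow> nat)) set \<Rightarrow> (nat \<times> (nat \<Rightarrow> nat) \<Rightarrow> nat \<Rightarrow> 'a) \<Rightarrow>
    nat \<Rightarrow> nat \<times> (nat \<Rightarrow> nat) \<Rightarrow> nat \<Rightarrow> 'a" where
  "shifted n T c k u m = (\<Sum>t\<in>T. c t (Suc m) * shift_coeff n t u m) -
     b m ^ k * (if u \<in> T then c u m else 0)"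

text \<open>The monomials at \<open>Suc m\<close> are expanded by \<open>mono_at_Suc\<close> and
  collected. Lower monomials appear in this way, so the index set grows to all divisors of members
  of \<open>T\<close>.\<close>

lemma relation_shifted:
  assumes "relation n T c"
  shows "relation n (\<Union>t\<in>T. divisors n t) (shifted n T c k)"
proof -
  let ?T' = "\<Union>t\<in>T. divisors n t"
  have fin: "finite T" and c: "\<And>t. t \<in> T \<Longrightarrow> c t \<in> rational_seq"
    and ext: "\<And>t. t \<in> T \<Longrightarrow> snd t \<in> extensional {..<n}"
    and zero: "\<forall>\<^sub>F m in sequentially. (\<Sum>t\<in>T. c t m * mono_at n t m) = 0"
    using assms by (auto simp: relation_def)
  have fin': "finite ?T'" using fin finite_divisors by auto
  have sub: "T \<subseteq> ?T'"
  proof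
    fix t assume t: "t \<in> T"
    have "t \<in> divisors n t" using ext[OF t] by (simp add: divisors_iff)
    then show "t \<in> ?T'" using t by blast
  qed
  have "\<forall>\<^sub>F m in sequentially. (\<Sum>t\<in>T. c t (Suc m) * mono_at n t (Suc m)) = 0"
    using zero by (subst eventually_sequentially_Suc)
  with zero have "\<forall>\<^sub>F m in sequentially. (\<Sum>u\<in>?T'. shifted n T c k u m * mono_at n u m) = 0"
  proof eventually_elim
    case (elim m)
    have "(\<Sum>u\<in>?T'. shifted n T c k u m * mono_at n u m) =
        (\<Sum>u\<in>?T'. \<Sum>t\<in>T. c t (Suc m) * shift_coeff n t u m * mono_at n u m) -
        (\<Sum>u\<in>?T'. b m ^ k * (if u \<in> T then c u m else 0) * mono_at n u m)"
      by (simp only: shifted_def left_diff_distrib sum_subtractf sum_distrib_right)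
    also have "(\<Sum>u\<in>?T'. \<Sum>t\<in>T. c t (Suc m) * shift_coeff n t u m * mono_at n u m) =
        (\<Sum>t\<in>T. c t (Suc m) * mono_at n t (Suc m))"
    proof (subst sum.swap, rule sum.cong[OF refl])
      fix t assume t: "t \<in> T"
      have "(\<Sum>u\<in>?T'. shift_coeff n t u m * mono_at n u m) =
          (\<Sum>u\<in>divisors n t. shift_coeff n t u m * mono_at n u m)"
      proof (rule sum.mono_neutral_right[OF fin'])
        show "\<forall>u\<in>?T' - divisors n t. shift_coeff n t u m * mono_at n u m = 0"
        proof
          fix u assume u: "u \<in> ?T' - divisors n t"
          then have u_ext: "snd u \<in> extensional {..<n}" by (auto simp: divisors_iff)
          have "shift_coeff n t u m = 0"
          proof (rule ccontr)
            assume "shift_coeff n t u m \<noteq> 0"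
            from shift_coeff_nonzeroD[OF this] u_ext have "u \<in> divisors n t"
              by (simp add: divisors_iff)
            then show False using u by simp
          qed
          then show "shift_coeff n t u m * mono_at n u m = 0" by simp
        qed
      qed (use t in auto)
      then show "(\<Sum>u\<in>?T'. c t (Suc m) * shift_coeff n t u m * mono_at n u m) =
          c t (Suc m) * mono_at n t (Suc m)"
        by (simp add: mono_at_Suc sum_distrib_left[symmetric] mult.assoc)
    qed
    also have "(\<Sum>u\<in>?T'. b m ^ k * (if u \<in> T then c u m else 0) * mono_at n u m) =
        (\<Sum>u\<in>T. b m ^ k * (if u \<in> T then c u m else 0) * mono_at n u m)"
      by (rule sum.mono_neutral_right[OF fin' sub]) auto
    also have "\<dots> = b m ^ k * (\<Sum>u\<in>T. c u m * mono_at n u m)"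
      unfolding sum_distrib_left by (rule sum.cong) auto
    finally show ?case using elim by simp
  qed
  moreover have "shifted n T c k u \<in> rational_seq" for u
  proof -
    have "(\<lambda>m. if u \<in> T then c u m else 0) \<in> rational_seq"
      by (cases "u \<in> T") (auto intro: c rational_seq_const)
    then show ?thesis unfolding shifted_def[abs_def]
      by (intro rational_seq_diff rational_seq_sum rational_seq_mult rational_seq_power
          rational_seq_b rational_seq_shift[OF c] rational_seq_shift_coeff)
  qed
  moreover have "snd u \<in> extensional {..<n}" if "u \<in> ?T'" for u
    using that by (auto simp: divisors_iff)
  ultimately show ?thesis using fin' by (auto simp: relation_def)
qed

lemma relation_remove:
  assumes "relation n T c" "\<forall>\<^sub>F m in sequentially. c t m = 0"
  shows "relation n (T - {t}) c"
proof -
  have zero: "\<forall>\<^sub>F m in sequentially. (\<Sum>t\<in>T. c t m * mono_at n t m) = 0" and "finite T"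
    using assms(1) by (auto simp: relation_def)
  have "\<forall>\<^sub>F m in sequentially. (\<Sum>t\<in>T - {t}. c t m * mono_at n t m) = 0"
    using zero assms(2) by eventually_elim (simp add: sum_diff1 \<open>finite T\<close>)
  then show ?thesis using assms(1) by (auto simp: relation_def)
qed

lemma relation_normalize:
  assumes "relation n T c" "d \<in> rational_seq"
  shows "relation n T (\<lambda>t m. c t m / d m)"
proof -
  have "\<forall>\<^sub>F m in sequentially. (\<Sum>t\<in>T. c t m * mono_at n t m) = 0"
    using assms(1) by (auto simp: relation_def)
  then have "\<forall>\<^sub>F m in sequentially. (\<Sum>t\<in>T. c t m / d m * mono_at n t m) = 0"
  proof eventually_elim
    case (elim m)
    have "(\<Sum>t\<in>T. c t m / d m * mono_at n t m) = (\<Sum>t\<in>T. c t m * mono_at n t m) / d m"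
      by (simp add: sum_divide_distrib)
    then show ?case using elim by simp
  qed
  then show ?thesis using assms by (auto simp: relation_def intro: rational_seq_divide)
qed

text \<open>By triangularity no other monomial reaches \<open>u\<close>. What remains is the twisted
  difference treated in \<open>twisted_invariant_exponent\<close>.\<close>

lemma shifted_top:
  assumes "finite T" "\<And>t. t \<in> T \<Longrightarrow> snd t \<in> extensional {..<n} \<and> mdeg n t \<le> d"
    and "u \<in> T" "mdeg n u = d"
  shows "shifted n T c k u m = c u (Suc m) * b m ^ fst u - b m ^ k * c u m"
proof -
  have "(\<Sum>t\<in>T. c t (Suc m) * shift_coeff n t u m) = (\<Sum>t\<in>{u}. c t (Suc m) * shift_coeff n t u m)"
  proof (rule sum.mono_neutral_right)
    show "\<forall>t\<in>T - {u}. c t (Suc m) * shift_coeff n t u m = 0"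
    proof
      fix t assume "t \<in> T - {u}"
      then have "shift_coeff n t u m = 0"
        using assms(2)[of t] assms(2)[of u] assms(3,4) by (intro shift_coeff_same_degree) auto
      then show "c t (Suc m) * shift_coeff n t u m = 0" by simp
    qed
  qed (use assms in auto)
  then show ?thesis using assms by (simp add: shifted_def shift_coeff_refl)
qed

text \<open>One degree below the top only \<open>u\<close> and its multiples
  \<open>raise u i\<close> contribute; here the increments \<open>r i\<close> enter, and only
  linearly. Monomials outside \<open>T\<close> count with coefficient 0.\<close>

lemma shifted_next:
  assumes "finite T" "\<And>t. t \<in> T \<Longrightarrow> snd t \<in> extensional {..<n} \<and> mdeg n t \<le> Suc (mdeg n u)"
    and u: "snd u \<in> extensional {..<n}"
  shows "shifted n T c k u m = (if u \<in> T then c u (Suc m) * b m ^ fst u else 0) +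
     (\<Sum>i<n. (if raise u i \<in> T then c (raise u i) (Suc m) else 0) *
        (b m ^ fst u * (of_nat (Suc (snd u i)) * r i m))) -
     b m ^ k * (if u \<in> T then c u m else 0)"
proof -
  let ?f = "\<lambda>t. c t (Suc m) * shift_coeff n t u m"
  let ?R = "raise u ` {..<n}"
  have uR: "u \<notin> ?R"
  proof
    assume "u \<in> ?R"
    then obtain i where "i < n" "u = raise u i" by auto
    then show False using mdeg_raise[of i n u] by simp
  qed
  have inj: "inj_on (raise u) {..<n}"
  proof (rule inj_onI)
    fix i j assume "raise u i = raise u j"
    then have "((snd u)(i := Suc (snd u i))) i = ((snd u)(j := Suc (snd u j))) i"
      by (simp add: raise_def)
    then show "i = j" by (auto split: if_splits)
  qed
  have "sum ?f T = sum ?f (T \<inter> insert u ?R)"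
  proof (rule sum.mono_neutral_right)
    show "\<forall>t\<in>T - T \<inter> insert u ?R. ?f t = 0"
    proof
      fix t assume t: "t \<in> T - T \<inter> insert u ?R"
      have "shift_coeff n t u m = 0"
      proof (rule ccontr)
        assume nz: "shift_coeff n t u m \<noteq> 0"
        then have "\<not> mdeg n t \<le> mdeg n u"
          using t assms(2)[of t] u shift_coeff_same_degree[of t n u m] by auto
        then have "mdeg n t = Suc (mdeg n u)" using t assms(2)[of t] by auto
        then obtain i where "i < n" "t = raise u i"
          using raise_if_shift_coeff_nonzero[OF _ u _ nz] assms(2) t by blast
        then show False using t by auto
      qed
      then show "?f t = 0" by simp
    qed
  qed (use assms(1) in auto)
  also have "\<dots> = (\<Sum>t\<in>insert u ?R. if t \<in> T then ?f t else 0)"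
    by (subst Int_commute) (rule sum.inter_restrict, simp)
  also have "\<dots> = (if u \<in> T then ?f u else 0) + (\<Sum>t\<in>?R. if t \<in> T then ?f t else 0)"
    using uR by simp
  also have "(\<Sum>t\<in>?R. if t \<in> T then ?f t else 0) =
      (\<Sum>i<n. if raise u i \<in> T then ?f (raise u i) else 0)"
    by (simp add: sum.reindex[OF inj])
  also have "\<dots> = (\<Sum>i<n. (if raise u i \<in> T then c (raise u i) (Suc m) else 0) *
        (b m ^ fst u * (of_nat (Suc (snd u i)) * r i m)))"
    by (intro sum.cong refl) (auto simp: shift_coeff_raise simp del: of_nat_Suc)
  finally show ?thesis by (simp add: shifted_def shift_coeff_refl)
qed

text \<open>A relation of least degree \<open>d\<close> with the fewest monomials of degree \<open>d\<close>, one of them with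
  coefficient \<open>1\<close>, is fixed by the shift up to a power of \<open>b\<close>. So its coefficients in degree \<open>d\<close>
  are constants, and comparing coefficients in degree \<open>d - 1\<close> contradicts
  \<open>combination_not_telescoping\<close>.\<close>

lemma relation_trivial_upto_degree:
  assumes "relation n T c" "\<And>t. t \<in> T \<Longrightarrow> mdeg n t \<le> d"
  shows "\<forall>t\<in>T. \<forall>\<^sub>F m in sequentially. c t m = 0"
  using assms
proof (induction d arbitrary: T c rule: less_induct)
  case (less d)
  note IHd = less.IH
  \<comment> \<open>The inner induction counts only monomials of degree \<open>d\<close>; those of
    lower degree may multiply under the shift without harm.\<close>
  from less.prems show ?case
  proof (induction "card {t \<in> T. mdeg n t = d}" arbitrary: T c rule: less_induct)
    case (less T)
    note IH = less.hyps
    have fin: "finite T" and rat: "\<And>t. t \<in> T \<Longrightarrow> c t \<in> rational_seq"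
      and ext: "\<And>t. t \<in> T \<Longrightarrow> snd t \<in> extensional {..<n}"
      using less.prems(1) by (auto simp: relation_def)
    show ?case
    proof (cases "\<exists>t0\<in>T. mdeg n t0 = d")
      case False
      then have lt: "mdeg n t < d" if "t \<in> T" for t
        using less.prems(2) that by (meson le_neq_implies_less)
      show ?thesis
      proof (cases "d = 0")
        case True
        then show ?thesis using lt by auto
      next
        case False
        then show ?thesis using IHd[of "d - 1" T c] less.prems(1) lt by fastforce
      qed
    next
      case True
      then obtain t0 where t0: "t0 \<in> T" "mdeg n t0 = d" by blast
      have smaller: "card {t \<in> T' - {t0}. mdeg n t = d} < card {t \<in> T. mdeg n t = d}"
        if "\<And>t. t \<in> T' \<Longrightarrow> mdeg n t = d \<Longrightarrow> t \<in> T" for T'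
        by (rule psubset_card_mono) (use fin t0 that in auto)
      show ?thesis
      proof (rule rational_seq_cases[OF rat[OF t0(1)]])
        assume z: "\<forall>\<^sub>F m in sequentially. c t0 m = 0"
        have "\<forall>t\<in>T - {t0}. \<forall>\<^sub>F m in sequentially. c t m = 0"
          using IH[OF smaller, of T] relation_remove[OF less.prems(1) z] less.prems(2) by auto
        then show ?thesis using z by auto
      next
        assume nz: "\<forall>\<^sub>F m in sequentially. c t0 m \<noteq> 0"
        \<comment> \<open>The coefficient of \<open>t0\<close> becomes eventually 1, hence shift
          invariant, so \<open>?c'\<close> loses \<open>t0\<close>.\<close>
        define c1 where "c1 t m = c t m / c t0 m" for t m
        have rel: "relation n T c1"
          using relation_normalize[OF less.prems(1) rat[OF t0(1)]] by (simp add: c1_def[abs_def])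
        then have rat1: "\<And>t. t \<in> T \<Longrightarrow> c1 t \<in> rational_seq" by (simp add: relation_def)
        have c1_t0: "\<forall>\<^sub>F m in sequentially. c1 t0 m = 1"
          using nz by eventually_elim (simp add: c1_def)
        then have c1_t0': "\<forall>\<^sub>F m in sequentially. c1 t0 (Suc m) = 1"
          by (subst eventually_sequentially_Suc)
        define k where "k = fst t0"
        let ?c' = "shifted n T c1 k" let ?T' = "\<Union>t\<in>T. divisors n t"
        have deg_div: "mdeg n u \<le> mdeg n t" if "u \<in> divisors n t" for u t
          using that by (auto simp: divisors_iff mdeg_def intro!: sum_mono)
        \<comment> \<open>A proper divisor has smaller degree: the shift creates no new monomial of
          degree \<open>d\<close>, and the count falls when \<open>t0\<close> is removed.\<close>
        have top_in_T: "u \<in> T" if "u \<in> ?T'" "mdeg n u = d" for u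
        proof -
          from that(1) obtain t where t: "t \<in> T" "u \<in> divisors n t" by blast
          have "mdeg n t = mdeg n u"
            using deg_div[OF t(2)] less.prems(2)[OF t(1)] that(2) by simp
          moreover have le: "snd u i \<le> snd t i" if "i < n" for i
            using t(2) that by (auto simp: divisors_iff)
          ultimately have "snd u i = snd t i" if "i < n" for i
          proof -
            have "\<not> snd u i < snd t i"
            proof
              assume "snd u i < snd t i"
              then have "mdeg n u < mdeg n t" unfolding mdeg_def
                using that le by (intro sum_strict_mono_ex1) auto
              then show False using \<open>mdeg n t = mdeg n u\<close> by simp
            qed
            then show ?thesis using le[OF that] by simp
          qed
          then have "snd u = snd t" using ext[OF t(1)] t(2)
            by (intro extensionalityI[of _ "{..<n}"]) (auto simp: divisors_iff)
          then have "u = t" using t(2) by (auto simp: divisors_iff prod_eq_iff)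
          then show ?thesis using t by simp
        qed
        have rel': "relation n ?T' ?c'" by (rule relation_shifted[OF rel])
        have T_bound: "snd t \<in> extensional {..<n} \<and> mdeg n t \<le> d" if "t \<in> T" for t
          using that ext less.prems(2) by blast
        have "\<forall>\<^sub>F m in sequentially. ?c' t0 m = 0"
          using c1_t0 c1_t0'
          by eventually_elim (simp add: shifted_top[OF fin T_bound t0] k_def)
        then have "relation n (?T' - {t0}) ?c'" by (rule relation_remove[OF rel'])
        then have "\<forall>t\<in>?T' - {t0}. \<forall>\<^sub>F m in sequentially. ?c' t m = 0"
        proof (rule IH[rotated])
          show "mdeg n t \<le> d" if "t \<in> ?T' - {t0}" for t
            using that deg_div less.prems(2) order_trans by blast
          show "card {t \<in> ?T' - {t0}. mdeg n t = d} < card {t \<in> T. mdeg n t = d}"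
            by (rule smaller) (rule top_in_T)
        qed
        with \<open>\<forall>\<^sub>F m in sequentially. ?c' t0 m = 0\<close>
        have c'_zero: "\<forall>\<^sub>F m in sequentially. ?c' t m = 0" if "t \<in> ?T'" for t
          using that by (cases "t = t0") auto
        have sub: "T \<subseteq> ?T'"
        proof
          fix t assume t: "t \<in> T"
          have "t \<in> divisors n t" using ext[OF t] by (simp add: divisors_iff)
          then show "t \<in> ?T'" using t by blast
        qed
        have top: "(\<forall>\<^sub>F m in sequentially. c1 t m = 0) \<or> fst t = k"
          and top_const: "\<exists>a. \<forall>\<^sub>F m in sequentially. c1 t m = a" if t: "t \<in> T" "mdeg n t = d" for t
        proof -
          have *: "\<forall>\<^sub>F m in sequentially. c1 t (Suc m) * b m ^ fst t = b m ^ k * c1 t m"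
            using c'_zero[of t] t sub shifted_top[OF fin T_bound t, of c1 k] by auto
          then show **: "(\<forall>\<^sub>F m in sequentially. c1 t m = 0) \<or> fst t = k"
            using twisted_invariant_exponent[OF rat1[OF t(1)]] by blast
          show "\<exists>a. \<forall>\<^sub>F m in sequentially. c1 t m = a"
          proof (cases "fst t = k")
            case True
            have "\<forall>\<^sub>F m in sequentially. c1 t (Suc m) = c1 t m"
              using * by eventually_elim (use True b_nonzero in simp)
            then show ?thesis by (rule eventually_shift_invariant) blast
          qed (use ** in blast)
        qed
        have False
        proof (cases "d = 0")
          case True
          \<comment> \<open>In degree 0 the monomials are powers of \<open>F\<close>; only
            \<open>F ^ k\<close> is left with a nonzero coefficient, and \<open>F\<close> has no
            zeros.\<close>
          have T_eq: "mdeg n t = d" if "t \<in> T" for t using less.prems(2)[OF that] True by simp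
          have others: "\<forall>\<^sub>F m in sequentially. c1 t m = 0" if "t \<in> T - {t0}" for t
          proof -
            have "snd t i = snd t0 i" if "i < n" for i
              using T_eq[of t] t0(2) True that \<open>t \<in> T - {t0}\<close> by (auto simp: mdeg_def)
            then have "snd t = snd t0" using ext t0(1) that
              by (intro extensionalityI[of _ "{..<n}"]) auto
            then have "fst t \<noteq> k" using that by (auto simp: k_def prod_eq_iff)
            then show ?thesis using top[of t] T_eq[of t] that by auto
          qed
          have "\<forall>\<^sub>F m in sequentially. \<forall>t\<in>T - {t0}. c1 t m = 0"
            using others fin by (subst eventually_ball_finite_distrib) auto
          moreover have "\<forall>\<^sub>F m in sequentially. (\<Sum>t\<in>T. c1 t m * mono_at n t m) = 0"
            using rel by (simp add: relation_def)
          ultimately have "\<forall>\<^sub>F m in sequentially. False" using c1_t0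
          proof eventually_elim
            case (elim m)
            have "(\<Sum>t\<in>T. c1 t m * mono_at n t m) = mono_at n t0 m"
              using elim fin t0(1) by (subst sum.remove[of _ t0]) auto
            also have "\<dots> = F m ^ k" using t0(2) True by (simp add: mono_at_def k_def mdeg_def)
            finally show False using elim F_nonzero by simp
          qed
          then show False by simp
        next
          case False
          have "\<exists>i<n. snd t0 i \<noteq> 0"
          proof (rule ccontr)
            assume "\<not> (\<exists>i<n. snd t0 i \<noteq> 0)"
            then have "mdeg n t0 = 0" by (simp add: mdeg_def)
            then show False using t0(2) False by simp
          qed
          then obtain i where i: "i < n" "snd t0 i \<noteq> 0" by blast
          \<comment> \<open>\<open>t0\<close> with one factor \<open>H i\<close> removed. The
            vanishing shifted coefficient of \<open>u\<close> gives the telescoping identity below,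
            in which \<open>\<mu> i\<close> is the exponent of \<open>H i\<close> in
            \<open>t0\<close>, hence not 0.\<close>
          define u where "u = (k, (snd t0)(i := snd t0 i - 1))"
          have u_ext: "snd u \<in> extensional {..<n}"
            using ext[OF t0(1)] i(1) by (auto simp: u_def extensional_def)
          have raise_u: "raise u i = t0"
            using i(2) by (auto simp: u_def raise_def k_def prod_eq_iff)
          have deg_u: "Suc (mdeg n u) = d" using mdeg_raise[OF i(1), of u] raise_u t0(2) by simp
          have "u \<in> divisors n t0" using ext[OF t0(1)] i(1)
            by (auto simp: u_def k_def divisors_iff extensional_def)
          then have "\<forall>\<^sub>F m in sequentially. ?c' u m = 0" using c'_zero t0(1) by blast
          define a where "a t = (SOME a. \<forall>\<^sub>F m in sequentially. c1 t m = a)" for t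
          have a: "\<forall>\<^sub>F m in sequentially. c1 t (Suc m) = a t" if "t \<in> T" "mdeg n t = d" for t
          proof -
            have "\<forall>\<^sub>F m in sequentially. c1 t m = a t"
              unfolding a_def using top_const[OF that] by (rule someI_ex)
            then show ?thesis by (subst eventually_sequentially_Suc)
          qed
          define \<mu> where "\<mu> j = (if raise u j \<in> T then a (raise u j) else 0) * of_nat (Suc (snd u j))" for j
          define q where "q m = (if u \<in> T then c1 u m else 0)" for m
          have "q \<in> rational_seq"
            by (cases "u \<in> T") (auto simp: q_def[abs_def] intro: rat1 rational_seq_const)
          moreover have "\<forall>\<^sub>F m in sequentially. (\<Sum>j<n. \<mu> j * r j m) = q m - q (Suc m)"
          proof -
            have "\<forall>\<^sub>F m in sequentially. \<forall>j\<in>{..<n}. raise u j \<in> T \<longrightarrow> c1 (raise u j) (Suc m) = a (raise u j)"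
            proof (subst eventually_ball_finite_distrib, simp, rule ballI)
              fix j assume "j \<in> {..<n}"
              then have "mdeg n (raise u j) = d" using mdeg_raise[of j n u] deg_u by simp
              then show "\<forall>\<^sub>F m in sequentially. raise u j \<in> T \<longrightarrow> c1 (raise u j) (Suc m) = a (raise u j)"
                using a[of "raise u j"] by (cases "raise u j \<in> T") auto
            qed
            with \<open>\<forall>\<^sub>F m in sequentially. ?c' u m = 0\<close> show ?thesis
            proof eventually_elim
              case (elim m)
              have "?c' u m = b m ^ k * (q (Suc m) + (\<Sum>j<n. \<mu> j * r j m) - q m)"
              proof -
                have "(\<Sum>j<n. (if raise u j \<in> T then c1 (raise u j) (Suc m) else 0) *
                    (b m ^ fst u * (of_nat (Suc (snd u j)) * r j m))) =
                    b m ^ k * (\<Sum>j<n. \<mu> j * r j m)"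
                  unfolding sum_distrib_left using elim(2)
                  by (intro sum.cong refl) (auto simp: \<mu>_def u_def)
                moreover have bound: "snd t \<in> extensional {..<n} \<and> mdeg n t \<le> Suc (mdeg n u)"
                  if "t \<in> T" for t using T_bound[OF that] deg_u by simp
                ultimately show ?thesis
                  by (simp add: shifted_next[OF fin bound u_ext] q_def algebra_simps)
                    (simp add: u_def)
              qed
              then have "q (Suc m) + (\<Sum>j<n. \<mu> j * r j m) - q m = 0"
                using elim(1) b_nonzero by simp
              then show ?case by (simp add: algebra_simps)
            qed
          qed
          ultimately have "\<mu> i = 0" using combination_not_telescoping i(1) by blast
          moreover have "a t0 = 1"
          proof -
            have "\<forall>\<^sub>F m in (sequentially :: nat filter). a t0 = 1"
              using a[OF t0] c1_t0' by eventually_elim simp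
            then show ?thesis by simp
          qed
          ultimately show False using t0(1) raise_u by (simp add: \<mu>_def del: of_nat_Suc)
        qed
        then show ?thesis ..
      qed
    qed
  qed
qed

theorem relation_trivial:
  assumes "relation n T c" "t \<in> T"
  shows "\<forall>\<^sub>F m in sequentially. c t m = 0"
proof -
  have "finite T" using assms(1) by (simp add: relation_def)
  then have "mdeg n t \<le> Max (mdeg n ` T)" if "t \<in> T" for t using that by simp
  then show ?thesis using relation_trivial_upto_degree[OF assms(1)] assms(2) by blast
qed

end

section \<open>Absolute value and Morita gamma function\<close>

lemma absval_0 [simp]: "absval (0 :: 'a::nonarch_field) = 0"
  using dist_absval[of "0 :: 'a" 0] by simp

lemma absval_eq_dist: "absval (x :: 'a::nonarch_field) = dist x 0"
  by (simp add: dist_absval)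

lemma absval_nonneg [simp]: "0 \<le> absval (x :: 'a::nonarch_field)"
  by (simp add: absval_eq_dist)

lemma absval_eq_0_iff [simp]: "absval (x :: 'a::nonarch_field) = 0 \<longleftrightarrow> x = 0"
  by (simp add: absval_eq_dist)

lemma absval_pos_iff [simp]: "0 < absval (x :: 'a::nonarch_field) \<longleftrightarrow> x \<noteq> 0"
  using absval_nonneg[of x] absval_eq_0_iff[of x] by linarith

lemma absval_1 [simp]: "absval (1 :: 'a::nonarch_field) = 1"
  using absval_mult[of "1 :: 'a" 1] by simp

lemma absval_minus [simp]: "absval (- x :: 'a::nonarch_field) = absval x"
proof -
  have "absval (-1 :: 'a) * absval (-1 :: 'a) = 1" by (simp flip: absval_mult)
  then have "(absval (-1 :: 'a) - 1) * (absval (-1 :: 'a) + 1) = 0" by (simp add: algebra_simps)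
  then have "absval (-1 :: 'a) = 1" using absval_nonneg[of "-1 :: 'a"] by simp
  then show ?thesis using absval_mult[of "-1" x] by simp
qed

lemma absval_minus_commute: "absval (x - y :: 'a::nonarch_field) = absval (y - x)"
  by (metis absval_minus minus_diff_eq)

lemma absval_add_le:
  "absval (x :: 'a::nonarch_field) \<le> C \<Longrightarrow> absval y \<le> C \<Longrightarrow> absval (x + y) \<le> C"
  using absval_add[of x y] by simp

lemma absval_diff_le:
  "absval (x :: 'a::nonarch_field) \<le> C \<Longrightarrow> absval y \<le> C \<Longrightarrow> absval (x - y) \<le> C"
  using absval_add_le[of x C "- y"] by simp

lemma absval_triangle_le:
  "absval (x - y :: 'a::nonarch_field) \<le> C \<Longrightarrow> absval (y - z) \<le> C \<Longrightarrow> absval (x - z) \<le> C"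
  using absval_add_le[of "x - y" C "y - z"] by simp

lemma absval_power: "absval (x ^ n :: 'a::nonarch_field) = absval x ^ n"
  by (induction n) (auto simp: absval_mult)

lemma absval_inverse: "absval (inverse x :: 'a::nonarch_field) = inverse (absval x)"
proof (cases "x = 0")
  case False
  then have "absval x * absval (inverse x) = 1" by (simp flip: absval_mult)
  then show ?thesis by (metis inverse_unique)
qed simp

lemma absval_divide: "absval (x / y :: 'a::nonarch_field) = absval x / absval y"
  by (simp add: divide_inverse absval_mult absval_inverse)

lemma absval_of_nat_le_1 [simp]: "absval (of_nat n :: 'a::nonarch_field) \<le> 1"
  by (induction n) (auto intro: absval_add_le)

lemma absval_of_int_le_1 [simp]: "absval (of_int n :: 'a::nonarch_field) \<le> 1"
  by (cases n rule: int_cases2) auto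

locale padic_complex_field =
  fixes p :: nat and K :: "'a::nonarch_field itself"
  assumes prime_p: "prime p" and padic_complex: "is_padic_complex p K"
begin

lemma absval_of_rat: "absval (of_rat q :: 'a) = padic_abs p q"
  using padic_complex unfolding is_padic_complex_def by blast

lemma complete_UNIV: "complete (UNIV :: 'a set)"
  using padic_complex unfolding is_padic_complex_def by blast

lemma p_gt_1: "real p > 1"
  using prime_gt_1_nat[OF prime_p] by simp

definition \<rho> :: real where "\<rho> = 1 / real p"

lemma \<rho>_pos: "0 < \<rho>" and \<rho>_less_1: "\<rho> < 1"
  using p_gt_1 by (auto simp: \<rho>_def)

lemma \<rho>_power_pos [simp]: "0 < \<rho> ^ k" and \<rho>_power_le_1 [simp]: "\<rho> ^ k \<le> 1"
  using \<rho>_pos \<rho>_less_1 by (auto simp: power_le_one)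

lemma \<rho>_power_mono: "k \<le> l \<Longrightarrow> \<rho> ^ l \<le> \<rho> ^ k"
  using \<rho>_pos \<rho>_less_1 by (auto intro: power_decreasing)

lemma \<rho>_power_less: "0 < e \<Longrightarrow> \<exists>k. \<rho> ^ k < e"
  using real_arch_pow_inv[of e \<rho>] \<rho>_less_1 by auto

text \<open>The form in which limits are taken below: an ultrametric estimate through approximants
  costs only a maximum with an error \<open>c * \<rho> ^ k\<close>, which disappears as
  \<open>k\<close> grows.\<close>

lemma le_if_le_\<rho>_power:
  assumes "\<And>k. a \<le> max b (c * \<rho> ^ k)" "0 \<le> b"
  shows "a \<le> b"
proof (rule ccontr)
  assume "\<not> a \<le> b"
  then have ab: "b < a" by simp
  then have pos: "a / (\<bar>c\<bar> + 1) > 0" using assms(2) by auto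
  obtain k where k: "\<rho> ^ k < a / (\<bar>c\<bar> + 1)" using \<rho>_power_less[OF pos] by blast
  have "c * \<rho> ^ k \<le> (\<bar>c\<bar> + 1) * \<rho> ^ k" by (intro mult_right_mono) (auto simp: less_imp_le)
  also have "\<dots> < a" using k by (simp add: field_simps)
  finally show False using assms(1)[of k] ab by simp
qed

lemma absval_p: "absval (of_nat p :: 'a) = \<rho>"
proof -
  have "multiplicity (int p) (int p) = 1"
    using prime_gt_1_nat[OF prime_p] by (intro multiplicity_self) auto
  then have "padic_abs p (of_nat p) = \<rho>"
    using prime_p by (auto simp: padic_abs_def \<rho>_def power_int_def inverse_eq_divide)
  then show ?thesis using absval_of_rat[of "of_nat p"] by simp
qed

lemma absval_of_int_unit:
  assumes "\<not> int p dvd n"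
  shows "absval (of_int n :: 'a) = 1"
proof -
  have "n \<noteq> 0" using assms by auto
  moreover have "multiplicity (int p) n = 0" using assms by (rule not_dvd_imp_multiplicity_0)
  ultimately have "padic_abs p (of_int n) = 1" by (simp add: padic_abs_def)
  then show ?thesis using absval_of_rat[of "of_int n"] by simp
qed

lemma absval_of_int_dvd:
  assumes "int p ^ k dvd n"
  shows "absval (of_int n :: 'a) \<le> \<rho> ^ k"
proof -
  obtain t where "n = int p ^ k * t" using assms by blast
  then have "absval (of_int n :: 'a) = \<rho> ^ k * absval (of_int t :: 'a)"
    by (simp add: absval_mult absval_power absval_p)
  also have "\<dots> \<le> \<rho> ^ k * 1" by (intro mult_left_mono) (auto simp: less_imp_le)
  finally show ?thesis by simp
qed

lemma absval_of_int_eq: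
  assumes "n \<noteq> 0"
  obtains v u where "n = int p ^ v * u" "\<not> int p dvd u" "absval (of_int n :: 'a) = \<rho> ^ v"
proof -
  have "\<not> is_unit (int p)" using prime_gt_1_nat[OF prime_p] by simp
  then obtain u where u: "n = int p ^ multiplicity (int p) n * u" "\<not> int p dvd u"
    using multiplicity_decompose'[OF assms] by blast
  have "absval (of_int n :: 'a) = \<rho> ^ multiplicity (int p) n"
    by (subst u(1)) (simp add: absval_mult absval_power absval_p absval_of_int_unit[OF u(2)])
  with u show thesis using that by blast
qed

lemma dvd_if_absval_of_int_le:
  assumes "absval (of_int n :: 'a) \<le> \<rho> ^ k"
  shows "int p ^ k dvd n"
proof (cases "n = 0")
  case False
  then obtain v u where n: "n = int p ^ v * u" "absval (of_int n :: 'a) = \<rho> ^ v"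
    using absval_of_int_eq by metis
  have "k \<le> v"
  proof (rule ccontr)
    assume "\<not> k \<le> v"
    then have "\<rho> ^ k < \<rho> ^ v" using \<rho>_pos \<rho>_less_1 by (intro power_strict_decreasing) auto
    then show False using assms n(2) by simp
  qed
  then show ?thesis using n(1) by (simp add: le_imp_power_dvd dvd_mult2)
qed simp

lemma absval_fact_ge: "\<rho> ^ n \<le> absval (fact n :: 'a)"
proof -
  obtain v u where vu: "(fact n :: int) = int p ^ v * u" "absval (of_int (fact n) :: 'a) = \<rho> ^ v"
    using absval_of_int_eq[of "fact n"] by (metis fact_nonzero)
  have "int (p ^ v) dvd int (fact n)" using vu(1) by simp
  then have "p ^ v dvd fact n" by (simp only: int_dvd_int_iff)
  then have "v \<le> n" using prime_power_dvd_fact_le[OF prime_p] by blast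
  then show ?thesis using vu(2) \<rho>_power_mono by simp
qed

section \<open>The p-adic integers\<close>

abbreviation Zp :: "'a set" where "Zp \<equiv> padic_integers"

lemma in_closure_Rats: "x \<in> (padic_numbers :: 'a set) \<longleftrightarrow> (\<forall>e>0. \<exists>q. absval (of_rat q - x) < e)"
  by (auto simp: padic_numbers_def closure_approachable dist_absval Rats_def)

lemma Zp_absval: "x \<in> Zp \<Longrightarrow> absval x \<le> 1"
  by (simp add: padic_integers_def)

text \<open>A rational close to \<open>x\<close> has absolute value at most 1, so its reduced
  denominator is prime to \<open>p\<close> and can be inverted modulo \<open>p ^ k\<close>, which
  yields an integer. Adding a multiple of \<open>p ^ k\<close> moves it beyond any \<open>N\<close>,
  as the gamma values are prescribed only from 2 on.\<close>

lemma Zp_approx: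
  assumes "x \<in> Zp" "0 < e"
  obtains n where "n \<ge> N" "absval (x - of_nat n) < e"
proof -
  have "x \<in> padic_numbers" "0 < min e 1" using assms by (auto simp: padic_integers_def)
  then have "\<exists>q. absval (of_rat q - x) < min e 1" unfolding in_closure_Rats by blast
  then obtain q where q: "absval (of_rat q - x) < e" "absval (of_rat q - x) < 1" by auto
  obtain a b where ab: "quotient_of q = (a, b)" by force
  have b0: "b > 0" and cop: "coprime a b" and q_eq: "q = of_int a / of_int b"
    using quotient_of_denom_pos[OF ab] quotient_of_coprime[OF ab] quotient_of_div[OF ab] by auto
  have q_eq': "(of_rat q :: 'a) = of_int a / of_int b" using b0 by (simp add: q_eq of_rat_divide)
  have "absval (of_rat q :: 'a) \<le> 1"
    using absval_add_le[of "of_rat q - x" 1 x] q(2) Zp_absval[OF assms(1)] by simp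
  then have le: "absval (of_int a :: 'a) \<le> absval (of_int b :: 'a)"
    using b0 by (simp add: q_eq' absval_divide divide_le_eq)
  have b_unit: "\<not> int p dvd b"
  proof
    assume pb: "int p dvd b"
    then have "absval (of_int b :: 'a) \<le> \<rho>" using absval_of_int_dvd[of 1 b] by simp
    then have "absval (of_int a :: 'a) \<le> \<rho> ^ 1" using le by simp
    then have "int p dvd a" using dvd_if_absval_of_int_le[of a 1] by simp
    then have "is_unit (int p)" using pb cop coprime_common_divisor by blast
    then show False using prime_gt_1_nat[OF prime_p] by simp
  qed
  obtain k where k: "\<rho> ^ k < e" using \<rho>_power_less[OF assms(2)] by blast
  have "prime (int p)" using prime_p by simp
  then have "coprime (int p) b" using b_unit by (rule prime_imp_coprime)
  then have "coprime b (int p ^ k)" by (simp add: coprime_commute)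
  then obtain t where t: "[b * t = 1] (mod int p ^ k)" using cong_solve_coprime_int by blast
  define z where "z = (a * t) mod (int p ^ k) + int p ^ k * int N"
  have pk: "int p ^ k > 0" using prime_gt_0_nat[OF prime_p] by simp
  have z_ge: "z \<ge> int N"
  proof -
    have "int N * 1 \<le> int N * int p ^ k" using pk by (intro mult_left_mono) auto
    moreover have "0 \<le> (a * t) mod (int p ^ k)" using pk by simp
    ultimately show ?thesis unfolding z_def by (simp add: mult.commute)
  qed
  have "[z * b = a] (mod int p ^ k)"
  proof -
    have "[z = a * t] (mod int p ^ k)" by (simp add: z_def cong_def)
    then have "[z * b = a * t * b] (mod int p ^ k)" by (rule cong_scalar_right)
    also have "a * t * b = a * (b * t)" by simp
    also have "[a * (b * t) = a * 1] (mod int p ^ k)" using t by (rule cong_scalar_left)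
    finally show ?thesis by simp
  qed
  then have "int p ^ k dvd a - z * b" by (metis cong_iff_dvd_diff cong_sym)
  then have "absval (of_int (a - z * b) :: 'a) \<le> \<rho> ^ k" by (rule absval_of_int_dvd)
  moreover have "of_rat q - of_int z = (of_int (a - z * b) / of_int b :: 'a)"
    using b0 by (simp add: q_eq' field_simps)
  ultimately have "absval (of_rat q - of_int z :: 'a) \<le> \<rho> ^ k"
    using absval_of_int_unit[OF b_unit] by (simp add: absval_divide)
  then have "absval (of_rat q - of_int z :: 'a) < e" using k by simp
  moreover have "(of_int z :: 'a) = of_nat (nat z)" using z_ge by simp
  ultimately have "absval (x - of_nat (nat z)) < e"
    using absval_add[of "x - of_rat q" "of_rat q - of_nat (nat z)"] q(1)
    by (simp add: absval_minus_commute[of x])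
  moreover have "nat z \<ge> N" using z_ge by simp
  ultimately show thesis using that by blast
qed

text \<open>The converse of \<open>Zp_approx\<close>: the integers lie in the unit ball, and so do
  their limits. Closure properties of \<open>Zp\<close> are derived from it.\<close>

lemma ZpI:
  assumes "\<And>e. 0 < e \<Longrightarrow> \<exists>n :: int. absval (x - of_int n) < e"
  shows "x \<in> Zp"
proof -
  obtain n :: int where "absval (x - of_int n) < 1" using assms[of 1] by auto
  then have "absval x \<le> 1" using absval_add_le[of "x - of_int n" 1 "of_int n"] by simp
  moreover have "x \<in> padic_numbers"
    unfolding in_closure_Rats
  proof (intro allI impI)
    fix e :: real assume "0 < e"
    then obtain n :: int where "absval (x - of_int n) < e" using assms by blast
    then show "\<exists>q. absval (of_rat q - x) < e"
      by (intro exI[of _ "of_int n"]) (simp add: absval_minus_commute)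
  qed
  ultimately show ?thesis by (simp add: padic_integers_def)
qed

lemma Zp_of_int [simp]: "of_int n \<in> Zp"
  by (rule ZpI) (auto intro!: exI[of _ n])

lemma Zp_of_nat [simp]: "of_nat n \<in> Zp"
  using Zp_of_int[of "int n"] by simp

lemma Zp_add:
  assumes "x \<in> Zp" "y \<in> Zp"
  shows "x + y \<in> Zp"
proof (rule ZpI)
  fix e :: real assume e: "0 < e"
  obtain m where m: "absval (x - of_nat m) < e" using Zp_approx[OF assms(1) e] by metis
  obtain n where n: "absval (y - of_nat n) < e" using Zp_approx[OF assms(2) e] by metis
  have "absval ((x - of_nat m) + (y - of_nat n)) < e"
    using absval_add[of "x - of_nat m" "y - of_nat n"] m n by simp
  then show "\<exists>k :: int. absval (x + y - of_int k) < e"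
    by (intro exI[of _ "int (m + n)"]) (simp add: algebra_simps)
qed

lemma Zp_mult_of_nat:
  assumes "x \<in> Zp"
  shows "of_nat k * x \<in> Zp"
proof (induction k)
  case 0
  then show ?case using Zp_of_nat[of 0] by simp
next
  case (Suc k)
  then show ?case using Zp_add[OF assms Suc] by (simp add: algebra_simps)
qed

text \<open>An integer close enough to \<open>x\<close> also has absolute value at most
  \<open>\<rho> ^ k\<close>, hence is divisible by \<open>p ^ k\<close>, and its quotient
  approximates that of \<open>x\<close>.\<close>

lemma Zp_divide_prime_power:
  assumes "x \<in> Zp" "absval x \<le> \<rho> ^ k"
  shows "x / of_nat (p ^ k) \<in> Zp"
proof (rule ZpI)
  fix e :: real assume e: "0 < e"
  then have "0 < min (e * \<rho> ^ k) (\<rho> ^ k)" by simp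
  then obtain n where n: "absval (x - of_nat n) < min (e * \<rho> ^ k) (\<rho> ^ k)"
    using Zp_approx[OF assms(1)] by metis
  have "absval (of_nat n :: 'a) \<le> \<rho> ^ k"
    using absval_diff_le[of x "\<rho> ^ k" "x - of_nat n"] assms(2) n by simp
  then have "int p ^ k dvd int n" using dvd_if_absval_of_int_le[of "int n" k] by simp
  then obtain t where t: "int n = int p ^ k * t" by blast
  have pk: "absval (of_nat p ^ k :: 'a) = \<rho> ^ k" by (simp add: absval_power absval_p)
  have pnz: "(of_nat p :: 'a) \<noteq> 0" using prime_gt_0_nat[OF prime_p] by simp
  have "(of_nat n :: 'a) = of_nat p ^ k * of_int t"
    using arg_cong[OF t, of "of_int :: int \<Rightarrow> 'a"] by simp
  then have "x / of_nat (p ^ k) - of_int t = (x - of_nat n) / of_nat p ^ k"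
    using pnz by (simp add: field_simps)
  then have "absval (x / of_nat (p ^ k) - of_int t) = absval (x - of_nat n) / \<rho> ^ k"
    by (simp add: absval_divide pk)
  also have "\<dots> < e" using n by (simp add: divide_less_eq)
  finally show "\<exists>n :: int. absval (x / of_nat (p ^ k) - of_int n) < e" by blast
qed

section \<open>Limits and Lipschitz extension\<close>

text \<open>In an ultrametric the bound for one step bounds the whole tail, so the limit is
  approached at the rate of the steps. Completeness of the field enters here.\<close>

lemma geometric_limit:
  fixes X :: "nat \<Rightarrow> 'a"
  assumes "\<And>n. absval (X (Suc n) - X n) \<le> C * \<rho> ^ n"
  obtains l where "\<And>n. absval (X n - l) \<le> C * \<rho> ^ n"
proof -
  have C: "0 \<le> C" using order_trans[OF absval_nonneg assms[of 0]] by simp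
  have tail: "absval (X m - X n) \<le> C * \<rho> ^ n" if "n \<le> m" for m n
    using that
  proof (induction rule: dec_induct)
    case (step m)
    have "absval (X (Suc m) - X m) \<le> C * \<rho> ^ n"
      using assms[of m] \<rho>_power_mono[OF step(1)] C by (meson mult_left_mono order_trans)
    then show ?case using step(3) absval_triangle_le by blast
  qed (use C \<rho>_power_pos[of n] in \<open>simp add: less_imp_le\<close>)
  have "Cauchy X"
  proof (rule metric_CauchyI)
    fix e :: real assume e: "0 < e"
    then obtain k where k: "\<rho> ^ k < e / (C + 1)" using \<rho>_power_less[of "e / (C + 1)"] C by auto
    have "C * \<rho> ^ k \<le> (C + 1) * \<rho> ^ k" by (intro mult_right_mono) (auto simp: less_imp_le)
    also have "\<dots> < e" using k C by (simp add: field_simps)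
    finally have Ck: "C * \<rho> ^ k < e" .
    show "\<exists>M. \<forall>m\<ge>M. \<forall>n\<ge>M. dist (X m) (X n) < e"
    proof (intro exI allI impI)
      fix m n assume "k \<le> m" "k \<le> n"
      then have "absval (X m - X n) \<le> C * \<rho> ^ k"
        using tail absval_triangle_le[of "X m" "X k" _ "X n"] absval_minus_commute by metis
      then show "dist (X m) (X n) < e" using Ck by (simp add: dist_absval)
    qed
  qed
  then obtain l where l: "X \<longlonglongrightarrow> l" using complete_UNIV unfolding complete_def by blast
  have "absval (X n - l) \<le> C * \<rho> ^ n" for n
  proof (rule le_if_le_\<rho>_power[where c = 1])
    fix k
    obtain M where "\<And>m. m \<ge> M \<Longrightarrow> dist (X m) l < \<rho> ^ k"
      using metric_LIMSEQ_D[OF l, of "\<rho> ^ k"] by auto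
    then have "absval (X (max M n) - l) < \<rho> ^ k" by (simp add: dist_absval)
    moreover have "absval (X n - X (max M n)) \<le> C * \<rho> ^ n"
      using tail[of n "max M n"] by (simp add: absval_minus_commute[of "X n"])
    ultimately show "absval (X n - l) \<le> max (C * \<rho> ^ n) (1 * \<rho> ^ k)"
      using absval_triangle_le[of "X n" "X (max M n)" "max (C * \<rho> ^ n) (1 * \<rho> ^ k)" l] by simp
  qed (use C in \<open>simp add: less_imp_le\<close>)
  then show thesis using that by blast
qed

text \<open>The naturals are dense in \<open>Zp\<close>. This identity principle carries equations
  from the naturals to all of \<open>Zp\<close>.\<close>

lemma lipschitz_zero:
  assumes lip: "\<And>x y. x \<in> Zp \<Longrightarrow> y \<in> Zp \<Longrightarrow> absval (\<phi> x - \<phi> y :: 'a) \<le> L * absval (x - y)"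
    and zero: "\<And>n. \<phi> (of_nat n) = 0" and x: "x \<in> Zp"
  shows "\<phi> x = 0"
proof -
  have "absval (\<phi> x) \<le> 0"
  proof (rule le_if_le_\<rho>_power)
    fix k
    obtain n where n: "absval (x - of_nat n) < \<rho> ^ k" using Zp_approx[OF x] by (metis \<rho>_power_pos)
    have "absval (\<phi> x) \<le> L * absval (x - of_nat n)" using lip[OF x, of "of_nat n"] zero by simp
    also have "\<dots> \<le> \<bar>L\<bar> * absval (x - of_nat n)" by (intro mult_right_mono) auto
    also have "\<dots> \<le> \<bar>L\<bar> * \<rho> ^ k" using n by (intro mult_left_mono) auto
    finally show "absval (\<phi> x) \<le> max 0 (\<bar>L\<bar> * \<rho> ^ k)" by simp
  qed simp
  then show ?thesis using absval_nonneg[of "\<phi> x"] absval_eq_0_iff[of "\<phi> x"] by linarith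
qed

text \<open>\<open>G x\<close> is the limit of \<open>g\<close> along natural approximants
  \<open>\<nu> x k\<close>. For distinct \<open>x\<close> and \<open>y\<close>, approximants with
  error below \<open>absval (x - y)\<close> are at most that far apart, which preserves the constant
  \<open>L\<close>.\<close>

lemma lipschitz_extension:
  fixes g :: "nat \<Rightarrow> 'a"
  assumes lip: "\<And>m n. absval (g m - g n) \<le> L * absval (of_nat m - of_nat n :: 'a)" and L: "0 \<le> L"
  obtains G where "\<And>n. G (of_nat n) = g n"
    "\<And>x y. x \<in> Zp \<Longrightarrow> y \<in> Zp \<Longrightarrow> absval (G x - G y) \<le> L * absval (x - y)"
proof -
  have "\<forall>x k. \<exists>n. x \<in> Zp \<longrightarrow> absval (x - of_nat n) < \<rho> ^ k"
    using Zp_approx \<rho>_power_pos by metis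
  then obtain \<nu> where \<nu>: "\<And>x k. x \<in> Zp \<Longrightarrow> absval (x - of_nat (\<nu> x k)) < \<rho> ^ k" by metis
  have "\<exists>l. \<forall>k. absval (g (\<nu> x k) - l) \<le> L * \<rho> ^ k" if x: "x \<in> Zp" for x
  proof -
    have "absval (g (\<nu> x (Suc k)) - g (\<nu> x k)) \<le> L * \<rho> ^ k" for k
    proof -
      have "absval (of_nat (\<nu> x (Suc k)) - x) \<le> \<rho> ^ k"
        using \<nu>[OF x, of "Suc k"] \<rho>_power_mono[of k "Suc k"]
        by (simp add: absval_minus_commute[of _ x] del: power_Suc)
      then have "absval (of_nat (\<nu> x (Suc k)) - of_nat (\<nu> x k) :: 'a) \<le> \<rho> ^ k"
        using absval_triangle_le[OF _ less_imp_le[OF \<nu>[OF x]]] by simp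
      then show ?thesis using lip[of "\<nu> x (Suc k)" "\<nu> x k"] L by (meson mult_left_mono order_trans)
    qed
    then show ?thesis by (rule geometric_limit) blast
  qed
  then obtain G where G: "\<And>x k. x \<in> Zp \<Longrightarrow> absval (g (\<nu> x k) - G x) \<le> L * \<rho> ^ k" by metis
  have G_nat: "G (of_nat n) = g n" for n
  proof -
    have "absval (G (of_nat n) - g n) \<le> 0"
    proof (rule le_if_le_\<rho>_power)
      fix k
      let ?m = "\<nu> (of_nat n) k"
      have "absval (of_nat ?m - of_nat n :: 'a) \<le> \<rho> ^ k"
        using \<nu>[of "of_nat n" k] by (simp add: absval_minus_commute)
      then have "absval (g ?m - g n) \<le> L * \<rho> ^ k"
        using lip[of ?m n] L by (meson mult_left_mono order_trans)
      moreover have "absval (G (of_nat n) - g ?m) \<le> L * \<rho> ^ k"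
        using G[of "of_nat n" k] by (simp add: absval_minus_commute)
      ultimately have "absval (G (of_nat n) - g n) \<le> L * \<rho> ^ k"
        by (rule absval_triangle_le[rotated])
      then show "absval (G (of_nat n) - g n) \<le> max 0 (L * \<rho> ^ k)" by simp
    qed simp
    then show ?thesis
      using absval_nonneg[of "G (of_nat n) - g n"] absval_eq_0_iff[of "G (of_nat n) - g n"] by simp
  qed
  have "absval (G x - G y) \<le> L * absval (x - y)" if x: "x \<in> Zp" and y: "y \<in> Zp" for x y
  proof (cases "x = y")
    case False
    then obtain k where k: "\<rho> ^ k < absval (x - y)" using \<rho>_power_less[of "absval (x - y)"] by auto
    have le: "L * \<rho> ^ k \<le> L * absval (x - y)" using k L by (intro mult_left_mono) auto
    have "absval (of_nat (\<nu> x k) - x) \<le> absval (x - y)"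
      using \<nu>[OF x, of k] k by (simp add: absval_minus_commute[of "of_nat (\<nu> x k)"])
    moreover have "absval (y - of_nat (\<nu> y k)) \<le> absval (x - y)" using \<nu>[OF y, of k] k by simp
    ultimately have "absval (of_nat (\<nu> x k) - of_nat (\<nu> y k) :: 'a) \<le> absval (x - y)"
      by (rule absval_triangle_le[OF _ absval_triangle_le[OF order_refl]])
    then have "absval (g (\<nu> x k) - g (\<nu> y k)) \<le> L * absval (x - y)"
      using lip[of "\<nu> x k" "\<nu> y k"] L by (meson mult_left_mono order_trans)
    moreover have "absval (g (\<nu> y k) - G y) \<le> L * absval (x - y)"
      using G[OF y, of k] le by simp
    ultimately have "absval (g (\<nu> x k) - G y) \<le> L * absval (x - y)" by (rule absval_triangle_le)
    moreover have "absval (G x - g (\<nu> x k)) \<le> L * absval (x - y)"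
      using G[OF x, of k] le by (simp add: absval_minus_commute[of "G x" "g (\<nu> x k)"])
    ultimately show ?thesis by (rule absval_triangle_le[rotated])
  qed simp
  with G_nat show thesis using that by blast
qed

section \<open>Existence and uniqueness of the Morita gamma function\<close>

text \<open>For \<open>v \<ge> 3\<close> the congruence modulo \<open>p ^ v\<close> gives the
  constant 1. For smaller \<open>v\<close> the trivial bound 1 is used, and the factor
  \<open>p ^ 3\<close> pays for it.\<close>

lemma int_gamma_lipschitz:
  "absval (of_int (int_gamma p m) - of_int (int_gamma p n) :: 'a) \<le>
     real p ^ 3 * absval (of_nat m - of_nat n :: 'a)"
proof (cases "m = n")
  case False
  then have "int m - int n \<noteq> 0" by simp
  then obtain v u where v: "int m - int n = int p ^ v * u"
    "absval (of_int (int m - int n) :: 'a) = \<rho> ^ v" using absval_of_int_eq by metis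
  have p\<rho>: "real p ^ 3 * \<rho> ^ 3 = 1" using p_gt_1 by (simp add: \<rho>_def power_one_over)
  show ?thesis
  proof (cases "v \<ge> 3")
    case True
    have "[int m = int n] (mod int (p ^ v))" using v(1) by (simp add: cong_iff_dvd_diff)
    then have "[m = n] (mod p ^ v)" by (simp only: cong_int_iff)
    then have "int p ^ v dvd int_gamma p m - int_gamma p n"
      using int_gamma_cong[OF prime_p True] by (simp add: cong_iff_dvd_diff)
    then have "absval (of_int (int_gamma p m - int_gamma p n) :: 'a) \<le> 1 * \<rho> ^ v"
      using absval_of_int_dvd[of v "int_gamma p m - int_gamma p n"] by (simp only: mult_1)
    also have "1 * \<rho> ^ v \<le> real p ^ 3 * \<rho> ^ v"
      using p_gt_1 by (intro mult_right_mono) (auto simp: less_imp_le)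
    finally show ?thesis using v(2) by simp
  next
    case False
    then have "\<rho> ^ 3 \<le> \<rho> ^ v" by (intro \<rho>_power_mono) simp
    then have "1 \<le> real p ^ 3 * \<rho> ^ v" using p\<rho> p_gt_1
      by (metis less_imp_le mult_left_mono of_nat_0_le_iff zero_le_power)
    moreover have "absval (of_int (int_gamma p m - int_gamma p n) :: 'a) \<le> 1"
      by (rule absval_of_int_le_1)
    ultimately show ?thesis using v(2) by simp
  qed
qed simp

lemma gamma_values:
  "(-1) ^ n * (\<Prod>j | 1 \<le> j \<and> j < n \<and> \<not> p dvd j. of_nat j) = (of_int (int_gamma p n) :: 'a)"
proof -
  have "{j. 1 \<le> j \<and> j < n \<and> \<not> p dvd j} = unit_indices p n"
    by (auto simp: unit_indices_def intro!: Suc_leI Nat.gr0I)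
  then show ?thesis by (simp add: int_gamma_def)
qed

text \<open>The definite description is resolved: the Lipschitz extension, restricted to
  \<open>Zp\<close>, satisfies it, and a continuous function on \<open>Zp\<close> is determined by
  its values at the naturals from 2 on, which are dense.\<close>

lemma morita_gamma_properties:
  shows morita_gamma_of_nat: "morita_gamma p (of_nat n) = (of_int (int_gamma p n) :: 'a)"
    and morita_gamma_lipschitz: "x \<in> Zp \<Longrightarrow> y \<in> Zp \<Longrightarrow>
      absval (morita_gamma p x - morita_gamma p y) \<le> real p ^ 3 * absval (x - y)"
proof -
  obtain G where G_nat: "\<And>n. G (of_nat n) = (of_int (int_gamma p n) :: 'a)"
    and G_lip: "\<And>x y. x \<in> Zp \<Longrightarrow> y \<in> Zp \<Longrightarrow> absval (G x - G y) \<le> real p ^ 3 * absval (x - y)"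
    using lipschitz_extension[OF int_gamma_lipschitz] by auto
  let ?P = "\<lambda>g. g \<in> Zp \<rightarrow>\<^sub>E Zp \<and> continuous_on Zp g \<and> (\<forall>n\<ge>2. g (of_nat n) =
      (-1) ^ n * (\<Prod>j | 1 \<le> j \<and> j < n \<and> \<not> p dvd j. of_nat j))"
  define g where "g = restrict G Zp"
  have cont: "continuous_on Zp g"
    unfolding continuous_on_iff
  proof (intro ballI allI impI)
    fix y :: 'a and e :: real assume "y \<in> Zp" "0 < e"
    show "\<exists>d>0. \<forall>x'\<in>Zp. dist x' y < d \<longrightarrow> dist (g x') (g y) < e"
    proof (intro exI conjI ballI impI)
      show "e / real p ^ 3 > 0" using \<open>0 < e\<close> p_gt_1 by simp
      fix x' assume x': "x' \<in> Zp" "dist x' y < e / real p ^ 3"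
      have "dist (g x') (g y) \<le> real p ^ 3 * absval (x' - y)"
        using G_lip[OF x'(1) \<open>y \<in> Zp\<close>] x'(1) \<open>y \<in> Zp\<close> by (simp add: g_def dist_absval)
      also have "\<dots> < e" using x'(2) p_gt_1 by (simp add: dist_absval field_simps)
      finally show "dist (g x') (g y) < e" .
    qed
  qed
  have range: "G x \<in> Zp" if x: "x \<in> Zp" for x
  proof (rule ZpI)
    fix e :: real assume "0 < e"
    then have "0 < e / real p ^ 3" using p_gt_1 by simp
    then obtain n where "absval (x - of_nat n) < e / real p ^ 3" using Zp_approx[OF x] by metis
    then have "real p ^ 3 * absval (x - of_nat n) < e" using p_gt_1 by (simp add: field_simps)
    then have "absval (G x - G (of_nat n)) < e" using G_lip[OF x, of "of_nat n"] by simp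
    then show "\<exists>n :: int. absval (G x - of_int n) < e" unfolding G_nat by blast
  qed
  have "?P g"
    using range cont unfolding gamma_values by (auto simp: g_def G_nat)
  moreover have "g' = g" if g': "?P g'" for g'
  proof (rule extensionalityI[of _ Zp])
    fix x :: 'a assume x: "x \<in> Zp"
    have "\<forall>k. \<exists>n. n \<ge> 2 \<and> absval (x - of_nat n) < \<rho> ^ k" using Zp_approx[OF x] \<rho>_power_pos by metis
    then obtain \<nu> where \<nu>: "\<And>k. \<nu> k \<ge> 2" "\<And>k. absval (x - of_nat (\<nu> k)) < \<rho> ^ k" by metis
    have lim: "(\<lambda>k. of_nat (\<nu> k)) \<longlonglongrightarrow> x"
    proof (rule metric_LIMSEQ_I)
      fix e :: real assume "0 < e"
      then obtain k where k: "\<rho> ^ k < e" using \<rho>_power_less by blast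
      show "\<exists>N. \<forall>n\<ge>N. dist (of_nat (\<nu> n)) x < e"
      proof (intro exI allI impI)
        fix n assume "k \<le> n"
        then show "dist (of_nat (\<nu> n)) x < e"
          using \<nu>(2)[of n] \<rho>_power_mono[of k n] k by (simp add: dist_absval absval_minus_commute)
      qed
    qed
    have "(\<lambda>k. f (of_nat (\<nu> k))) \<longlonglongrightarrow> f x" if "continuous_on Zp f" for f :: "'a \<Rightarrow> 'a"
      using that lim x unfolding continuous_on_sequentially comp_def by (elim ballE allE impE) auto
    then have "(\<lambda>k. g' (of_nat (\<nu> k))) \<longlonglongrightarrow> g' x" "(\<lambda>k. g (of_nat (\<nu> k))) \<longlonglongrightarrow> g x"
      using g' cont by blast+
    moreover have "g' (of_nat (\<nu> k)) = g (of_nat (\<nu> k))" for k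
      using g' \<nu>(1)[of k] unfolding gamma_values by (simp add: g_def G_nat)
    ultimately show "g' x = g x" using LIMSEQ_unique by simp
  qed (use that in \<open>auto simp: g_def PiE_iff\<close>)
  ultimately have "morita_gamma p = g"
    unfolding morita_gamma_def by (rule the_equality)
  then show "morita_gamma p (of_nat n) = (of_int (int_gamma p n) :: 'a)"
    "x \<in> Zp \<Longrightarrow> y \<in> Zp \<Longrightarrow>
      absval (morita_gamma p x - morita_gamma p y) \<le> real p ^ 3 * absval (x - y)"
    using G_nat G_lip by (auto simp: g_def)
qed

end

section \<open>Newton series and derivatives\<close>

definition fdiff :: "(nat \<Rightarrow> int) \<Rightarrow> nat \<Rightarrow> int" where
  "fdiff h m = h (Suc m) - h m"

text \<open>The hypothesis is applied to both \<open>h\<close> and \<open>fdiff h\<close>, and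
  Pascal's rule adds the results.\<close>

lemma newton_forward: "h m = (\<Sum>k\<le>m. int (m choose k) * (fdiff ^^ k) h 0)"
proof (induction m arbitrary: h)
  case (Suc m)
  have "h (Suc m) = fdiff h m + h m" by (simp add: fdiff_def)
  also have "fdiff h m = (\<Sum>k\<le>m. int (m choose k) * (fdiff ^^ Suc k) h 0)"
    by (subst Suc[of "fdiff h"]) (simp add: funpow_swap1)
  also have "h m = (\<Sum>k\<le>Suc m. int (m choose k) * (fdiff ^^ k) h 0)"
    by (subst Suc[of h]) simp
  also have "\<dots> = h 0 + (\<Sum>k\<le>m. int (m choose Suc k) * (fdiff ^^ Suc k) h 0)"
    by (subst sum.atMost_Suc_shift) simp
  finally have "h (Suc m) = h 0 + (\<Sum>k\<le>m. int (Suc m choose Suc k) * (fdiff ^^ Suc k) h 0)"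
    by (simp add: sum.distrib algebra_simps del: funpow.simps)
  then show ?case by (subst sum.atMost_Suc_shift) simp
qed simp

lemma poly_difference_quotient:
  fixes E :: "'a::comm_ring_1 poly"
  obtains R where "\<And>y. poly E (y + d) - poly E y = d * poly R y"
proof -
  have "\<exists>R. \<forall>y. poly E (y + d) - poly E y = d * poly R y"
  proof (induction E)
    case (pCons a E)
    then obtain R where R: "\<And>y. poly E (y + d) - poly E y = d * poly R y" by blast
    show ?case
    proof (intro exI[of _ "pCons 0 R + pcompose E [:d, 1:]"] allI)
      fix y
      have "poly (pCons a E) (y + d) - poly (pCons a E) y =
          y * (poly E (y + d) - poly E y) + d * poly E (y + d)"
        by (simp add: algebra_simps)
      then show "poly (pCons a E) (y + d) - poly (pCons a E) y =
          d * poly (pCons 0 R + pcompose E [:d, 1:]) y"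
        unfolding R by (simp add: poly_pcompose algebra_simps)
    qed
  qed (intro exI[of _ 0], simp)
  then show thesis using that by blast
qed

lemma coeff_linear_mult:
  "poly.coeff ([:a, 1:] * q :: 'a::comm_ring_1 poly) i = a * poly.coeff q i + (case i of 0 \<Rightarrow> 0 | Suc j \<Rightarrow> poly.coeff q j)"
  by (cases i) simp_all

text \<open>A bound for the Gauss norm. It bounds values on the unit ball and survives formal
  differentiation, since integers have absolute value at most 1.\<close>

definition coeffs_le :: "real \<Rightarrow> 'a::nonarch_field poly \<Rightarrow> bool" where
  "coeffs_le C q \<longleftrightarrow> (\<forall>i. absval (poly.coeff q i) \<le> C)"

lemma coeffs_le_nonneg: "coeffs_le C q \<Longrightarrow> 0 \<le> C"
  unfolding coeffs_le_def using absval_nonneg order_trans by blast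

lemma coeffs_le_pCons: "coeffs_le C (pCons a q) \<longleftrightarrow> absval a \<le> C \<and> coeffs_le C q"
  unfolding coeffs_le_def by (auto simp: coeff_pCons split: nat.splits)

lemma coeffs_le_pderiv: "coeffs_le C q \<Longrightarrow> coeffs_le C (pderiv q)"
  unfolding coeffs_le_def coeff_pderiv absval_mult
  by (metis absval_nonneg absval_of_nat_le_1 mult_left_le_one_le order_trans)

lemma coeffs_le_pderiv_funpow: "coeffs_le C q \<Longrightarrow> coeffs_le C ((pderiv ^^ j) q)"
  by (induction j) (auto intro: coeffs_le_pderiv)

lemma absval_mult_le_left:
  "absval (x :: 'a::nonarch_field) \<le> 1 \<Longrightarrow> absval y \<le> C \<Longrightarrow> absval (x * y) \<le> C"
  unfolding absval_mult by (meson absval_nonneg mult_left_le_one_le order_trans)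

lemma absval_poly_le:
  assumes "coeffs_le C q" "absval x \<le> 1"
  shows "absval (poly q x) \<le> C"
  using assms(1)
proof (induction q)
  case 0
  then show ?case using coeffs_le_nonneg by simp
next
  case (pCons a q)
  then show ?case using assms(2)
    by (auto simp: coeffs_le_pCons intro!: absval_add_le absval_mult_le_left)
qed

lemma absval_poly_diff_le:
  assumes "coeffs_le C q" "absval x \<le> 1" "absval y \<le> 1"
  shows "absval (poly q y - poly q x) \<le> C * absval (y - x)"
  using assms(1)
proof (induction q)
  case (pCons a q)
  then have q: "coeffs_le C q" by (simp add: coeffs_le_pCons)
  have "poly (pCons a q) y - poly (pCons a q) x = y * (poly q y - poly q x) + poly q x * (y - x)"
    by (simp add: algebra_simps)
  moreover have "absval (y * (poly q y - poly q x)) \<le> C * absval (y - x)"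
    using pCons.IH[OF q] assms(3) by (rule absval_mult_le_left[rotated])
  moreover have "absval (poly q x * (y - x)) \<le> C * absval (y - x)"
    unfolding absval_mult using absval_poly_le[OF q assms(2)] by (intro mult_right_mono) auto
  ultimately show ?case using absval_add_le by metis
qed (use coeffs_le_nonneg[of C] in \<open>auto intro!: mult_nonneg_nonneg\<close>)

text \<open>For \<open>a + X q\<close> the remainder is \<open>x\<close> times that of
  \<open>q\<close> plus \<open>(q y - q x) * (y - x)\<close>, so the induction closes with the same
  constant.\<close>

lemma absval_poly_taylor_le:
  assumes "coeffs_le C q" "absval x \<le> 1" "absval y \<le> 1"
  shows "absval (poly q y - poly q x - poly (pderiv q) x * (y - x)) \<le> C * (absval (y - x))\<^sup>2"
  using assms(1)
proof (induction q)
  case (pCons a q)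
  then have q: "coeffs_le C q" by (simp add: coeffs_le_pCons)
  have "poly (pCons a q) y - poly (pCons a q) x - poly (pderiv (pCons a q)) x * (y - x) =
      x * (poly q y - poly q x - poly (pderiv q) x * (y - x)) + (poly q y - poly q x) * (y - x)"
    by (simp add: pderiv_pCons algebra_simps)
  moreover have "absval (x * (poly q y - poly q x - poly (pderiv q) x * (y - x))) \<le>
      C * (absval (y - x))\<^sup>2"
    using pCons.IH[OF q] assms(2) by (rule absval_mult_le_left[rotated])
  moreover have "absval ((poly q y - poly q x) * (y - x)) \<le> C * (absval (y - x))\<^sup>2"
    using mult_right_mono[OF absval_poly_diff_le[OF q assms(2,3)], of "absval (y - x)"]
    by (simp add: absval_mult power2_eq_square mult.assoc)
  ultimately show ?case using absval_add_le by metis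
qed (use coeffs_le_nonneg[of C] in \<open>auto intro!: mult_nonneg_nonneg\<close>)

lemma coeffs_le_linear_mult:
  assumes "absval (a :: 'a::nonarch_field) \<le> 1" "coeffs_le 1 q"
  shows "coeffs_le 1 ([:a, 1:] * q)"
  unfolding coeffs_le_def
proof
  fix i
  have "absval (a * poly.coeff q i) \<le> 1"
    using assms by (intro absval_mult_le_left) (auto simp: coeffs_le_def)
  moreover have "absval (case i of 0 \<Rightarrow> 0 | Suc j \<Rightarrow> poly.coeff q j) \<le> 1"
    using assms(2) by (auto simp: coeffs_le_def split: nat.split)
  ultimately show "absval (poly.coeff ([:a, 1:] * q) i) \<le> 1"
    unfolding coeff_linear_mult by (rule absval_add_le)
qed

text \<open>\<open>k!\<close> times the binomial polynomial. Leaving \<open>k!\<close> out keeps the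
  coefficients integral and puts every denominator into \<open>newton_coeff\<close>.\<close>

definition falling_poly :: "nat \<Rightarrow> 'a::comm_ring_1 poly" where
  "falling_poly k = (\<Prod>i<k. [:- of_nat i, 1:])"

lemma poly_falling_poly_of_nat:
  "poly (falling_poly k) (of_nat m) = (fact k * of_nat (m choose k) :: 'a::field_char_0)"
  by (simp add: falling_poly_def poly_prod binomial_gbinomial gbinomial_prod_rev
      atLeast0LessThan)

lemma coeffs_le_falling_poly: "coeffs_le 1 (falling_poly k :: 'a::nonarch_field poly)"
proof (induction k)
  case 0
  then show ?case by (auto simp: falling_poly_def coeffs_le_def coeff_pCons split: nat.splits)
next
  case (Suc k)
  have eq: "falling_poly (Suc k) = ([:- of_nat k, 1:] * falling_poly k :: 'a poly)"
    by (simp add: falling_poly_def mult.commute del: mult_pCons_left mult_pCons_right)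
  show ?case unfolding eq using Suc by (intro coeffs_le_linear_mult) auto
qed

lemma pderiv_funpow_add: "(pderiv ^^ j) (f + g) = (pderiv ^^ j) f + (pderiv ^^ j) g"
  by (induction j) (auto simp: pderiv_add)

section \<open>Newton series along the multiples of s\<close>

context padic_complex_field
begin

definition s :: nat where "s = p ^ 4"

lemma s_pos: "s > 0" and s_dvd: "p dvd s"
  using prime_gt_0_nat[OF prime_p] by (auto simp: s_def)

lemma s_nonzero: "(of_nat s :: 'a) \<noteq> 0"
  using s_pos by simp

lemma int_gamma_s: "[int_gamma p s = 1] (mod int p ^ 2)"
proof -
  have "[int_gamma p s = 1] (mod int (p ^ 4))"
    unfolding s_def by (rule int_gamma_prime_power[OF prime_p]) simp
  then show ?thesis by (rule cong_dvd_modulus) (simp add: le_imp_power_dvd)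
qed

text \<open>On multiples of \<open>s = q\<^sup>2\<close> the multiplier of the functional equation, as a polynomial in
  \<open>q m\<close>, is \<open>1\<close> modulo \<open>q = p\<^sup>2\<close>; this makes the Newton coefficients decay.\<close>

lemma shift_poly_expand:
  obtains C where "\<And>y. poly (shift_poly p s) (int p ^ 2 * y) = 1 + int p ^ 2 * poly C y"
proof -
  obtain b0 b1 where b: "shift_poly p s = pCons b0 b1" by (rule pCons_cases)
  have "b0 = int_gamma p s" using poly_shift_poly_0[of p s] by (simp add: b)
  then have "int p ^ 2 dvd b0 - 1" using int_gamma_s by (simp add: cong_iff_dvd_diff)
  then obtain e where "b0 - 1 = int p ^ 2 * e" by blast
  then have e: "b0 = 1 + int p ^ 2 * e" by simp
  show thesis
    by (rule that[of "pCons e (pcompose b1 [:0, int p ^ 2:])"])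
      (simp add: b e poly_pcompose algebra_simps)
qed

definition h :: "nat \<Rightarrow> int" where "h m = int_gamma p (s * m)"

lemma h_Suc: "h (Suc m) = poly (shift_poly p s) (int s * int m) * h m"
  using int_gamma_add[of p "s * m" s] s_dvd by (simp add: h_def algebra_simps)

text \<open>Each difference gains a factor \<open>q = p\<^sup>2\<close> for two reasons: the
  multiplier is \<open>1 + q C\<close>, and \<open>E\<close> is evaluated at \<open>q m\<close>, so
  its own increment is a multiple of \<open>q\<close>.\<close>

lemma fdiff_h: "\<exists>E. \<forall>m. (fdiff ^^ k) h m = (int p ^ 2) ^ k * poly E (int p ^ 2 * int m) * h m"
proof (induction k)
  case 0
  show ?case by (rule exI[of _ 1]) simp
next
  case (Suc k)
  define q where "q = int p ^ 2"
  obtain E where E: "\<And>m. (fdiff ^^ k) h m = q ^ k * poly E (q * int m) * h m"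
    using Suc by (auto simp: q_def)
  obtain C where C: "\<And>y. poly (shift_poly p s) (q * y) = 1 + q * poly C y"
    using shift_poly_expand unfolding q_def by blast
  obtain R where R: "\<And>y. poly E (y + q) - poly E y = q * poly R y"
    using poly_difference_quotient[of E q] by blast
  have sq: "int s = q * q" by (simp add: s_def q_def flip: power_add)
  have "(fdiff ^^ Suc k) h m = q ^ Suc k * poly (R + pcompose E [:q, 1:] * C) (q * int m) * h m" for m
  proof -
    define y where "y = q * int m"
    have "h (Suc m) = (1 + q * poly C y) * h m"
      using C[of y] by (simp add: h_Suc sq y_def mult.assoc)
    moreover have "poly E (q * int (Suc m)) = poly E y + q * poly R y"
      using R[of y] by (simp add: y_def algebra_simps)
    moreover have "poly (pcompose E [:q, 1:]) y = poly E y + q * poly R y"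
      using R[of y] by (simp add: poly_pcompose algebra_simps)
    ultimately show ?thesis unfolding y_def[symmetric]
      by (simp add: fdiff_def E y_def[symmetric] algebra_simps)
  qed
  then show ?case unfolding q_def by blast
qed

definition newton_coeff :: "nat \<Rightarrow> 'a" where
  "newton_coeff k = of_int ((fdiff ^^ k) h 0) / fact k"

lemma absval_newton_coeff: "absval (newton_coeff k) \<le> \<rho> ^ k"
proof -
  obtain E where "(fdiff ^^ k) h 0 = (int p ^ 2) ^ k * poly E 0 * h 0"
    using fdiff_h[of k] by fastforce
  then have "int p ^ (2 * k) dvd (fdiff ^^ k) h 0" by (simp add: power_mult)
  then have "absval (of_int ((fdiff ^^ k) h 0) :: 'a) \<le> \<rho> ^ (2 * k)" by (rule absval_of_int_dvd)
  also have "\<rho> ^ (2 * k) = \<rho> ^ k * \<rho> ^ k" by (simp add: mult_2 power_add)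
  also have "\<dots> \<le> \<rho> ^ k * absval (fact k :: 'a)"
    using absval_fact_ge by (intro mult_left_mono) (auto simp: less_imp_le)
  finally show ?thesis
    by (simp add: newton_coeff_def absval_divide divide_le_eq)
qed

text \<open>A partial sum of the Newton series in the rescaled variable \<open>z = x / s\<close>; it
  interpolates \<open>h\<close> at the naturals below \<open>n\<close>.\<close>

definition newton_poly :: "nat \<Rightarrow> 'a poly" where
  "newton_poly n = (\<Sum>k<n. [:newton_coeff k:] * falling_poly k)"

lemma newton_poly_Suc: "newton_poly (Suc n) = newton_poly n + [:newton_coeff n:] * falling_poly n"
  by (simp add: newton_poly_def)

lemma coeffs_le_newton_step: "coeffs_le (\<rho> ^ n) ([:newton_coeff n:] * falling_poly n)"
  unfolding coeffs_le_def
proof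
  fix i
  have "absval (newton_coeff n * poly.coeff (falling_poly n) i) \<le> \<rho> ^ n * 1"
    unfolding absval_mult using absval_newton_coeff coeffs_le_falling_poly
    by (intro mult_mono) (auto simp: coeffs_le_def less_imp_le)
  then show "absval (poly.coeff ([:newton_coeff n:] * falling_poly n) i) \<le> \<rho> ^ n" by simp
qed

lemma coeffs_le_newton_poly: "coeffs_le 1 (newton_poly n)"
proof (induction n)
  case 0
  then show ?case by (simp add: newton_poly_def coeffs_le_def)
next
  case (Suc n)
  have "absval (poly.coeff ([:newton_coeff n:] * falling_poly n) i) \<le> 1" for i
    using coeffs_le_newton_step[of n] \<rho>_power_le_1[of n] unfolding coeffs_le_def by (meson order_trans)
  then show ?case using Suc unfolding coeffs_le_def newton_poly_Suc coeff_add
    by (intro allI absval_add_le) auto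
qed

lemma poly_newton_poly_of_nat:
  assumes "m < n"
  shows "poly (newton_poly n) (of_nat m) = of_int (h m)"
proof -
  have "poly (newton_poly n) (of_nat m) = (\<Sum>k<n. of_int ((fdiff ^^ k) h 0) * of_nat (m choose k))"
    by (simp add: newton_poly_def poly_sum poly_falling_poly_of_nat newton_coeff_def)
  also have "\<dots> = (\<Sum>k\<le>m. of_int ((fdiff ^^ k) h 0) * of_nat (m choose k))"
    using assms by (intro sum.mono_neutral_right) auto
  also have "\<dots> = of_int (\<Sum>k\<le>m. int (m choose k) * (fdiff ^^ k) h 0)"
    by (simp add: mult.commute)
  finally show ?thesis by (simp only: newton_forward[symmetric])
qed

text \<open>The increments have coefficients bounded by \<open>\<rho> ^ n\<close>, and formal
  differentiation keeps this bound; so every derivative converges at the same rate on the unit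
  ball.\<close>

lemma newton_limit:
  obtains H where "\<And>j z n. absval z \<le> 1 \<Longrightarrow>
    absval (poly ((pderiv ^^ j) (newton_poly n)) z - H j z) \<le> \<rho> ^ n"
proof -
  have "\<exists>l. \<forall>n. absval (poly ((pderiv ^^ j) (newton_poly n)) z - l) \<le> \<rho> ^ n"
    if z: "absval z \<le> 1" for j z
  proof -
    have "absval (poly ((pderiv ^^ j) (newton_poly (Suc n))) z -
        poly ((pderiv ^^ j) (newton_poly n)) z) \<le> 1 * \<rho> ^ n" for n
      unfolding newton_poly_Suc pderiv_funpow_add
      using absval_poly_le[OF coeffs_le_pderiv_funpow[OF coeffs_le_newton_step] z] by simp
    then show ?thesis by (rule geometric_limit) auto
  qed
  then have "\<forall>j z. \<exists>l. absval z \<le> 1 \<longrightarrow>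
      (\<forall>n. absval (poly ((pderiv ^^ j) (newton_poly n)) z - l) \<le> \<rho> ^ n)" by blast
  then obtain H where "\<forall>j z. absval z \<le> 1 \<longrightarrow>
      (\<forall>n. absval (poly ((pderiv ^^ j) (newton_poly n)) z - H j z) \<le> \<rho> ^ n)" by metis
  then show thesis using that by blast
qed

section \<open>Differentiation on a disc\<close>

definition S :: "'a set" where "S = (\<lambda>z. of_nat s * z) ` Zp"

lemma S_subset: "S \<subseteq> Zp"
  using Zp_mult_of_nat by (auto simp: S_def)

lemma S_of_nat: "of_nat (s * m) \<in> S"
  unfolding S_def by (rule image_eqI[of _ _ "of_nat m"]) auto

lemma S_add_s: "x \<in> S \<Longrightarrow> x + of_nat s \<in> S"
  unfolding S_def
  by (auto intro!: image_eqI[of _ _ "_ + 1"] Zp_add Zp_of_nat[of 1, simplified] simp: algebra_simps)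

lemma absval_s: "absval (of_nat s :: 'a) = \<rho> ^ 4"
  by (simp add: s_def absval_power absval_p)

lemma S_divide: "x \<in> S \<Longrightarrow> x / of_nat s \<in> Zp"
  using s_nonzero by (auto simp: S_def)

text \<open>The disc \<open>S\<close> is open in \<open>Zp\<close>, so derivatives within
  \<open>Zp\<close> at points of \<open>S\<close> can be computed inside \<open>S\<close>.\<close>

lemma S_if_close:
  assumes "x \<in> S" "y \<in> Zp" "absval (y - x) \<le> \<rho> ^ 4"
  shows "y \<in> S"
proof -
  obtain z where z: "x = of_nat s * z" "z \<in> Zp" using assms(1) by (auto simp: S_def)
  have "absval x \<le> \<rho> ^ 4 * 1"
    unfolding z(1) absval_mult absval_s
    using Zp_absval[OF z(2)] by (intro mult_left_mono) (auto simp: less_imp_le)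
  then have "absval y \<le> \<rho> ^ 4" using absval_add_le[of "y - x" "\<rho> ^ 4" x] assms(3) by simp
  then have "y / of_nat s \<in> Zp" unfolding s_def by (rule Zp_divide_prime_power[OF assms(2)])
  then show ?thesis unfolding S_def
    by (rule image_eqI[rotated]) (use s_nonzero in simp)
qed

text \<open>The quadratic remainder bound is stronger than differentiability, but it is preserved by all
  operations needed and avoids a derivative calculus over \<open>'a\<close>.\<close>

definition deriv_tower :: "(nat \<Rightarrow> 'a \<Rightarrow> 'a) \<Rightarrow> bool" where
  "deriv_tower G \<longleftrightarrow> (\<forall>j. (\<exists>C. \<forall>x\<in>S. absval (G j x) \<le> C) \<and>
     (\<exists>C. \<forall>x\<in>S. \<forall>y\<in>S. absval (G j y - G j x - G (Suc j) x * (y - x)) \<le> C * (absval (y - x))\<^sup>2))"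

lemma deriv_towerD:
  assumes "deriv_tower G"
  obtains C where "C \<ge> 0" "\<And>x. x \<in> S \<Longrightarrow> absval (G j x) \<le> C"
    "\<And>x y. x \<in> S \<Longrightarrow> y \<in> S \<Longrightarrow> absval (G j y - G j x - G (Suc j) x * (y - x)) \<le> C * (absval (y - x))\<^sup>2"
proof -
  obtain A B where A: "\<And>x. x \<in> S \<Longrightarrow> absval (G j x) \<le> A"
    and B: "\<And>x y. x \<in> S \<Longrightarrow> y \<in> S \<Longrightarrow> absval (G j y - G j x - G (Suc j) x * (y - x)) \<le> B * (absval (y - x))\<^sup>2"
    using assms unfolding deriv_tower_def by meson
  let ?C = "max 0 (max A B)"
  have "B * (absval (y - x))\<^sup>2 \<le> ?C * (absval (y - x))\<^sup>2" for x y :: 'a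
    by (intro mult_right_mono) auto
  from order_trans[OF B this] A show thesis
    by (intro that[of ?C]) (auto simp: le_max_iff_disj simp del: max.bounded_iff)
qed

lemma deriv_on_eq:
  fixes f :: "'a \<Rightarrow> 'a"
  assumes quad: "\<And>y. y \<in> S \<Longrightarrow> absval (f y - f x - d * (y - x)) \<le> C * (absval (y - x))\<^sup>2"
    and x: "x \<in> S"
  shows "deriv_on Zp f x = d"
proof -
  have C: "C * (absval (y - x))\<^sup>2 \<ge> 0" if "y \<in> S" for y
    using order_trans[OF absval_nonneg quad[OF that]] .
  have x_Zp: "x \<in> Zp" using x S_subset by blast
  have "((\<lambda>y. (f y - f x) / (y - x)) \<longlongrightarrow> d) (at x within Zp)"
  proof (rule tendstoI)
    fix e :: real assume e: "0 < e"
    define \<delta> where "\<delta> = min (\<rho> ^ 4) (e / (\<bar>C\<bar> + 1))"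
    have "\<delta> > 0" using e \<rho>_pos by (simp add: \<delta>_def)
    show "\<forall>\<^sub>F y in at x within Zp. dist ((f y - f x) / (y - x)) d < e"
      unfolding eventually_at
    proof (intro exI[of _ \<delta>] conjI ballI impI)
      fix y assume y: "y \<in> Zp" "y \<noteq> x \<and> dist y x < \<delta>"
      then have close: "absval (y - x) < \<rho> ^ 4" "absval (y - x) < e / (\<bar>C\<bar> + 1)" and ne: "y - x \<noteq> 0"
        by (auto simp: dist_absval \<delta>_def)
      have yS: "y \<in> S" using S_if_close[OF x y(1)] close by simp
      have "(f y - f x) / (y - x) - d = (f y - f x - d * (y - x)) / (y - x)"
        using ne by (simp add: field_simps)
      then have "dist ((f y - f x) / (y - x)) d = absval (f y - f x - d * (y - x)) / absval (y - x)"
        by (simp add: dist_absval absval_divide)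
      also have "\<dots> \<le> C * (absval (y - x))\<^sup>2 / absval (y - x)"
        using quad[OF yS] by (intro divide_right_mono) auto
      also have "\<dots> = C * absval (y - x)" by (simp add: power2_eq_square)
      also have "\<dots> \<le> (\<bar>C\<bar> + 1) * absval (y - x)" by (intro mult_right_mono) auto
      also have "\<dots> < e" using close(2) by (simp add: field_simps)
      finally show "dist ((f y - f x) / (y - x)) d < e" .
    qed (use \<open>\<delta> > 0\<close> in auto)
  qed
  \<comment> \<open>\<open>Lim\<close> determines the derivative only at a limit point; the points
    \<open>x + p ^ k\<close> approach \<open>x\<close>.\<close>
  moreover have "\<not> trivial_limit (at x within Zp)"
    unfolding trivial_limit_within islimpt_approachable not_not
  proof (intro allI impI)
    fix e :: real assume "0 < e"
    then obtain k where k: "\<rho> ^ k < e" using \<rho>_power_less by blast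
    show "\<exists>x'\<in>Zp. x' \<noteq> x \<and> dist x' x < e"
      using k prime_gt_0_nat[OF prime_p]
      by (intro bexI[of _ "x + of_nat (p ^ k)"] Zp_add x_Zp Zp_of_nat)
        (auto simp: dist_absval absval_power absval_p)
  qed
  ultimately show ?thesis unfolding deriv_on_def by (intro tendsto_Lim)
qed

lemma deriv_on_funpow_eq:
  assumes G: "deriv_tower G" and f: "\<And>x. x \<in> S \<Longrightarrow> f x = G 0 x" and x: "x \<in> S"
  shows "(deriv_on Zp ^^ k) f x = G k x"
  using x
proof (induction k arbitrary: x)
  case (Suc k)
  obtain C where C: "\<And>x y. x \<in> S \<Longrightarrow> y \<in> S \<Longrightarrow>
      absval (G k y - G k x - G (Suc k) x * (y - x)) \<le> C * (absval (y - x))\<^sup>2"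
    using deriv_towerD[OF G, of k] by metis
  have "deriv_on Zp ((deriv_on Zp ^^ k) f) x = G (Suc k) x"
    using C Suc by (intro deriv_on_eq[where C = C]) auto
  then show ?case by simp
qed (simp add: f)

lemma deriv_tower_unique:
  assumes "deriv_tower F" "deriv_tower G" "\<And>x. x \<in> S \<Longrightarrow> F 0 x = G 0 x" "x \<in> S"
  shows "F k x = G k x"
  using deriv_on_funpow_eq[OF assms(1), of "F 0" x k] deriv_on_funpow_eq[OF assms(2), of "F 0" x k] assms
  by simp

lemma deriv_tower_shift:
  assumes "deriv_tower G"
  shows "deriv_tower (\<lambda>k x. G k (x + of_nat s))"
  unfolding deriv_tower_def
proof (intro allI conjI)
  fix j
  obtain C where C: "\<And>x. x \<in> S \<Longrightarrow> absval (G j x) \<le> C"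
    "\<And>x y. x \<in> S \<Longrightarrow> y \<in> S \<Longrightarrow> absval (G j y - G j x - G (Suc j) x * (y - x)) \<le> C * (absval (y - x))\<^sup>2"
    using deriv_towerD[OF assms, of j] by metis
  show "\<exists>C. \<forall>x\<in>S. absval (G j (x + of_nat s)) \<le> C"
    using C(1) S_add_s by blast
  show "\<exists>C. \<forall>x\<in>S. \<forall>y\<in>S. absval (G j (y + of_nat s) - G j (x + of_nat s) -
      G (Suc j) (x + of_nat s) * (y - x)) \<le> C * (absval (y - x))\<^sup>2"
    using C(2)[OF S_add_s S_add_s] by (intro exI[of _ C]) simp
qed

lemma absval_const_mult_le:
  "absval (x :: 'a) \<le> C \<Longrightarrow> absval (a * x) \<le> absval a * C"
  unfolding absval_mult by (intro mult_left_mono) auto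

text \<open>The Leibniz rule for \<open>a f + x g\<close>, one step of Horner's scheme. At
  \<open>k = 0\<close> the factor \<open>of_nat k\<close> removes the term with the truncated index
  \<open>k - 1\<close>.\<close>

lemma deriv_tower_affine:
  assumes F: "deriv_tower F" and G: "deriv_tower G"
  shows "deriv_tower (\<lambda>k x. a * F k x + x * G k x + of_nat k * G (k - 1) x)"
  unfolding deriv_tower_def
proof (intro allI conjI)
  fix j
  obtain A where A: "A \<ge> 0" "\<And>x. x \<in> S \<Longrightarrow> absval (F j x) \<le> A"
    "\<And>x y. x \<in> S \<Longrightarrow> y \<in> S \<Longrightarrow> absval (F j y - F j x - F (Suc j) x * (y - x)) \<le> A * (absval (y - x))\<^sup>2"
    using deriv_towerD[OF F, of j] by metis
  obtain B where B: "B \<ge> 0" "\<And>x. x \<in> S \<Longrightarrow> absval (G j x) \<le> B"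
    "\<And>x y. x \<in> S \<Longrightarrow> y \<in> S \<Longrightarrow> absval (G j y - G j x - G (Suc j) x * (y - x)) \<le> B * (absval (y - x))\<^sup>2"
    using deriv_towerD[OF G, of j] by metis
  obtain B' where B': "B' \<ge> 0" "\<And>x. x \<in> S \<Longrightarrow> absval (G (Suc j) x) \<le> B'"
    using deriv_towerD[OF G, of "Suc j"] by metis
  obtain D where D: "D \<ge> 0" "\<And>x. x \<in> S \<Longrightarrow> absval (G (j - 1) x) \<le> D"
    "\<And>x y. x \<in> S \<Longrightarrow> y \<in> S \<Longrightarrow>
      absval (G (j - 1) y - G (j - 1) x - G (Suc (j - 1)) x * (y - x)) \<le> D * (absval (y - x))\<^sup>2"
    using deriv_towerD[OF G, of "j - 1"] by metis
  have S1: "absval x \<le> 1" if "x \<in> S" for x using that S_subset Zp_absval by blast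
  define M where "M = max (max (absval a * A) (max B D)) B'"
  have M: "absval a * A \<le> M" "B \<le> M" "D \<le> M" "B' \<le> M" by (auto simp: M_def)
  show "\<exists>C. \<forall>x\<in>S. absval (a * F j x + x * G j x + of_nat j * G (j - 1) x) \<le> C"
  proof (intro exI[of _ M] ballI absval_add_le)
    fix x assume x: "x \<in> S"
    show "absval (a * F j x) \<le> M" using absval_const_mult_le[OF A(2)[OF x], of a] M(1) by simp
    show "absval (x * G j x) \<le> M" using B(2)[OF x] M(2) S1[OF x] by (intro absval_mult_le_left) auto
    show "absval (of_nat j * G (j - 1) x) \<le> M"
      using D(2)[OF x] M(3) by (intro absval_mult_le_left) auto
  qed
  show "\<exists>C. \<forall>x\<in>S. \<forall>y\<in>S. absval (a * F j y + y * G j y + of_nat j * G (j - 1) y -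
      (a * F j x + x * G j x + of_nat j * G (j - 1) x) -
      (a * F (Suc j) x + x * G (Suc j) x + of_nat (Suc j) * G (Suc j - 1) x) * (y - x)) \<le>
      C * (absval (y - x))\<^sup>2"
  proof (intro exI[of _ M] ballI)
    fix x y assume x: "x \<in> S" and y: "y \<in> S"
    let ?t = "absval (y - x)"
    have mono: "c * ?t\<^sup>2 \<le> M * ?t\<^sup>2" if "c \<le> M" for c using that by (intro mult_right_mono) auto
    define u where "u = F j y - F j x - F (Suc j) x * (y - x)"
    define v where "v = G j y - G j x - G (Suc j) x * (y - x)"
    define w where "w = G (j - 1) y - G (j - 1) x - G (Suc (j - 1)) x * (y - x)"
    have t1: "absval (a * u) \<le> M * ?t\<^sup>2"
      using absval_const_mult_le[OF A(3)[OF x y], of a] mono[OF M(1)] by (simp add: u_def mult.assoc)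
    have t2: "absval (y * v) \<le> M * ?t\<^sup>2"
      using B(3)[OF x y] mono[OF M(2)] S1[OF y] by (intro absval_mult_le_left) (auto simp: v_def)
    have t3: "absval (of_nat j * w) \<le> M * ?t\<^sup>2"
      using D(3)[OF x y] mono[OF M(3)] by (intro absval_mult_le_left) (auto simp: w_def)
    have t4: "absval (G (Suc j) x * ((y - x) * (y - x))) \<le> M * ?t\<^sup>2"
      unfolding absval_mult power2_eq_square using B'(2)[OF x] M(4) by (intro mult_right_mono) auto
    have jw: "of_nat j * G (Suc (j - 1)) x = of_nat j * G j x" by (cases j) auto
    have "a * F j y + y * G j y + of_nat j * G (j - 1) y -
      (a * F j x + x * G j x + of_nat j * G (j - 1) x) -
      (a * F (Suc j) x + x * G (Suc j) x + of_nat (Suc j) * G (Suc j - 1) x) * (y - x) =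
      a * u + y * v + of_nat j * w + G (Suc j) x * ((y - x) * (y - x)) +
      (of_nat j * G (Suc (j - 1)) x - of_nat j * G j x) * (y - x)"
      by (simp add: u_def v_def w_def algebra_simps)
    also have "\<dots> = a * u + y * v + of_nat j * w + G (Suc j) x * ((y - x) * (y - x))"
      unfolding jw by simp
    finally show "absval (a * F j y + y * G j y + of_nat j * G (j - 1) y -
      (a * F j x + x * G j x + of_nat j * G (j - 1) x) -
      (a * F (Suc j) x + x * G (Suc j) x + of_nat (Suc j) * G (Suc j - 1) x) * (y - x)) \<le> M * ?t\<^sup>2"
      using absval_add_le[OF absval_add_le[OF absval_add_le[OF t1 t2] t3] t4] by (simp only:)
  qed
qed

definition jet :: "(nat \<Rightarrow> 'a \<Rightarrow> 'a) \<Rightarrow> 'a \<Rightarrow> 'a fps" where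
  "jet G x = Abs_fps (\<lambda>k. G k x / fact k)"

text \<open>The Leibniz rule for a polynomial factor, in terms of Taylor series:
  \<open>pcompose q [:x, 1:]\<close> is the expansion of \<open>q\<close> at \<open>x\<close>.
  Induction on \<open>q\<close> in Horner form reduces it to the affine case.\<close>

lemma deriv_tower_poly_mult:
  assumes "deriv_tower G"
  shows "deriv_tower (\<lambda>k x. fact k * fps_nth (fps_of_poly (pcompose q [:x, 1:]) * jet G x) k)"
proof (induction q)
  case 0
  then show ?case by (auto simp: deriv_tower_def intro!: exI[of _ 0])
next
  case (pCons a q)
  let ?V = "\<lambda>x. fps_of_poly (pcompose q [:x, 1:]) * jet G x"
  have "fact k * fps_nth (fps_of_poly (pcompose (pCons a q) [:x, 1:]) * jet G x) k =
      a * G k x + x * (fact k * fps_nth (?V x) k) + of_nat k * (fact (k - 1) * fps_nth (?V x) (k - 1))"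
    for k x
  proof -
    have "fps_of_poly (pcompose (pCons a q) [:x, 1:]) * jet G x =
        fps_const a * jet G x + fps_const x * ?V x + fps_X * ?V x"
      by (simp add: pcompose_pCons fps_of_poly_add fps_of_poly_mult fps_of_poly_pCons algebra_simps)
    moreover have "fact k * fps_nth (jet G x) k = G k x" by (simp add: jet_def)
    ultimately show ?thesis
      by (cases k) (simp_all add: algebra_simps)
  qed
  then show ?case using deriv_tower_affine[OF assms pCons(2), of a] by simp
qed

section \<open>The functional equation and its Taylor expansion\<close>

definition mult_poly :: "'a poly" where
  "mult_poly = [:(-1) ^ s:] * (\<Prod>j\<in>unit_indices p s. [:of_nat j, 1:])"

lemma poly_mult_poly_of_nat: "poly mult_poly (of_nat m) = of_int (poly (shift_poly p s) (int m))"
  by (simp add: mult_poly_def poly_shift_poly poly_prod)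

lemma coeffs_le_mult_poly: "coeffs_le 1 mult_poly"
proof -
  have one: "coeffs_le 1 (1 :: 'a poly)"
    by (auto simp: coeffs_le_def coeff_pCons one_pCons split: nat.splits)
  have "coeffs_le 1 (\<Prod>j\<in>A. [:of_nat j :: 'a, 1:])" for A :: "nat set"
    by (induction A rule: infinite_finite_induct)
      (auto simp: one intro!: coeffs_le_linear_mult simp del: mult_pCons_left mult_pCons_right)
  then show ?thesis by (auto simp: coeffs_le_def mult_poly_def absval_mult absval_power)
qed

text \<open>At \<open>x = s n\<close> this is \<open>int_gamma_add\<close>. Both sides are Lipschitz
  in \<open>z = x / s\<close>, so \<open>lipschitz_zero\<close> extends it to
  \<open>S\<close>.\<close>

lemma morita_gamma_shift:
  assumes "x \<in> S"
  shows "morita_gamma p (x + of_nat s) = poly mult_poly x * morita_gamma p x"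
proof -
  obtain z where z: "x = of_nat s * z" "z \<in> Zp" using assms by (auto simp: S_def)
  let ?g = "morita_gamma p :: 'a \<Rightarrow> 'a"
  define \<phi> where "\<phi> z = ?g (of_nat s * z + of_nat s) - poly mult_poly (of_nat s * z) * ?g (of_nat s * z)" for z
  have "\<phi> z = 0"
  proof (rule lipschitz_zero[OF _ _ z(2)])
    fix n
    have "?g (of_nat (s * n + s)) = of_int (poly (shift_poly p s) (int (s * n))) * ?g (of_nat (s * n))"
      unfolding morita_gamma_of_nat using int_gamma_add[of p "s * n" s] s_dvd by simp
    then show "\<phi> (of_nat n) = 0"
      unfolding \<phi>_def poly_mult_poly_of_nat[symmetric] by simp
  next
    fix x y assume xy: "x \<in> Zp" "y \<in> Zp"
    define u v where "u = of_nat s * x" and "v = of_nat s * y"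
    have uv: "u \<in> Zp" "v \<in> Zp" using xy Zp_mult_of_nat by (auto simp: u_def v_def)
    have uv_le: "absval (u - v) \<le> absval (x - y)"
      using absval_mult_le_left[of "of_nat s" "x - y" "absval (x - y)"]
      by (simp add: u_def v_def algebra_simps)
    define L where "L = real p ^ 3"
    have L: "1 \<le> L" using p_gt_1 by (simp add: L_def)
    have lip: "absval (?g (u' + of_nat c) - ?g (v' + of_nat c)) \<le> L * absval (x - y)"
      if "u' = u" "v' = v" for u' v' c
    proof -
      have "absval (?g (u + of_nat c) - ?g (v + of_nat c)) \<le> L * absval (u - v)"
        using morita_gamma_lipschitz[of "u + of_nat c" "v + of_nat c"] uv by (simp add: L_def Zp_add)
      also have "\<dots> \<le> L * absval (x - y)" using uv_le L by (intro mult_left_mono) auto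
      finally show ?thesis using that by simp
    qed
    have g_le: "absval (?g v) \<le> L"
    proof -
      have "absval (?g v - ?g (of_nat 0)) \<le> L * absval (v - of_nat 0)"
        unfolding L_def by (rule morita_gamma_lipschitz[OF uv(2) Zp_of_nat])
      also have "\<dots> \<le> L * 1" using Zp_absval[OF uv(2)] L by (intro mult_left_mono) auto
      finally have "absval (?g v - 1) \<le> L" unfolding morita_gamma_of_nat by simp
      then show ?thesis using absval_add_le[of "?g v - 1" L 1] L by simp
    qed
    have t1: "absval (?g (u + of_nat s) - ?g (v + of_nat s)) \<le> L * absval (x - y)"
      by (rule lip) auto
    have t2: "absval (poly mult_poly u * (?g u - ?g v)) \<le> L * absval (x - y)"
      using lip[of u v 0] absval_poly_le[OF coeffs_le_mult_poly Zp_absval[OF uv(1)]]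
      by (intro absval_mult_le_left) auto
    have t3: "absval ((poly mult_poly u - poly mult_poly v) * ?g v) \<le> L * absval (x - y)"
    proof -
      have "absval (poly mult_poly u - poly mult_poly v) \<le> absval (x - y)"
        using absval_poly_diff_le[OF coeffs_le_mult_poly Zp_absval[OF uv(2)] Zp_absval[OF uv(1)]] uv_le
        by simp
      then have "absval (poly mult_poly u - poly mult_poly v) * absval (?g v) \<le> absval (x - y) * L"
        using g_le by (intro mult_mono) auto
      then show ?thesis by (simp add: absval_mult mult.commute)
    qed
    have "\<phi> x - \<phi> y = (?g (u + of_nat s) - ?g (v + of_nat s)) -
        (poly mult_poly u * (?g u - ?g v) + (poly mult_poly u - poly mult_poly v) * ?g v)"
      by (simp add: \<phi>_def u_def v_def algebra_simps)
    then show "absval (\<phi> x - \<phi> y) \<le> L * absval (x - y)"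
      using absval_diff_le[OF t1 absval_add_le[OF t2 t3]] by (simp only:)
  qed
  then show ?thesis by (simp add: \<phi>_def z)
qed

text \<open>The limits \<open>H j\<close> inherit the quadratic bound of the Newton polynomials,
  which is uniform in \<open>n\<close>. \<open>H 0\<close> is the gamma function at naturals by
  interpolation, then everywhere by \<open>lipschitz_zero\<close>. The chain rule for
  \<open>x / s\<close> gives the factors \<open>1 / s ^ j\<close>.\<close>

lemma morita_gamma_tower:
  obtains G where "deriv_tower G" "\<And>x. x \<in> S \<Longrightarrow> morita_gamma p x = G 0 x"
proof -
  obtain H where H: "\<And>j z n. absval z \<le> 1 \<Longrightarrow>
      absval (poly ((pderiv ^^ j) (newton_poly n)) z - H j z) \<le> \<rho> ^ n"
    by (rule newton_limit) blast
  have H_bound: "absval (H j z) \<le> 1" if "absval z \<le> 1" for j z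
  proof -
    \<comment> \<open>At \<open>n = 0\<close> the Newton polynomial is 0 and the error bound is
      1.\<close>
    have "(pderiv ^^ j) 0 = (0 :: 'a poly)" by (induction j) auto
    then show ?thesis using H[OF that, of j 0] by (simp add: newton_poly_def)
  qed
  have H_quad: "absval (H j y - H j x - H (Suc j) x * (y - x)) \<le> (absval (y - x))\<^sup>2"
    if x: "absval x \<le> 1" and y: "absval y \<le> 1" for j x y
  proof (rule le_if_le_\<rho>_power[where c = 1])
    fix n
    let ?C = "max ((absval (y - x))\<^sup>2) (1 * \<rho> ^ n)"
    let ?q = "(pderiv ^^ j) (newton_poly n)"
    have le: "\<rho> ^ n \<le> ?C" by simp
    have yx: "absval (y - x) \<le> 1" using x y by (intro absval_diff_le)
    have t0: "absval (poly ?q y - poly ?q x - poly (pderiv ?q) x * (y - x)) \<le> ?C"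
      using absval_poly_taylor_le[OF coeffs_le_pderiv_funpow[OF coeffs_le_newton_poly] x y, of j n] by simp
    have t1: "absval (poly ?q y - H j y) \<le> ?C" "absval (poly ?q x - H j x) \<le> ?C"
      using H[OF y, of j n] H[OF x, of j n] le by auto
    have "absval ((y - x) * (poly (pderiv ?q) x - H (Suc j) x)) \<le> \<rho> ^ n"
      using H[OF x, of "Suc j" n] yx by (intro absval_mult_le_left) auto
    then have t2: "absval ((y - x) * (poly (pderiv ?q) x - H (Suc j) x)) \<le> ?C" using le by simp
    have "H j y - H j x - H (Suc j) x * (y - x) =
        (poly ?q y - poly ?q x - poly (pderiv ?q) x * (y - x)) - (poly ?q y - H j y) +
        (poly ?q x - H j x) + (y - x) * (poly (pderiv ?q) x - H (Suc j) x)"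
      by (simp add: algebra_simps)
    then show "absval (H j y - H j x - H (Suc j) x * (y - x)) \<le> ?C"
      using absval_add_le[OF absval_add_le[OF absval_diff_le[OF t0 t1(1)] t1(2)] t2] by (simp only:)
  qed simp
  have H0: "H 0 z = morita_gamma p (of_nat s * z)" if z: "z \<in> Zp" for z
  proof -
    have "morita_gamma p (of_nat s * z) - H 0 z = 0"
    proof (rule lipschitz_zero[where \<phi> = "\<lambda>z. morita_gamma p (of_nat s * z) - H 0 z", OF _ _ z])
      fix n
      have "absval (of_int (h n) - H 0 (of_nat n)) \<le> 0"
      proof (rule le_if_le_\<rho>_power[where c = 1])
        fix k
        have "absval (poly (newton_poly (max k (Suc n))) (of_nat n) - H 0 (of_nat n)) \<le> \<rho> ^ max k (Suc n)"
          using H[of "of_nat n" 0 "max k (Suc n)"] by simp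
        also have "\<dots> \<le> \<rho> ^ k" by (rule \<rho>_power_mono) simp
        finally show "absval (of_int (h n) - H 0 (of_nat n)) \<le> max 0 (1 * \<rho> ^ k)"
          by (simp add: poly_newton_poly_of_nat)
      qed simp
      then have "of_int (h n) - H 0 (of_nat n) = 0"
        by (metis absval_eq_0_iff absval_nonneg order_antisym)
      then show "morita_gamma p (of_nat s * of_nat n) - H 0 (of_nat n) = 0"
        using morita_gamma_of_nat[of "s * n"] by (simp add: h_def)
    next
      fix x y assume xy: "x \<in> Zp" "y \<in> Zp"
      note x1 = Zp_absval[OF xy(1)] note y1 = Zp_absval[OF xy(2)]
      define L where "L = real p ^ 3"
      have L: "1 \<le> L" using p_gt_1 by (simp add: L_def)
      have le: "absval (x - y) \<le> L * absval (x - y)"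
        using mult_right_mono[OF L, of "absval (x - y)"] by simp
      have "absval (of_nat s * x - of_nat s * y) \<le> absval (x - y)"
        using absval_mult_le_left[of "of_nat s" "x - y" "absval (x - y)"] by (simp add: algebra_simps)
      then have "L * absval (of_nat s * x - of_nat s * y) \<le> L * absval (x - y)"
        using L by (intro mult_left_mono) auto
      then have t1: "absval (morita_gamma p (of_nat s * x) - morita_gamma p (of_nat s * y)) \<le> L * absval (x - y)"
        using morita_gamma_lipschitz[OF Zp_mult_of_nat[OF xy(1), of s] Zp_mult_of_nat[OF xy(2), of s]]
        by (simp add: L_def)
      have "absval (x - y) \<le> 1" using x1 y1 by (rule absval_diff_le)
      then have "absval (H 0 x - H 0 y - H (Suc 0) y * (x - y)) \<le> absval (x - y)"
        using order_trans[OF H_quad[OF y1 x1, of 0]] mult_left_le_one_le[of "absval (x - y)" "absval (x - y)"]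
        by (simp add: power2_eq_square)
      moreover have "absval (H (Suc 0) y * (x - y)) \<le> absval (x - y)"
        using H_bound[OF y1] by (intro absval_mult_le_left) auto
      ultimately have "absval (H 0 x - H 0 y) \<le> absval (x - y)"
        using absval_add_le[of "H 0 x - H 0 y - H (Suc 0) y * (x - y)" "absval (x - y)"
            "H (Suc 0) y * (x - y)"] by simp
      then have t2: "absval (H 0 x - H 0 y) \<le> L * absval (x - y)" using le by simp
      have "(morita_gamma p (of_nat s * x) - H 0 x) - (morita_gamma p (of_nat s * y) - H 0 y) =
          (morita_gamma p (of_nat s * x) - morita_gamma p (of_nat s * y)) - (H 0 x - H 0 y)"
        by (simp add: algebra_simps)
      then show "absval ((morita_gamma p (of_nat s * x) - H 0 x) -
          (morita_gamma p (of_nat s * y) - H 0 y)) \<le> L * absval (x - y)"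
        using absval_diff_le[OF t1 t2] by (simp only:)
    qed
    then show ?thesis by simp
  qed
  define G where "G j x = H j (x / of_nat s) / of_nat s ^ j" for j x
  have "deriv_tower G"
    unfolding deriv_tower_def
  proof (intro allI conjI)
    fix j
    let ?c = "absval (of_nat s ^ j :: 'a)"
    have c: "?c > 0" using s_nonzero by simp
    show "\<exists>C. \<forall>x\<in>S. absval (G j x) \<le> C"
    proof (intro exI ballI)
      fix x assume "x \<in> S"
      then show "absval (G j x) \<le> 1 / ?c"
        unfolding G_def absval_divide
        using H_bound[OF Zp_absval[OF S_divide]] c by (intro divide_right_mono) auto
    qed
    show "\<exists>C. \<forall>x\<in>S. \<forall>y\<in>S. absval (G j y - G j x - G (Suc j) x * (y - x)) \<le> C * (absval (y - x))\<^sup>2"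
    proof (intro exI ballI)
      fix x y assume xy: "x \<in> S" "y \<in> S"
      let ?x = "x / of_nat s" let ?y = "y / of_nat s"
      have diff: "?y - ?x = (y - x) / of_nat s" by (simp add: diff_divide_distrib)
      have "G j y - G j x - G (Suc j) x * (y - x) =
          (H j ?y - H j ?x - H (Suc j) ?x * (?y - ?x)) / of_nat s ^ j"
        unfolding diff G_def using s_nonzero by (simp add: field_simps)
      then have "absval (G j y - G j x - G (Suc j) x * (y - x)) =
          absval (H j ?y - H j ?x - H (Suc j) ?x * (?y - ?x)) / ?c" by (simp only: absval_divide)
      also have "\<dots> \<le> (absval (?y - ?x))\<^sup>2 / ?c"
        using H_quad[OF Zp_absval[OF S_divide[OF xy(1)]] Zp_absval[OF S_divide[OF xy(2)]]]
        by (intro divide_right_mono) auto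
      also have "\<dots> = (1 / (absval (of_nat s :: 'a))\<^sup>2 / ?c) * (absval (y - x))\<^sup>2"
        unfolding diff by (simp add: absval_divide power_divide)
      finally show "absval (G j y - G j x - G (Suc j) x * (y - x)) \<le>
          (1 / (absval (of_nat s :: 'a))\<^sup>2 / ?c) * (absval (y - x))\<^sup>2" .
    qed
  qed
  moreover have "morita_gamma p x = G 0 x" if "x \<in> S" for x
    using H0[OF S_divide[OF that]] s_nonzero by (simp add: G_def)
  ultimately show thesis using that by blast
qed

text \<open>Both sides of the functional equation start towers that agree at the bottom, so
  uniqueness of towers differentiates the equation to all orders at once.\<close>

theorem morita_gamma_jets:
  obtains Y :: "nat \<Rightarrow> 'a fps" where
    "\<And>k m. (deriv_on Zp ^^ k) (morita_gamma p) (of_nat (s * m)) = fact k * fps_nth (Y m) k"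
    "\<And>m. Y (Suc m) = fps_of_poly (pcompose mult_poly [:of_nat (s * m), 1:]) * Y m"
proof -
  obtain G where G: "deriv_tower G" and G0: "\<And>x. x \<in> S \<Longrightarrow> morita_gamma p x = G 0 x"
    by (rule morita_gamma_tower) blast
  define Y where "Y m = jet G (of_nat (s * m))" for m
  let ?T = "\<lambda>k x. fact k * fps_nth (fps_of_poly (pcompose mult_poly [:x, 1:]) * jet G x) k"
  have shift: "G k (x + of_nat s) = ?T k x" if x: "x \<in> S" for k x
  proof (rule deriv_tower_unique[OF deriv_tower_shift[OF G] deriv_tower_poly_mult[OF G] _ x])
    fix x assume x: "x \<in> S"
    have "poly (pcompose mult_poly [:x, 1:]) 0 = poly mult_poly x" by (simp add: poly_pcompose)
    then have "?T 0 x = poly mult_poly x * G 0 x"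
      by (simp add: jet_def poly_0_coeff_0)
    moreover have "G 0 (x + of_nat s) = poly mult_poly x * G 0 x"
      using morita_gamma_shift[OF x] G0[OF x] G0[OF S_add_s[OF x]] by simp
    ultimately show "G 0 (x + of_nat s) = ?T 0 x" by (simp only:)
  qed
  show thesis
  proof (rule that[of Y])
    show "(deriv_on Zp ^^ k) (morita_gamma p) (of_nat (s * m)) = fact k * fps_nth (Y m) k" for k m
      using deriv_on_funpow_eq[OF G G0 S_of_nat] by (simp add: Y_def jet_def)
    show "Y (Suc m) = fps_of_poly (pcompose mult_poly [:of_nat (s * m), 1:]) * Y m" for m
    proof (rule fps_ext)
      fix k
      have "of_nat (s * Suc m) = (of_nat (s * m) + of_nat s :: 'a)" by (simp add: algebra_simps)
      then have "fps_nth (Y (Suc m)) k = G k (of_nat (s * m) + of_nat s) / fact k"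
        by (simp only: Y_def jet_def fps_nth_Abs_fps)
      also have "\<dots> = fps_nth (fps_of_poly (pcompose mult_poly [:of_nat (s * m), 1:]) * Y m) k"
        unfolding shift[OF S_of_nat] Y_def by simp
      finally show "fps_nth (Y (Suc m)) k =
          fps_nth (fps_of_poly (pcompose mult_poly [:of_nat (s * m), 1:]) * Y m) k" .
    qed
  qed
qed

end

section \<open>Polynomial functions, logarithmic derivatives and the theorem\<close>

text \<open>The Taylor coefficients of a series \<open>W\<close> recovered from its constant term
  \<open>F\<close> and the coefficients \<open>h\<close> of its logarithmic derivative
  \<open>L\<close>, by comparing coefficients in \<open>W' = L * W\<close>.\<close>

fun log_jet :: "'a::field_char_0 \<Rightarrow> (nat \<Rightarrow> 'a) \<Rightarrow> nat \<Rightarrow> 'a" where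
  "log_jet F h 0 = F"
| "log_jet F h (Suc k) = (\<Sum>i\<le>k. h i * log_jet F h (k - i)) / of_nat (Suc k)"

lemma log_jet_eq:
  fixes W :: "'a::field_char_0 fps"
  assumes "fps_deriv W = L * W"
  shows "log_jet (fps_nth W 0) (fps_nth L) k = fps_nth W k"
proof (induction k rule: less_induct)
  case (less k)
  show ?case
  proof (cases k)
    case (Suc j)
    have "of_nat (Suc j) * fps_nth W (Suc j) = fps_nth (L * W) j"
      unfolding assms[symmetric] by simp
    also have "\<dots> = (\<Sum>i\<le>j. fps_nth L i * fps_nth W (j - i))"
      by (simp add: fps_mult_nth atLeast0AtMost)
    also have "\<dots> = (\<Sum>i\<le>j. fps_nth L i * log_jet (fps_nth W 0) (fps_nth L) (j - i))"
      using less Suc by (intro sum.cong) auto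
    finally show ?thesis unfolding Suc by (simp add: field_simps del: of_nat_Suc)
  qed simp
qed

text \<open>Polynomials in \<open>x\<close>, \<open>F\<close> and
  \<open>h 0, ..., h (n - 1)\<close>, in the normal form that \<open>relation\<close> expects:
  distinct monomials in \<open>F\<close> and \<open>h\<close>, with coefficients polynomial in
  \<open>x\<close>.\<close>

definition poly_fun :: "nat \<Rightarrow> ('a::field_char_0 \<Rightarrow> 'a \<Rightarrow> (nat \<Rightarrow> 'a) \<Rightarrow> 'a) \<Rightarrow> bool" where
  "poly_fun n q \<longleftrightarrow> (\<exists>T A. finite T \<and> (\<forall>t\<in>T. snd t \<in> extensional {..<n}) \<and>
     (\<forall>x F h. q x F h = (\<Sum>t\<in>T. poly (A t) x * (F ^ fst t * (\<Prod>i<n. h i ^ snd t i)))))"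

text \<open>\<tau> may repeat monomials; the coefficients of equal ones are added. Sums and products
  need no normal form of their own this way.\<close>

lemma poly_fun_family:
  assumes "finite I" "\<And>i. i \<in> I \<Longrightarrow> snd (\<tau> i) \<in> extensional {..<n}"
    and "\<And>x F h. q x F h = (\<Sum>i\<in>I. poly (A i) x * (F ^ fst (\<tau> i) * (\<Prod>j<n. h j ^ snd (\<tau> i) j)))"
  shows "poly_fun n q"
  unfolding poly_fun_def
proof (intro exI conjI allI)
  show "finite (\<tau> ` I)" "\<forall>t\<in>\<tau> ` I. snd t \<in> extensional {..<n}" using assms by auto
  fix x F h
  have "q x F h = (\<Sum>t\<in>\<tau> ` I. \<Sum>i | i \<in> I \<and> \<tau> i = t.
      poly (A i) x * (F ^ fst (\<tau> i) * (\<Prod>j<n. h j ^ snd (\<tau> i) j)))"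
    unfolding assms(3) by (rule sum.image_gen[OF assms(1)])
  also have "\<dots> = (\<Sum>t\<in>\<tau> ` I. poly (\<Sum>i | i \<in> I \<and> \<tau> i = t. A i) x *
      (F ^ fst t * (\<Prod>j<n. h j ^ snd t j)))"
    unfolding poly_sum sum_distrib_right by (intro sum.cong refl) auto
  finally show "q x F h = (\<Sum>t\<in>\<tau> ` I. poly (\<Sum>i | i \<in> I \<and> \<tau> i = t. A i) x *
      (F ^ fst t * (\<Prod>j<n. h j ^ snd t j)))" .
qed

lemma poly_fun_poly: "poly_fun n (\<lambda>x F h. poly A x)"
  by (rule poly_fun_family[where I = "{()}" and A = "\<lambda>_. A" and
        \<tau> = "\<lambda>_. (0, restrict (\<lambda>_. 0) {..<n})"]) auto

lemma poly_fun_const: "poly_fun n (\<lambda>x F h. c)"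
  using poly_fun_poly[of n "[:c:]"] by simp

lemma poly_fun_X: "poly_fun n (\<lambda>x F h. x)"
  using poly_fun_poly[of n "[:0, 1:]"] by simp

lemma poly_fun_F: "poly_fun n (\<lambda>x F h. F)"
  by (rule poly_fun_family[where I = "{()}" and A = "\<lambda>_. 1" and
        \<tau> = "\<lambda>_. (1, restrict (\<lambda>_. 0) {..<n})"]) auto

lemma poly_fun_H:
  assumes "i < n"
  shows "poly_fun n (\<lambda>x F h. h i)"
proof (rule poly_fun_family[where I = "{()}" and A = "\<lambda>_. 1" and
      \<tau> = "\<lambda>_. (0, restrict (\<lambda>j. if j = i then 1 else 0) {..<n})"])
  fix x F and h :: "nat \<Rightarrow> 'a"
  have "(\<Prod>j<n. h j ^ restrict (\<lambda>j. if j = i then 1 else 0) {..<n} j) = (\<Prod>j<n. if j = i then h i else 1)"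
    by (rule prod.cong) auto
  also have "\<dots> = h i" using assms by simp
  finally show "h i = (\<Sum>u\<in>{()}. poly 1 x * (F ^ fst (0 :: nat, restrict (\<lambda>j. if j = i then 1 else 0) {..<n}) *
      (\<Prod>j<n. h j ^ snd (0 :: nat, restrict (\<lambda>j. if j = i then 1 else (0 :: nat)) {..<n}) j)))"
    by simp
qed auto

lemma poly_fun_add:
  assumes "poly_fun n q" "poly_fun n r"
  shows "poly_fun n (\<lambda>x F h. q x F h + r x F h)"
proof -
  obtain T A where T: "finite T" "\<forall>t\<in>T. snd t \<in> extensional {..<n}"
    "\<And>x F h. q x F h = (\<Sum>t\<in>T. poly (A t) x * (F ^ fst t * (\<Prod>i<n. h i ^ snd t i)))"
    using assms(1) unfolding poly_fun_def by blast
  obtain U B where U: "finite U" "\<forall>t\<in>U. snd t \<in> extensional {..<n}"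
    "\<And>x F h. r x F h = (\<Sum>t\<in>U. poly (B t) x * (F ^ fst t * (\<Prod>i<n. h i ^ snd t i)))"
    using assms(2) unfolding poly_fun_def by blast
  show ?thesis
    by (rule poly_fun_family[where I = "T <+> U" and A = "case_sum A B" and \<tau> = "case_sum id id"])
      (use T U in \<open>auto simp: sum.Plus\<close>)
qed

lemma poly_fun_mult:
  fixes q r :: "'a::field_char_0 \<Rightarrow> 'a \<Rightarrow> (nat \<Rightarrow> 'a) \<Rightarrow> 'a"
  assumes "poly_fun n q" "poly_fun n r"
  shows "poly_fun n (\<lambda>x F h. q x F h * r x F h)"
proof -
  obtain T A where T: "finite T" "\<forall>t\<in>T. snd t \<in> extensional {..<n}"
    "\<And>x F h. q x F h = (\<Sum>t\<in>T. poly (A t) x * (F ^ fst t * (\<Prod>i<n. h i ^ snd t i)))"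
    using assms(1) unfolding poly_fun_def by blast
  obtain U B where U: "finite U" "\<forall>t\<in>U. snd t \<in> extensional {..<n}"
    "\<And>x F h. r x F h = (\<Sum>t\<in>U. poly (B t) x * (F ^ fst t * (\<Prod>i<n. h i ^ snd t i)))"
    using assms(2) unfolding poly_fun_def by blast
  let ?\<tau> = "\<lambda>(t, u). (fst t + fst u, restrict (\<lambda>i. snd t i + snd u i) {..<n})"
  show ?thesis
  proof (rule poly_fun_family[where I = "T \<times> U" and A = "\<lambda>(t, u). A t * B u" and \<tau> = ?\<tau>])
    fix x F :: 'a and h :: "nat \<Rightarrow> 'a"
    have mono: "(F ^ fst t * (\<Prod>i<n. h i ^ snd t i)) * (F ^ fst u * (\<Prod>i<n. h i ^ snd u i)) =
        F ^ fst (?\<tau> (t, u)) * (\<Prod>i<n. h i ^ snd (?\<tau> (t, u)) i)" for t u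
      by (simp add: power_add prod.distrib mult_ac)
    show "q x F h * r x F h = (\<Sum>i\<in>T \<times> U. poly ((\<lambda>(t, u). A t * B u) i) x *
        (F ^ fst (?\<tau> i) * (\<Prod>j<n. h j ^ snd (?\<tau> i) j)))"
      unfolding T(3) U(3) sum_product sum.cartesian_product
    proof (rule sum.cong[OF refl])
      fix i :: "(nat \<times> (nat \<Rightarrow> nat)) \<times> (nat \<times> (nat \<Rightarrow> nat))"
      obtain t u where i: "i = (t, u)" by (cases i)
      have "poly (A t) x * (F ^ fst t * (\<Prod>i<n. h i ^ snd t i)) *
          (poly (B u) x * (F ^ fst u * (\<Prod>i<n. h i ^ snd u i))) =
          poly (A t * B u) x * (F ^ fst (?\<tau> (t, u)) * (\<Prod>i<n. h i ^ snd (?\<tau> (t, u)) i))"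
        unfolding mono[symmetric] poly_mult by (simp only: mult_ac)
      then show "(case i of (t, u) \<Rightarrow> poly (A t) x * (F ^ fst t * (\<Prod>i<n. h i ^ snd t i)) *
          (poly (B u) x * (F ^ fst u * (\<Prod>i<n. h i ^ snd u i)))) =
          poly ((\<lambda>(t, u). A t * B u) i) x * (F ^ fst (?\<tau> i) * (\<Prod>j<n. h j ^ snd (?\<tau> i) j))"
        by (simp only: i prod.case)
    qed
  qed (use T(1) U(1) in auto)
qed

lemma poly_fun_power: "poly_fun n q \<Longrightarrow> poly_fun n (\<lambda>x F h. q x F h ^ k)"
  by (induction k) (auto intro: poly_fun_const poly_fun_mult)

lemma poly_fun_sum:
  "(\<And>i. i \<in> I \<Longrightarrow> poly_fun n (q i)) \<Longrightarrow> poly_fun n (\<lambda>x F h. \<Sum>i\<in>I. q i x F h)"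
  by (induction I rule: infinite_finite_induct) (auto intro: poly_fun_const poly_fun_add)

lemma poly_fun_prod:
  "(\<And>i. i \<in> I \<Longrightarrow> poly_fun n (q i)) \<Longrightarrow> poly_fun n (\<lambda>x F h. \<Prod>i\<in>I. q i x F h)"
  by (induction I rule: infinite_finite_induct) (auto intro: poly_fun_const poly_fun_mult)

text \<open>\<open>log_jet F h k\<close> involves only \<open>h 0, ..., h (k - 1)\<close>, hence the
  bound \<open>k \<le> n\<close>.\<close>

lemma poly_fun_log_jet: "k \<le> n \<Longrightarrow> poly_fun n (\<lambda>(x::'a::field_char_0) F h. log_jet F h k)"
proof (induction k rule: less_induct)
  case (less k)
  show ?case
  proof (cases k)
    case 0
    then show ?thesis by (simp add: poly_fun_F)
  next
    case (Suc j)
    have "poly_fun n (\<lambda>(x::'a) F h. log_jet F h (j - i))" for i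
    proof (rule less.IH)
      show "j - i < k" "j - i \<le> n" using less.prems Suc by linarith+
    qed
    then have "poly_fun n (\<lambda>(x::'a) F h. (\<Sum>i\<le>j. h i * log_jet F h (j - i)) * (1 / of_nat (Suc j)))"
      using less.prems Suc by (intro poly_fun_mult poly_fun_sum poly_fun_H poly_fun_const) auto
    then show ?thesis unfolding Suc by simp
  qed
qed

lemma digits_unique:
  fixes a b :: "nat \<Rightarrow> nat"
  assumes "(\<Sum>i<n. a i * N ^ i) = (\<Sum>i<n. b i * N ^ i)" "\<And>i. a i < N" "\<And>i. b i < N" "i < n"
  shows "a i = b i"
  using assms
proof (induction n arbitrary: a b i)
  case (Suc n)
  have split: "(\<Sum>i<Suc n. c i * N ^ i) = c 0 + N * (\<Sum>i<n. c (Suc i) * N ^ i)" for c :: "nat \<Rightarrow> nat"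
    unfolding sum.lessThan_Suc_shift by (simp add: sum_distrib_left mult_ac)
  have eq: "a 0 + N * (\<Sum>i<n. a (Suc i) * N ^ i) = b 0 + N * (\<Sum>i<n. b (Suc i) * N ^ i)"
    using Suc.prems(1) unfolding split .
  have "a 0 = b 0" using arg_cong[OF eq, of "\<lambda>x. x mod N"] Suc.prems(2,3) by simp
  moreover have "(\<Sum>i<n. a (Suc i) * N ^ i) = (\<Sum>i<n. b (Suc i) * N ^ i)"
    using eq \<open>a 0 = b 0\<close> Suc.prems(2)[of 0] by simp
  then have "a (Suc j) = b (Suc j)" if "j < n" for j
    using Suc.IH[of "\<lambda>i. a (Suc i)" "\<lambda>i. b (Suc i)" j] Suc.prems(2,3) that by blast
  ultimately show ?case using Suc.prems(4) by (cases i) auto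
qed simp

text \<open>Kronecker substitution: at \<open>v i = t ^ (N ^ i)\<close> with \<open>N\<close> larger than all exponents, distinct
  monomials become distinct powers of \<open>t\<close>.\<close>

lemma mpoly_eq_0I:
  fixes P :: "'a::field_char_0 mpolynomial"
  assumes zero: "\<And>v. v 1 \<noteq> 0 \<Longrightarrow> mpoly_eval P v = 0"
  shows "P = 0"
proof (rule ccontr)
  assume "P \<noteq> 0"
  then have "Poly_Mapping.keys P \<noteq> {}" by simp
  then obtain m0 where m0: "m0 \<in> Poly_Mapping.keys P" by blast
  let ?K = "Poly_Mapping.keys P" and ?l = "Poly_Mapping.lookup"
  define N where "N = Suc (\<Sum>m\<in>?K. \<Sum>i\<in>Poly_Mapping.keys m. ?l m i)"
  define B where "B = Suc (\<Sum>m\<in>?K. \<Sum>i\<in>Poly_Mapping.keys m. i)"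
  define wt where "wt m = (\<Sum>i<B. ?l m i * N ^ i)" for m :: "nat \<Rightarrow>\<^sub>0 nat"
  have N: "?l m i < N" if "m \<in> ?K" for m i
  proof (cases "i \<in> Poly_Mapping.keys m")
    case True
    then have "?l m i \<le> (\<Sum>i\<in>Poly_Mapping.keys m. ?l m i)" by (intro member_le_sum) auto
    also have "\<dots> \<le> (\<Sum>m\<in>?K. \<Sum>i\<in>Poly_Mapping.keys m. ?l m i)"
      using that by (intro member_le_sum[where f = "\<lambda>m. \<Sum>i\<in>Poly_Mapping.keys m. ?l m i"]) auto
    finally show ?thesis by (simp add: N_def)
  qed (simp add: N_def in_keys_iff)
  have B: "i < B" if "m \<in> ?K" "i \<in> Poly_Mapping.keys m" for m i
  proof -
    have "i \<le> (\<Sum>i\<in>Poly_Mapping.keys m. i)" using that by (intro member_le_sum) auto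
    also have "\<dots> \<le> (\<Sum>m\<in>?K. \<Sum>i\<in>Poly_Mapping.keys m. i)"
      using that by (intro member_le_sum[where f = "\<lambda>m. \<Sum>i\<in>Poly_Mapping.keys m. i"]) auto
    finally show ?thesis by (simp add: B_def)
  qed
  have inj: "inj_on wt ?K"
  proof (rule inj_onI)
    fix m m' assume m: "m \<in> ?K" "m' \<in> ?K" "wt m = wt m'"
    have "?l m i = ?l m' i" for i
    proof (cases "i < B")
      case True
      then show ?thesis using digits_unique[of "?l m" N B "?l m'" i] m N by (auto simp: wt_def)
    next
      case False
      then have "i \<notin> Poly_Mapping.keys m" "i \<notin> Poly_Mapping.keys m'" using B m by blast+
      then show ?thesis by (simp add: in_keys_iff)
    qed
    then show "m = m'" by (intro poly_mapping_eqI)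
  qed
  define Q where "Q = (\<Sum>m\<in>?K. Polynomial.monom (?l P m) (wt m))"
  have "poly Q t = 0" if "t \<noteq> 0" for t
  proof -
    have "(\<Prod>i\<in>Poly_Mapping.keys m. (t ^ (N ^ i)) ^ ?l m i) = t ^ wt m" if "m \<in> ?K" for m
    proof -
      have "(\<Prod>i\<in>Poly_Mapping.keys m. (t ^ (N ^ i)) ^ ?l m i) = (\<Prod>i<B. (t ^ (N ^ i)) ^ ?l m i)"
        using B[OF that] by (intro prod.mono_neutral_left) (auto simp: in_keys_iff)
      also have "\<dots> = t ^ wt m"
        by (simp add: wt_def power_sum mult.commute flip: power_mult)
      finally show ?thesis .
    qed
    then have "poly Q t = mpoly_eval P (\<lambda>i. t ^ (N ^ i))"
      by (simp add: Q_def mpoly_eval_def poly_sum poly_monom)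
    then show ?thesis using zero[of "\<lambda>i. t ^ (N ^ i)"] that by simp
  qed
  \<comment> \<open>Nonzero \<open>t\<close> are those that satisfy the condition on
    \<open>v 1\<close>; the extra factor \<open>X\<close> covers \<open>t = 0\<close>.\<close>
  then have "poly ([:0, 1:] * Q) t = 0" for t by (cases "t = 0") auto
  then have "[:0, 1:] * Q = 0" using poly_all_0_iff_0[of "[:0, 1:] * Q"] by blast
  then have "Q = 0" by (simp del: mult_pCons_left)
  have "poly.coeff Q (wt m0) = (\<Sum>m\<in>?K. if m = m0 then ?l P m else 0)"
    unfolding Q_def coeff_sum using inj m0 by (intro sum.cong) (auto simp: inj_on_def)
  also have "\<dots> = ?l P m0" using m0 by simp
  finally show False using \<open>Q = 0\<close> m0 by (simp add: in_keys_iff)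
qed


section \<open>Logarithmic derivatives of power series\<close>

lemma fps_nth_0_prod: "fps_nth (\<Prod>j\<in>J. U j) 0 = (\<Prod>j\<in>J. fps_nth (U j :: 'a::comm_ring_1 fps) 0)"
  by (induction J rule: infinite_finite_induct) auto

definition fps_logd :: "'a::field_char_0 fps \<Rightarrow> 'a fps" where
  "fps_logd W = fps_deriv W * inverse W"

lemma fps_logd_times:
  assumes "fps_nth W 0 \<noteq> 0"
  shows "fps_logd W * W = fps_deriv W"
  by (simp add: fps_logd_def mult.assoc inverse_mult_eq_1[OF assms])

lemma fps_logd_mult:
  assumes "fps_nth U 0 \<noteq> 0" "fps_nth V 0 \<noteq> 0"
  shows "fps_logd (U * V) = fps_logd U + fps_logd V"
proof -
  have "inverse U * U = 1" "inverse V * V = 1"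
    using inverse_mult_eq_1[OF assms(1)] inverse_mult_eq_1[OF assms(2)] by auto
  moreover have "fps_logd (U * V) = fps_deriv U * inverse U * (inverse V * V) +
      fps_deriv V * inverse V * (inverse U * U)"
    by (simp add: fps_logd_def fps_inverse_mult algebra_simps)
  ultimately show ?thesis by (simp add: fps_logd_def)
qed

text \<open>The nonzero constant term is carried along because additivity in the induction step
  relies on it.\<close>

lemma fps_logd_const_mult_prod:
  assumes "finite J" "c \<noteq> 0" "\<And>j. j \<in> J \<Longrightarrow> fps_nth (U j) 0 \<noteq> 0"
  shows "fps_logd (fps_const c * (\<Prod>j\<in>J. U j)) = (\<Sum>j\<in>J. fps_logd (U j)) \<and>
    fps_nth (fps_const c * (\<Prod>j\<in>J. U j)) 0 \<noteq> 0"
  using assms(1,3)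
proof (induction J rule: finite_induct)
  case empty
  then show ?case using assms(2) by (simp add: fps_logd_def)
next
  case (insert j J)
  have eq: "fps_const c * (\<Prod>j\<in>insert j J. U j) = U j * (fps_const c * (\<Prod>j\<in>J. U j))"
    using insert by (simp add: mult_ac)
  show ?case unfolding eq
    using insert fps_logd_mult[of "U j" "fps_const c * (\<Prod>j\<in>J. U j)"] by auto
qed

text \<open>The derivative of the linear series is 1, so this is the geometric series of its
  inverse.\<close>

lemma fps_logd_linear:
  assumes "a \<noteq> (0 :: 'a::field_char_0)"
  shows "fps_nth (fps_logd (fps_const a + fps_X)) i = (-1) ^ i * (1 / a ^ Suc i)"
proof -
  define V where "V = Abs_fps (\<lambda>i. (-1) ^ i * (1 / a ^ Suc i))"
  have "(fps_const a + fps_X) * V = 1"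
  proof (rule fps_ext)
    show "fps_nth ((fps_const a + fps_X) * V) n = fps_nth 1 n" for n
      using assms by (cases n) (simp_all add: V_def distrib_right)
  qed
  then have "inverse (fps_const a + fps_X) = V" by (rule fps_inverse_unique)
  then show ?thesis by (simp add: fps_logd_def V_def)
qed


section \<open>From a differential equation to a relation\<close>

context padic_complex_field
begin

lemma fps_of_mult_poly:
  "fps_of_poly (pcompose mult_poly [:of_nat (s * m), 1:]) =
     fps_const ((-1) ^ s) * (\<Prod>j\<in>unit_indices p s. fps_const (of_nat (s * m + j)) + fps_X)"
proof -
  have "pcompose mult_poly [:of_nat (s * m), 1:] =
      [:(-1) ^ s:] * (\<Prod>j\<in>unit_indices p s. [:of_nat (s * m + j), 1:])"
    by (simp add: mult_poly_def pcompose_mult pcompose_prod pcompose_pCons add.commute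
        del: mult_pCons_left)
  then show ?thesis
    by (simp add: fps_of_poly_mult fps_of_poly_prod fps_of_poly_pCons del: mult_pCons_left)
qed

text \<open>Products of Taylor series become sums of logarithmic derivatives, and each linear factor
  of the multiplier contributes one geometric series.\<close>

lemma morita_gamma_shift_system:
  fixes Y :: "nat \<Rightarrow> 'a fps"
  assumes jets: "\<And>k m. (deriv_on Zp ^^ k) (morita_gamma p) (of_nat (s * m)) = fact k * fps_nth (Y m) k"
    and Y_Suc: "\<And>m. Y (Suc m) = fps_of_poly (pcompose mult_poly [:of_nat (s * m), 1:]) * Y m"
  shows "shift_system s (unit_indices p s) ((-1) ^ s) (\<lambda>m. fps_nth (Y m) 0)
    (\<lambda>i m. fps_nth (fps_logd (Y m)) i)"
proof
  have s2: "s \<ge> 2"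
    using self_le_power[of p 4] prime_ge_2_nat[OF prime_p] by (simp add: s_def)
  show "1 \<in> unit_indices p s"
    using s2 prime_gt_1_nat[OF prime_p] by (simp add: unit_indices_def)
  show "unit_indices p s \<subseteq> {1..<s}"
    by (auto simp: unit_indices_def intro!: Suc_leI Nat.gr0I)
  show "(-1) ^ s \<noteq> (0 :: 'a)" by simp
  show F0: "fps_nth (Y m) 0 \<noteq> 0" for m
  proof -
    have "fps_nth (Y m) 0 = of_int (int_gamma p (s * m))"
      using jets[of 0 m] morita_gamma_of_nat[of "s * m"] by simp
    then show ?thesis using int_gamma_nonzero by simp
  qed
  have nz: "(of_nat (s * m + j) :: 'a) \<noteq> 0" if "j \<in> unit_indices p s" for m j
  proof -
    have "s * m + j \<noteq> 0" using that by (auto simp: unit_indices_def)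
    then show ?thesis by (simp only: of_nat_eq_0_iff not_False_eq_True)
  qed
  let ?U = "\<lambda>m j. fps_const (of_nat (s * m + j) :: 'a) + fps_X"
  have logd: "fps_logd (fps_const ((-1) ^ s) * (\<Prod>j\<in>unit_indices p s. ?U m j)) =
      (\<Sum>j\<in>unit_indices p s. fps_logd (?U m j))"
    and nz': "fps_nth (fps_const ((-1) ^ s) * (\<Prod>j\<in>unit_indices p s. ?U m j)) 0 \<noteq> 0" for m
    using fps_logd_const_mult_prod[of "unit_indices p s" "(-1) ^ s" "?U m"] nz
    by (auto simp del: of_nat_add of_nat_mult)
  show "fps_nth (Y (Suc m)) 0 = (-1) ^ s * (\<Prod>j\<in>unit_indices p s. of_nat (s * m + j)) * fps_nth (Y m) 0" for m
    unfolding Y_Suc fps_of_mult_poly by (simp add: fps_nth_0_prod del: of_nat_add of_nat_mult)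
  show "fps_nth (fps_logd (Y (Suc m))) i = fps_nth (fps_logd (Y m)) i +
      (-1) ^ i * (\<Sum>j\<in>unit_indices p s. 1 / of_nat (s * m + j) ^ Suc i)" for i m
    unfolding Y_Suc fps_of_mult_poly fps_logd_mult[OF nz' F0] logd
    by (simp add: fps_sum_nth fps_logd_linear[OF nz] sum_distrib_left del: of_nat_add of_nat_mult power_Suc)
qed

text \<open>Derivatives up to order \<open>n\<close> involve \<open>h 0, ..., h (n - 1)\<close>, so
  the relation uses \<open>n\<close> of the sequences \<open>H i\<close>. Its triviality makes
  \<open>Q\<close> vanish identically, and the substitution \<open>V\<close> reaches every
  \<open>v\<close> with \<open>v 1 \<noteq> 0\<close>.\<close>

lemma no_differential_equation:
  fixes P :: "'a mpolynomial"
  assumes vars: "mpoly_vars P \<subseteq> {0..Suc n}"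
    and zero: "\<And>x. x \<in> Zp \<Longrightarrow> mpoly_eval P (jet_on Zp (morita_gamma p) x) = 0"
  shows "P = 0"
proof -
  obtain Y :: "nat \<Rightarrow> 'a fps" where
    jets: "\<And>k m. (deriv_on Zp ^^ k) (morita_gamma p) (of_nat (s * m)) = fact k * fps_nth (Y m) k"
    and Y_Suc: "\<And>m. Y (Suc m) = fps_of_poly (pcompose mult_poly [:of_nat (s * m), 1:]) * Y m"
    by (rule morita_gamma_jets) blast
  interpret shift_system s "unit_indices p s" "(-1) ^ s" "\<lambda>m. fps_nth (Y m) 0"
    "\<lambda>i m. fps_nth (fps_logd (Y m)) i"
    by (rule morita_gamma_shift_system[OF jets Y_Suc])
  define V where "V x F h = (\<lambda>i. case i of 0 \<Rightarrow> x | Suc k \<Rightarrow> fact k * log_jet F h k)" for x F :: 'a and h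
  define Q where "Q x F h = mpoly_eval P (V x F h)" for x F h
  have "poly_fun n (\<lambda>x F h. V x F h i)" if "i \<le> Suc n" for i
    using that unfolding V_def
    by (cases i) (auto intro: poly_fun_X poly_fun_mult poly_fun_const poly_fun_log_jet)
  moreover have "i \<le> Suc n" if "m \<in> Poly_Mapping.keys P" "i \<in> Poly_Mapping.keys m" for m i
    using vars that by (auto simp: mpoly_vars_def)
  ultimately have "poly_fun n Q"
    unfolding Q_def mpoly_eval_def
    by (intro poly_fun_sum poly_fun_mult poly_fun_const poly_fun_prod poly_fun_power) blast
  then obtain T A where T: "finite T" "\<forall>t\<in>T. snd t \<in> extensional {..<n}"
    and Q: "\<And>x F h. Q x F h = (\<Sum>t\<in>T. poly (A t) x * (F ^ fst t * (\<Prod>i<n. h i ^ snd t i)))"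
    unfolding poly_fun_def by blast
  have "Q (of_nat (s * m)) (fps_nth (Y m) 0) (fps_nth (fps_logd (Y m))) = 0" for m
  proof -
    have "V (of_nat (s * m)) (fps_nth (Y m) 0) (fps_nth (fps_logd (Y m))) i =
        jet_on Zp (morita_gamma p) (of_nat (s * m)) i" for i
      using log_jet_eq[OF fps_logd_times[OF F_nonzero[of m], symmetric]] jets[of _ m]
      by (simp add: V_def jet_on_def split: nat.split)
    then have "V (of_nat (s * m)) (fps_nth (Y m) 0) (fps_nth (fps_logd (Y m))) =
        jet_on Zp (morita_gamma p) (of_nat (s * m))" by (rule ext)
    then show ?thesis using zero[OF Zp_of_nat] unfolding Q_def by (simp only:)
  qed
  then have vanish: "(\<Sum>t\<in>T. poly (A t) (of_nat (s * m)) * mono_at n t m) = 0" for m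
    unfolding Q mono_at_def .
  \<comment> \<open>The coefficients of a relation are rational in \<open>m\<close>, while the
    \<open>A t\<close> are evaluated at \<open>s m\<close>; composition with \<open>s X\<close>
    reconciles the two.\<close>
  have A_seq: "(\<lambda>m. poly (A t) (of_nat (s * m))) =
      (\<lambda>m. poly (pcompose (A t) [:0, of_nat s:]) (of_nat m))" for t
    by (simp add: poly_pcompose mult.commute fun_eq_iff)
  have rel: "relation n T (\<lambda>t m. poly (A t) (of_nat (s * m)))"
  proof -
    have "\<forall>\<^sub>F m in sequentially. (\<Sum>t\<in>T. poly (A t) (of_nat (s * m)) * mono_at n t m) = 0"
      using vanish by (intro always_eventually allI)
    moreover have "(\<lambda>m. poly (A t) (of_nat (s * m))) \<in> rational_seq" for t
      unfolding A_seq by (rule rational_seq_poly)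
    ultimately show ?thesis unfolding relation_def using T by blast
  qed
  have "A t = 0" if "t \<in> T" for t
  proof -
    have "\<forall>\<^sub>F m in sequentially. poly (pcompose (A t) [:0, of_nat s:]) (of_nat m) = 0"
      using relation_trivial[OF rel that] by (simp add: poly_pcompose mult.commute)
    then have "pcompose (A t) [:0, of_nat s:] = 0" by (rule poly_eventually_zero_imp_zero)
    then show ?thesis using s_nonzero by (subst (asm) pcompose_eq_0_iff) auto
  qed
  then have Q0: "Q x F h = 0" for x F h unfolding Q by simp
  show "P = 0"
  proof (rule mpoly_eq_0I)
    fix v :: "nat \<Rightarrow> 'a" assume v: "v 1 \<noteq> 0"
    \<comment> \<open>A series with the prescribed derivatives \<open>v 1, v 2, ...\<close> at 0.
      Its constant term is \<open>v 1 \<noteq> 0\<close>, so its logarithmic derivative exists and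
      supplies a preimage of \<open>v\<close> under \<open>V\<close>.\<close>
    define W where "W = Abs_fps (\<lambda>k. v (Suc k) / fact k)"
    have W0: "fps_nth W 0 = v 1" by (simp add: W_def)
    have "V (v 0) (v 1) (fps_nth (fps_logd W)) i = v i" for i
      using log_jet_eq[OF fps_logd_times[of W, symmetric]] v
      by (auto simp: V_def W0 W_def split: nat.split)
    then have "V (v 0) (v 1) (fps_nth (fps_logd W)) = v" by (rule ext)
    then show "mpoly_eval P v = 0" using Q0[of "v 0" "v 1" "fps_nth (fps_logd W)"] by (simp add: Q_def)
  qed
qed

end

theorem theorem2:
  fixes p :: nat
  assumes "prime p"
    and "is_padic_complex p TYPE('a::nonarch_field)"
  shows "\<not> (\<exists>(n::nat) (P :: 'a mpolynomial).
           P \<noteq> 0 \<and> mpoly_vars P \<subseteq> {0..Suc n} \<and>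
           (\<forall>x \<in> padic_integers.
              mpoly_eval P (jet_on padic_integers (morita_gamma p) x) = 0))"
proof -
  interpret padic_complex_field p "TYPE('a)"
    by unfold_locales (fact assms)+
  show ?thesis using no_differential_equation by blast
qed

end
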